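(* There is a QPTAS (i.e., for every fixed $\epsilon>0$ an algorithm with running time $2^{(\log n)^{O(1)}}$ computing a $(1+\epsilon)$-approximate solution) for GSP, assuming that each cost function $f_j$ can be expressed as $f_j=w_j\cdot g_{u(j)}$ for some job-dependent weight $w_j$ and at most $k=(\log n)^{O(1)}$ global functions $g_1,\dots,g_k$ (with $u:J\to[k]$), that the jobs have at most $(\log n)^{O(1)}$ distinct release dates, and that the weights $w_j$ are integers bounded by $W=2^{(\log n)^{O(1)}}$.
   Context: General Scheduling Problem (GSP): the input is a set $J$ of $n$ jobs, each job $j$ with a processing time $p_j$, a release date $r_j$, and a non-decreasing non-negative cost function $f_j$. One computes a preemptive schedule on a single unit-speed machine in which no job is processed before its release date, minimizing $\sum_{j}f_j(C_j)$, where $C_j$ is the completion time of job $j$. Here the functions $g_1,\dots,g_k$ are non-decreasing and non-negative.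
   Formalization: The running time is 2^{(log n)^{O(1)}} times a polynomial in the largest bit length of p_j, r_j and the g_i values, as no bit-cost bound in n alone is possible; p_j (positive) and r_j are integers, and the g_i are given by an oracle with rational values at integer times. *)

theory Defs
  imports Complex_Main "HOL-Library.Log_Nat"
begin

section \<open>The General Scheduling Problem\<close>

text \<open>Jobs are \<open>0, \<dots>, njobs I - 1\<close>. Processing times and release dates are integers (the usual
  input convention); schedules and cost functions live on the real time axis.\<close>

record gsp =
  njobs :: nat
  proc :: "nat \<Rightarrow> nat"
  release :: "nat \<Rightarrow> nat"
  cost_fun :: "nat \<Rightarrow> real \<Rightarrow> real"

definition cost_function :: "(real \<Rightarrow> real) \<Rightarrow> bool" where
  "cost_function f \<longleftrightarrow> mono_on {0..} f \<and> (\<forall>t\<ge>0. 0 \<le> f t)"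

definition valid_gsp :: "gsp \<Rightarrow> bool" where
  "valid_gsp I \<longleftrightarrow> (\<forall>j<njobs I. 0 < proc I j \<and> cost_function (cost_fun I j))"

text \<open>A piece \<open>(j, a, b)\<close> means that job \<open>j\<close> is processed, at unit speed, during \<open>[a, b)\<close>.
  A preemptive schedule is a finite list of pieces in chronological order.\<close>

type_synonym schedule = "(nat \<times> real \<times> real) list"

definition feasible :: "gsp \<Rightarrow> schedule \<Rightarrow> bool" where
  "feasible I S \<longleftrightarrow>
     (\<forall>(j, a, b) \<in> set S. j < njobs I \<and> real (release I j) \<le> a \<and> a < b) \<and>
     sorted_wrt (\<lambda>(_, _, b) (_, a', _). b \<le> a') S \<and>
     (\<forall>j<njobs I. (\<Sum>(i, a, b)\<leftarrow>S. if i = j then b - a else 0) = real (proc I j))"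

definition completion :: "schedule \<Rightarrow> nat \<Rightarrow> real" where
  "completion S j = Max {b. \<exists>a. (j, a, b) \<in> set S}"

definition total_cost :: "gsp \<Rightarrow> schedule \<Rightarrow> real" where
  "total_cost I S = (\<Sum>j<njobs I. cost_fun I j (completion S j))"

definition opt_cost :: "gsp \<Rightarrow> real" where
  "opt_cost I = Inf (total_cost I ` {S. feasible I S})"

definition approx_solution :: "real \<Rightarrow> gsp \<Rightarrow> schedule \<Rightarrow> bool" where
  "approx_solution \<alpha> I S \<longleftrightarrow> feasible I S \<and> total_cost I S \<le> \<alpha> * opt_cost I"

definition factors_through ::
  "gsp \<Rightarrow> nat \<Rightarrow> (nat \<Rightarrow> real \<Rightarrow> real) \<Rightarrow> (nat \<Rightarrow> nat) \<Rightarrow> (nat \<Rightarrow> nat) \<Rightarrow> bool" where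
  "factors_through I k g w u \<longleftrightarrow>
     (\<forall>i<k. cost_function (g i)) \<and>
     (\<forall>j<njobs I. u j < k \<and> (\<forall>t\<ge>0. cost_fun I j t = real (w j) * g (u j) t))"


section \<open>Growth rates\<close>

text \<open>Growth \<open>(log n)\<^bsup>O(1)\<^esup>\<close> and \<open>2\<^bsup>(log n)\<^bsup>O(1)\<^esup>\<^esup>\<close>.\<close>

definition polylog :: "(nat \<Rightarrow> real) \<Rightarrow> bool" where
  "polylog h \<longleftrightarrow> (\<exists>c::nat. \<forall>\<^sub>F n in sequentially. h n \<le> log 2 (real n) ^ c)"

definition quasi_poly :: "(nat \<Rightarrow> real) \<Rightarrow> bool" where
  "quasi_poly h \<longleftrightarrow> (\<exists>c::nat. \<forall>\<^sub>F n in sequentially. h n \<le> 2 powr (log 2 (real n) ^ c))"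


section \<open>Model of computation\<close>

text \<open>Structured programs for a random access machine with logarithmic cost: the memory maps
  addresses to natural numbers, \<open>Mem\<close> gives indirect addressing, and every operation is charged
  one unit plus the bit length of its result; operands are charged when they are evaluated, so
  each step is charged for all addresses and numbers it touches.
  The global cost functions are available through a value oracle \<open>q\<close>: the rational number
  \<open>g\<^sub>i(t)\<close> at an integer time \<open>t\<close> is the quotient of the two components of \<open>q i t\<close>.\<close>

type_synonym memory = "nat \<Rightarrow> nat"
type_synonym oracle_fun = "nat \<Rightarrow> nat \<Rightarrow> nat \<times> nat"

datatype expr =
    Const nat
  | Mem expr
  | Add expr expr
  | Sub expr expr
  | Mul expr expr
  | Div expr expr
  | QNum expr expr
  | QDen expr expr

fun val :: "oracle_fun \<Rightarrow> memory \<Rightarrow> expr \<Rightarrow> nat" where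
  "val q M (Const c) = c"
| "val q M (Mem e) = M (val q M e)"
| "val q M (Add e e') = val q M e + val q M e'"
| "val q M (Sub e e') = val q M e - val q M e'"
| "val q M (Mul e e') = val q M e * val q M e'"
| "val q M (Div e e') = val q M e div val q M e'"
| "val q M (QNum e e') = fst (q (val q M e) (val q M e'))"
| "val q M (QDen e e') = snd (q (val q M e) (val q M e'))"

abbreviation bits :: "nat \<Rightarrow> nat" where
  "bits x \<equiv> floorlog 2 x"

fun eval_cost :: "oracle_fun \<Rightarrow> memory \<Rightarrow> expr \<Rightarrow> nat" where
  "eval_cost q M (Const c) = 1 + bits c"
| "eval_cost q M (Mem e) = 1 + bits (val q M (Mem e)) + eval_cost q M e"
| "eval_cost q M (Add e e') = 1 + bits (val q M (Add e e')) + eval_cost q M e + eval_cost q M e'"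
| "eval_cost q M (Sub e e') = 1 + bits (val q M (Sub e e')) + eval_cost q M e + eval_cost q M e'"
| "eval_cost q M (Mul e e') = 1 + bits (val q M (Mul e e')) + eval_cost q M e + eval_cost q M e'"
| "eval_cost q M (Div e e') = 1 + bits (val q M (Div e e')) + eval_cost q M e + eval_cost q M e'"
| "eval_cost q M (QNum e e') = 1 + bits (val q M (QNum e e')) + eval_cost q M e + eval_cost q M e'"
| "eval_cost q M (QDen e e') = 1 + bits (val q M (QDen e e')) + eval_cost q M e + eval_cost q M e'"

datatype prog =
    Skip
  | Store expr expr
  | Seq prog prog
  | Cond expr prog prog
  | While expr prog

inductive exec :: "oracle_fun \<Rightarrow> prog \<Rightarrow> memory \<Rightarrow> nat \<Rightarrow> memory \<Rightarrow> bool" for q where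
  Skip: "exec q Skip M 1 M"
| Store: "exec q (Store a e) M (1 + eval_cost q M a + eval_cost q M e)
            (M(val q M a := val q M e))"
| Seq: "exec q P M s M' \<Longrightarrow> exec q P' M' t M'' \<Longrightarrow> exec q (Seq P P') M (s + t) M''"
| Cond_True: "val q M e \<noteq> 0 \<Longrightarrow> exec q P M t M' \<Longrightarrow>
    exec q (Cond e P P') M (1 + eval_cost q M e + t) M'"
| Cond_False: "val q M e = 0 \<Longrightarrow> exec q P' M t M' \<Longrightarrow>
    exec q (Cond e P P') M (1 + eval_cost q M e + t) M'"
| While_True: "val q M e \<noteq> 0 \<Longrightarrow> exec q P M s M' \<Longrightarrow> exec q (While e P) M' t M'' \<Longrightarrow>
    exec q (While e P) M (1 + eval_cost q M e + s + t) M''"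
| While_False: "val q M e = 0 \<Longrightarrow> exec q (While e P) M (1 + eval_cost q M e) M"

inductive_cases exec_SkipE: "exec q Skip M t M'"
inductive_cases exec_StoreE: "exec q (Store a e) M t M'"
inductive_cases exec_SeqE: "exec q (Seq P P') M t M'"
inductive_cases exec_CondE: "exec q (Cond e P P') M t M'"
inductive_cases exec_WhileE: "exec q (While e P) M t M'"

lemma exec_deterministic:
  "exec q P M t M' \<Longrightarrow> exec q P M s N' \<Longrightarrow> t = s \<and> M' = N'"
proof (induction arbitrary: s N' rule: exec.induct)
  case (Skip M)
  then show ?case by (elim exec_SkipE) simp
next
  case (Store a e M)
  then show ?case by (elim exec_StoreE) simp
next
  case (Seq P M s1 M' P' t M'')
  show ?case
  proof (rule exec_SeqE[OF Seq.prems], goal_cases)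
    case (1 s2 L t2)
    with Seq.IH(1)[OF 1(2)] Seq.IH(2)[of t2 N'] show ?case by metis
  qed
next
  case (Cond_True M e P t M' P')
  show ?case
  proof (rule exec_CondE[OF Cond_True.prems], goal_cases)
    case (1 t2)
    with Cond_True.IH[OF 1(3)] show ?case by linarith
  next
    case (2 t2)
    with Cond_True.hyps(1) show ?case by linarith
  qed
next
  case (Cond_False M e P' t M' P)
  show ?case
  proof (rule exec_CondE[OF Cond_False.prems], goal_cases)
    case (1 t2)
    with Cond_False.hyps(1) show ?case by linarith
  next
    case (2 t2)
    with Cond_False.IH[OF 2(3)] show ?case by linarith
  qed
next
  case (While_True M e P s1 M' t M'')
  show ?case
  proof (rule exec_WhileE[OF While_True.prems], goal_cases)
    case (1 s2 L t2)
    from While_True.IH(1)[OF 1(3)] have eq: "s1 = s2" "M' = L" by blast+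
    from 1(4) have "exec q (While e P) M' t2 N'" unfolding eq .
    from While_True.IH(2)[OF this] eq 1(1) show ?case by linarith
  next
    case 2
    with While_True.hyps(1) show ?case by linarith
  qed
next
  case (While_False M e P)
  show ?case
  proof (rule exec_WhileE[OF While_False.prems], goal_cases)
    case (1 s2 L t2)
    with While_False.hyps show ?case by linarith
  next
    case 2
    then show ?case by simp
  qed
qed


section \<open>Input and output conventions\<close>

definition value_oracle :: "nat \<Rightarrow> (nat \<Rightarrow> real \<Rightarrow> real) \<Rightarrow> oracle_fun \<Rightarrow> bool" where
  "value_oracle k g q \<longleftrightarrow>
     (\<forall>i<k. \<forall>t. 0 < snd (q i t) \<and> g i (real t) = real (fst (q i t)) / real (snd (q i t)))"

text \<open>Cells 0 and 1 hold \<open>n\<close> and \<open>k\<close>; job \<open>j\<close> occupies cells \<open>4j + 2, \<dots>, 4j + 5\<close>.\<close>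

definition input_memory :: "gsp \<Rightarrow> nat \<Rightarrow> (nat \<Rightarrow> nat) \<Rightarrow> (nat \<Rightarrow> nat) \<Rightarrow> memory" where
  "input_memory I k w u a =
     (if a = 0 then njobs I
      else if a = 1 then k
      else let j = (a - 2) div 4 in
        if j < njobs I then [proc I j, release I j, w j, u j] ! ((a - 2) mod 4) else 0)"

text \<open>Cell 0 holds the number of pieces; piece \<open>i\<close> occupies cells \<open>3i + 1, \<dots>, 3i + 3\<close>.\<close>

definition output_schedule :: "memory \<Rightarrow> schedule" where
  "output_schedule M =
     map (\<lambda>i. (M (3 * i + 1), real (M (3 * i + 2)), real (M (3 * i + 3)))) [0..<M 0]"

text \<open>A schedule that is never idle after the last release date ends by the horizon.\<close>

definition horizon :: "gsp \<Rightarrow> nat" where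
  "horizon I = Max (insert 0 (release I ` {..<njobs I})) + (\<Sum>j<njobs I. proc I j)"

text \<open>The largest bit length of a processing time, a release date, or a value of a global cost
  function up to the horizon. Operations are charged by bit length and these numbers are not
  bounded in terms of \<open>n\<close>, so running times are stated as a quasi-polynomial in \<open>n\<close> times a
  polynomial in this length.\<close>

definition number_length :: "gsp \<Rightarrow> nat \<Rightarrow> oracle_fun \<Rightarrow> nat" where
  "number_length I k q =
     Max (insert 1 (bits ` (proc I ` {..<njobs I} \<union> release I ` {..<njobs I} \<union>
       (\<Union>i<k. \<Union>t\<le>horizon I. {fst (q i t), snd (q i t)}))))"

end

theory Submission
  imports Defs
begin

text \<open>Round every weight down to a grid on which consecutive values differ by a factor of at most
  \<open>1 + 1/N\<close>, up to integrality. Jobs with the same release date, global function and rounded weight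
  form a class; there are only \<open>(log n)\<^bsup>O(1)\<^esup>\<close> classes, and within a class shorter jobs may be
  assumed to finish first. A set of jobs that finish first is therefore described by one counter
  per class, which gives \<open>n\<^bsup>(log n)\<^bsup>O(1)\<^esup>\<^esup>\<close> states. The dynamic program over these states charges the
  job added last the cost at the makespan \<open>max\<^sub>j (r\<^sub>j + \<Sum>\<^bsub>i: r\<^sub>i \<ge> r\<^sub>j\<^esub> p\<^sub>i)\<close> of the
  state. Following the completion order of any schedule shows that the optimum of the program is a
  lower bound; conversely, giving priority to the jobs in the order found by the program lets each
  job finish by the makespan it was charged for.\<close>

section \<open>A language of bounded loops\<close>

text \<open>Only the weights are rounded. Rounding them down keeps the value computed by the program
  below the true optimum, so the factor \<open>1 + 1/N\<close> is lost just once, when the schedule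
  found is charged with the true weights. Completion times are not guessed either: an order of the
  jobs fixes one deadline per prefix, and the priority rule meets all of these deadlines at once.
  The other obstacle is the running time. Operations are charged by bit length and costs are
  fractions supplied by an oracle. The table therefore stores exact, unreduced fractions, and their
  length has to be controlled. Programs are written in a small language whose loops have a length
  fixed on entry and at most \<open>X\<close>; time is then a constant times
  \<open>(X + 1) ^ d * (b + 1)\<close> for a constant \<open>d\<close>, which leaves functional
  correctness and bounds on stored values to be checked. The program text depends on \<epsilon>
  alone; the growth bounds enter only the analysis.\<close>

datatype lexp =
    Lit nat
  | Size
  | Arr nat lexp
  | Plus lexp lexp (infixl "+:" 65)
  | Minus lexp lexp (infixl "-:" 65)
  | Times lexp lexp (infixl "*:" 70)
  | Over lexp lexp (infixl "'/:" 70)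
  | QN lexp lexp
  | QD lexp lexp

datatype com =
    Put nat lexp lexp
  | Comp com com (infixr ";;" 60)
  | If1 lexp com
  | For nat lexp com

type_synonym arrays = "nat \<Rightarrow> nat \<Rightarrow> nat"

abbreviation upd :: "arrays \<Rightarrow> nat \<Rightarrow> nat \<Rightarrow> nat \<Rightarrow> arrays" where
  "upd \<sigma> a x y \<equiv> \<sigma>(a := (\<sigma> a)(x := y))"

primrec writes :: "com \<Rightarrow> nat set" where
  "writes (Put a i e) = {a}"
| "writes (c ;; d) = writes c \<union> writes d"
| "writes (If1 e c) = writes c"
| "writes (For a e c) = insert a (writes c)"

primrec wf_exp :: "lexp \<Rightarrow> bool" where
  "wf_exp (Lit c) = True"
| "wf_exp Size = True"
| "wf_exp (Arr a e) = (a < 32 \<and> wf_exp e)"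
| "wf_exp (e +: f) = (wf_exp e \<and> wf_exp f)"
| "wf_exp (e -: f) = (wf_exp e \<and> wf_exp f)"
| "wf_exp (e *: f) = (wf_exp e \<and> wf_exp f)"
| "wf_exp (e /: f) = (wf_exp e \<and> wf_exp f)"
| "wf_exp (QN e f) = (wf_exp e \<and> wf_exp f)"
| "wf_exp (QD e f) = (wf_exp e \<and> wf_exp f)"

primrec wf_com :: "com \<Rightarrow> bool" where
  "wf_com (Put a i e) = (a < 32 \<and> wf_exp i \<and> wf_exp e)"
| "wf_com (c ;; d) = (wf_com c \<and> wf_com d)"
| "wf_com (If1 e c) = (wf_exp e \<and> wf_com c)"
| "wf_com (For a e c) = (0 < a \<and> a < 32 \<and> wf_exp e \<and> a \<notin> writes c \<and> wf_com c)"

text \<open>Array 0 is the memory below \<open>base n\<close>, which holds the input and later the output. The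
  other arrays are interleaved above it, so none of them needs a length.\<close>

definition base :: "nat \<Rightarrow> nat" where
  "base n = 10 * ((n + 1) * (n + 1))"

definition addr :: "nat \<Rightarrow> nat \<Rightarrow> nat \<Rightarrow> nat" where
  "addr n a x = (if a = 0 then x else base n + (32 * x + a))"

text \<open>The base depends on the input size, so compiled code recomputes it at every access from
  memory cell 0, which keeps \<open>n\<close> until the very last store.\<close>

definition addr_expr :: "nat \<Rightarrow> expr \<Rightarrow> expr" where
  "addr_expr a e =
     (if a = 0 then e
      else Add (Mul (Const 10) (Mul (Add (Mem (Const 0)) (Const 1)) (Add (Mem (Const 0)) (Const 1))))
               (Add (Mul (Const 32) e) (Const a)))"

primrec compile_exp :: "lexp \<Rightarrow> expr" where
  "compile_exp (Lit c) = Const c"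
| "compile_exp Size = Mem (Const 0)"
| "compile_exp (Arr a e) = Mem (addr_expr a (compile_exp e))"
| "compile_exp (e +: f) = Add (compile_exp e) (compile_exp f)"
| "compile_exp (e -: f) = Sub (compile_exp e) (compile_exp f)"
| "compile_exp (e *: f) = Mul (compile_exp e) (compile_exp f)"
| "compile_exp (e /: f) = Div (compile_exp e) (compile_exp f)"
| "compile_exp (QN e f) = QNum (compile_exp e) (compile_exp f)"
| "compile_exp (QD e f) = QDen (compile_exp e) (compile_exp f)"

abbreviation put :: "nat \<Rightarrow> lexp \<Rightarrow> lexp \<Rightarrow> prog" where
  "put a i e \<equiv> Store (addr_expr a (compile_exp i)) (compile_exp e)"

primrec compile :: "com \<Rightarrow> prog" where
  "compile (Put a i e) = put a i e"
| "compile (c ;; d) = Seq (compile c) (compile d)"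
| "compile (If1 e c) = Cond (compile_exp e) (compile c) Skip"
| "compile (For a e c) =
     Seq (put a (Lit 1) e)
    (Seq (put a (Lit 0) (Lit 0))
         (While (compile_exp (Arr a (Lit 1) -: Arr a (Lit 0)))
            (Seq (compile c) (put a (Lit 0) (Arr a (Lit 0) +: Lit 1)))))"


subsection \<open>Running time of expressions\<close>

primrec expr_size :: "expr \<Rightarrow> nat" where
  "expr_size (Const c) = 1"
| "expr_size (Mem e) = 1 + expr_size e"
| "expr_size (Add e f) = 1 + expr_size e + expr_size f"
| "expr_size (Sub e f) = 1 + expr_size e + expr_size f"
| "expr_size (Mul e f) = 1 + expr_size e + expr_size f"
| "expr_size (Div e f) = 1 + expr_size e + expr_size f"
| "expr_size (QNum e f) = 1 + expr_size e + expr_size f"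
| "expr_size (QDen e f) = 1 + expr_size e + expr_size f"

text \<open>Constants and oracle answers are the only values that need a bound of their own: memory
  contents are bounded by a hypothesis on \<open>M\<close>, results of arithmetic by
  \<open>val_bound\<close>.\<close>

primrec small :: "oracle_fun \<Rightarrow> nat \<Rightarrow> memory \<Rightarrow> expr \<Rightarrow> bool" where
  "small q b M (Const c) = (c < 2 ^ b)"
| "small q b M (Mem e) = small q b M e"
| "small q b M (Add e f) = (small q b M e \<and> small q b M f)"
| "small q b M (Sub e f) = (small q b M e \<and> small q b M f)"
| "small q b M (Mul e f) = (small q b M e \<and> small q b M f)"
| "small q b M (Div e f) = (small q b M e \<and> small q b M f)"
| "small q b M (QNum e f) = (small q b M e \<and> small q b M f \<and> val q M (QNum e f) < 2 ^ b)"
| "small q b M (QDen e f) = (small q b M e \<and> small q b M f \<and> val q M (QDen e f) < 2 ^ b)"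

lemma less_power2_mono: "x < 2 ^ s \<Longrightarrow> s \<le> t \<Longrightarrow> x < (2::nat) ^ t"
  by (meson less_le_trans one_le_numeral power_increasing)

text \<open>No arithmetic operation yields more bits than its operands have together, apart from the
  carry of an addition, which is absorbed by the \<open>b\<close> bits granted to the node
  itself.\<close>

lemma val_bound:
  assumes "\<And>a. M a < 2 ^ b" "small q b M e" "0 < b"
  shows "val q M e < 2 ^ (b * expr_size e)"
  using assms(2)
proof (induction e)
  case (Const c)
  then show ?case by simp
next
  case (Mem e)
  show ?case using less_power2_mono[OF assms(1)] by simp
next
  case (Add e f)
  then have "val q M e < 2 ^ (b * expr_size e)" "val q M f < 2 ^ (b * expr_size f)"
    by auto
  then have *: "val q M e < 2 ^ (b * expr_size e + b * expr_size f)"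
    "val q M f < 2 ^ (b * expr_size e + b * expr_size f)"
    by (auto intro: less_power2_mono)
  have "val q M (Add e f) < 2 ^ (1 + (b * expr_size e + b * expr_size f))"
    using * by simp
  then show ?case
    by (rule less_power2_mono) (use assms(3) in \<open>simp add: algebra_simps\<close>)
next
  case (Sub e f)
  then have "val q M e < 2 ^ (b * expr_size e)" by auto
  then have "val q M (Sub e f) < 2 ^ (b * expr_size e)" by simp
  then show ?case by (rule less_power2_mono) (simp add: algebra_simps)
next
  case (Mul e f)
  then have "val q M e < 2 ^ (b * expr_size e)" "val q M f < 2 ^ (b * expr_size f)"
    by auto
  then have "val q M (Mul e f) < 2 ^ (b * expr_size e + b * expr_size f)"
    by (simp add: power_add mult_strict_mono)
  then show ?case by (rule less_power2_mono) (simp add: algebra_simps)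
next
  case (Div e f)
  then have "val q M e < 2 ^ (b * expr_size e)" by auto
  then have "val q M (Div e f) < 2 ^ (b * expr_size e)"
    by (metis div_le_dividend le_less_trans val.simps(6))
  then show ?case by (rule less_power2_mono) (simp add: algebra_simps)
next
  case (QNum e f)
  then have "val q M (QNum e f) < 2 ^ b" by (simp only: small.simps)
  then show ?case by (rule less_power2_mono) simp
next
  case (QDen e f)
  then have "val q M (QDen e f) < 2 ^ b" by (simp only: small.simps)
  then show ?case by (rule less_power2_mono) simp
qed

lemma bits_val_bound:
  assumes "\<And>a. M a < 2 ^ b" "small q b M e" "0 < b" "expr_size e \<le> m"
  shows "bits (val q M e) \<le> b * m"
proof -
  have "val q M e < 2 ^ (b * m)"
    using val_bound[OF assms(1-3)] by (rule less_power2_mono) (use assms(4) in simp)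
  then show ?thesis by (simp add: floorlog_le_iff)
qed

lemma eval_cost_bound_aux:
  assumes M: "\<And>a. M a < 2 ^ b" and b: "0 < b" and "small q b M e" "expr_size e \<le> m"
  shows "eval_cost q M e \<le> expr_size e * (1 + b * m)"
proof -
  note B = bits_val_bound[where b = b and M = M and q = q and m = m, OF M _ b]
  show ?thesis using assms(3,4)
  proof (induction e)
    case (Const c)
    then show ?case using B[of "Const c"] by simp
  next
    case (Mem e)
    then show ?case using B[of "Mem e"] by simp
  next
    case (Add e f)
    then show ?case using B[of "Add e f"] by (simp add: algebra_simps)
  next
    case (Sub e f)
    then show ?case using B[of "Sub e f"] by (simp add: algebra_simps)
  next
    case (Mul e f)
    then show ?case using B[of "Mul e f"] by (simp add: algebra_simps)
  next
    case (Div e f)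
    then show ?case using B[of "Div e f"] by (simp add: algebra_simps)
  next
    case (QNum e f)
    then show ?case using B[of "QNum e f"] by (simp add: algebra_simps)
  next
    case (QDen e f)
    then show ?case using B[of "QDen e f"] by (simp add: algebra_simps)
  qed
qed

text \<open>Splits the cost into a part that depends on the program text only, hence a constant for
  fixed \<epsilon>, and the factor \<open>b + 1\<close>.\<close>

definition expr_weight :: "expr \<Rightarrow> nat" where
  "expr_weight e = expr_size e * (1 + expr_size e)"

lemma eval_cost_bound:
  assumes "\<And>a. M a < 2 ^ b" "0 < b" "small q b M e"
  shows "eval_cost q M e \<le> expr_weight e * (b + 1)"
proof -
  have "eval_cost q M e \<le> expr_size e * (1 + b * expr_size e)"
    by (rule eval_cost_bound_aux) (use assms in auto)
  also have "\<dots> \<le> expr_weight e * (b + 1)"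
    by (simp add: expr_weight_def algebra_simps)
  finally show ?thesis .
qed

abbreviation put_weight :: "nat \<Rightarrow> lexp \<Rightarrow> lexp \<Rightarrow> nat" where
  "put_weight a i e \<equiv>
     1 + expr_weight (addr_expr a (compile_exp i)) + expr_weight (compile_exp e)"

primrec weight :: "com \<Rightarrow> nat" where
  "weight (Put a i e) = put_weight a i e"
| "weight (c ;; d) = weight c + weight d"
| "weight (If1 e c) = 2 + expr_weight (compile_exp e) + weight c"
| "weight (For a e c) =
     put_weight a (Lit 1) e + put_weight a (Lit 0) (Lit 0) +
     (1 + expr_weight (compile_exp (Arr a (Lit 1) -: Arr a (Lit 0)))) +
     put_weight a (Lit 0) (Arr a (Lit 0) +: Lit 1) + weight c"

primrec depth :: "com \<Rightarrow> nat" where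
  "depth (Put a i e) = 0"
| "depth (c ;; d) = depth c + depth d"
| "depth (If1 e c) = depth c"
| "depth (For a e c) = Suc (depth c)"


subsection \<open>Semantics and compiler correctness\<close>

text \<open>Input size \<open>n\<close>; the oracle may be asked for the functions below \<open>k\<close> at times up to \<open>h\<close>;
  \<open>b\<close> bounds the bit length of all stored numbers and \<open>X\<close> the length of all loops.\<close>

locale machine =
  fixes q :: oracle_fun and n k h b X :: nat
  assumes b_large: "6 \<le> b"
    and X_small: "X < 2 ^ b"
    and n_small: "n < 2 ^ b"
    and q_small: "\<And>i t. i < k \<Longrightarrow> t \<le> h \<Longrightarrow> fst (q i t) < 2 ^ b \<and> snd (q i t) < 2 ^ b"
begin

text \<open>Cell 0 of array 0 is out of reach of programs because all addresses are computed from
  it.\<close>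

definition cell :: "nat \<Rightarrow> nat \<Rightarrow> bool" where
  "cell a x \<longleftrightarrow> a = 0 \<longrightarrow> 0 < x \<and> x < base n"

primrec lval :: "arrays \<Rightarrow> lexp \<Rightarrow> nat" where
  "lval \<sigma> (Lit c) = c"
| "lval \<sigma> Size = n"
| "lval \<sigma> (Arr a e) = \<sigma> a (lval \<sigma> e)"
| "lval \<sigma> (e +: f) = lval \<sigma> e + lval \<sigma> f"
| "lval \<sigma> (e -: f) = lval \<sigma> e - lval \<sigma> f"
| "lval \<sigma> (e *: f) = lval \<sigma> e * lval \<sigma> f"
| "lval \<sigma> (e /: f) = lval \<sigma> e div lval \<sigma> f"
| "lval \<sigma> (QN e f) = fst (q (lval \<sigma> e) (lval \<sigma> f))"
| "lval \<sigma> (QD e f) = snd (q (lval \<sigma> e) (lval \<sigma> f))"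

primrec ok_exp :: "arrays \<Rightarrow> lexp \<Rightarrow> bool" where
  "ok_exp \<sigma> (Lit c) = (c < 2 ^ b)"
| "ok_exp \<sigma> Size = True"
| "ok_exp \<sigma> (Arr a e) = (ok_exp \<sigma> e \<and> cell a (lval \<sigma> e))"
| "ok_exp \<sigma> (e +: f) = (ok_exp \<sigma> e \<and> ok_exp \<sigma> f)"
| "ok_exp \<sigma> (e -: f) = (ok_exp \<sigma> e \<and> ok_exp \<sigma> f)"
| "ok_exp \<sigma> (e *: f) = (ok_exp \<sigma> e \<and> ok_exp \<sigma> f)"
| "ok_exp \<sigma> (e /: f) = (ok_exp \<sigma> e \<and> ok_exp \<sigma> f)"
| "ok_exp \<sigma> (QN e f) = (ok_exp \<sigma> e \<and> ok_exp \<sigma> f \<and> lval \<sigma> e < k \<and> lval \<sigma> f \<le> h)"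
| "ok_exp \<sigma> (QD e f) = (ok_exp \<sigma> e \<and> ok_exp \<sigma> f \<and> lval \<sigma> e < k \<and> lval \<sigma> f \<le> h)"

definition bump :: "nat \<Rightarrow> arrays \<Rightarrow> arrays" where
  "bump a \<sigma> = upd \<sigma> a 0 (\<sigma> a 0 + 1)"

text \<open>A loop stores its bound in cell 1 of the array whose cell 0 is the counter. As the body
  may not write this array, the number of rounds is known on entry.\<close>

definition loop_init :: "nat \<Rightarrow> nat \<Rightarrow> arrays \<Rightarrow> arrays" where
  "loop_init a m \<sigma> = \<sigma>(a := (\<sigma> a)(1 := m, 0 := 0))"

fun run :: "com \<Rightarrow> arrays \<Rightarrow> arrays" where
  "run (Put a i e) \<sigma> = upd \<sigma> a (lval \<sigma> i) (lval \<sigma> e)"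
| "run (c ;; d) \<sigma> = run d (run c \<sigma>)"
| "run (If1 e c) \<sigma> = (if lval \<sigma> e = 0 then \<sigma> else run c \<sigma>)"
| "run (For a e c) \<sigma> =
     (((\<lambda>\<tau>. bump a (run c \<tau>)) ^^ lval \<sigma> e) (loop_init a (lval \<sigma> e) \<sigma>))"

text \<open>\<open>run\<close> is total; \<open>ok\<close> collects the side conditions under which
  compiled code behaves like it: stored values fit into \<open>b\<close> bits, oracle queries are in
  range, loops have at most \<open>X\<close> rounds.\<close>

primrec ok :: "com \<Rightarrow> arrays \<Rightarrow> bool" where
  "ok (Put a i e) = (\<lambda>\<sigma>.
     ok_exp \<sigma> i \<and> ok_exp \<sigma> e \<and> cell a (lval \<sigma> i) \<and> lval \<sigma> e < 2 ^ b)"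
| "ok (c ;; d) = (\<lambda>\<sigma>. ok c \<sigma> \<and> ok d (run c \<sigma>))"
| "ok (If1 e c) = (\<lambda>\<sigma>. ok_exp \<sigma> e \<and> (lval \<sigma> e \<noteq> 0 \<longrightarrow> ok c \<sigma>))"
| "ok (For a e c) = (\<lambda>\<sigma>. ok_exp \<sigma> e \<and> lval \<sigma> e \<le> X \<and>
     (\<forall>j<lval \<sigma> e. ok c (((\<lambda>\<tau>. bump a (run c \<tau>)) ^^ j) (loop_init a (lval \<sigma> e) \<sigma>))))"

definition rep :: "memory \<Rightarrow> arrays \<Rightarrow> bool" where
  "rep M \<sigma> \<longleftrightarrow> M 0 = n \<and> (\<forall>a. M a < 2 ^ b) \<and>
     (\<forall>a x. a < 32 \<longrightarrow> cell a x \<longrightarrow> M (addr n a x) = \<sigma> a x)"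

text \<open>Covers the literals of compiled code, in particular the array numbers and the constants
  10 and 32 of \<open>addr_expr\<close>. This is the purpose of \<open>6 \<le> b\<close>.\<close>

lemma numeral_small: "m < 64 \<Longrightarrow> m < (2::nat) ^ b"
  using less_power2_mono[of m 6 b] b_large by simp

text \<open>Above \<open>base n\<close>, the residue modulo 32 of the offset recovers the array and
  the quotient the index; array 0 stays below.\<close>

lemma addr_inject:
  assumes "a < 32" "a' < 32" "cell a x" "cell a' x'" "addr n a x = addr n a' x'"
  shows "a = a' \<and> x = x'"
proof (cases "a = 0 \<or> a' = 0")
  case True
  then show ?thesis using assms by (auto simp: addr_def cell_def split: if_splits)
next
  case False
  then have "32 * x + a = 32 * x' + a'" using assms by (simp add: addr_def)
  then have "(32 * x + a) mod 32 = (32 * x' + a') mod 32" by simp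
  then have "a = a'" using assms(1,2) by simp
  with \<open>32 * x + a = 32 * x' + a'\<close> show ?thesis by simp
qed

lemma addr_pos: "cell a x \<Longrightarrow> 0 < addr n a x"
  by (auto simp: addr_def cell_def)

lemma rep_upd:
  assumes "rep M \<sigma>" "a < 32" "cell a x" "y < 2 ^ b"
  shows "rep (M(addr n a x := y)) (upd \<sigma> a x y)"
proof -
  have "(M(addr n a x := y)) (addr n a' x') = upd \<sigma> a x y a' x'" if "a' < 32" "cell a' x'" for a' x'
  proof (cases "a' = a \<and> x' = x")
    case False
    then have "addr n a' x' \<noteq> addr n a x"
      using addr_inject[OF that(1) assms(2) that(2) assms(3)] by blast
    with False that assms(1) show ?thesis by (auto simp: rep_def)
  qed simp
  then show ?thesis using assms(1,4) addr_pos[OF assms(3)] by (auto simp: rep_def)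
qed

lemma compile_exp_correct:
  assumes "rep M \<sigma>"
  shows "wf_exp e \<Longrightarrow> ok_exp \<sigma> e \<Longrightarrow>
    val q M (compile_exp e) = lval \<sigma> e \<and> small q b M (compile_exp e)"
proof (induction e)
  case (Arr a e)
  have "M (addr n a (lval \<sigma> e)) = \<sigma> a (lval \<sigma> e)"
    using Arr assms by (auto simp: rep_def)
  with Arr assms show ?case
    by (auto simp: rep_def addr_expr_def addr_def base_def numeral_small)
qed (use assms in \<open>auto simp: rep_def numeral_small q_small\<close>)

lemma addr_expr_correct:
  assumes "rep M \<sigma>" "a < 32" "wf_exp e" "ok_exp \<sigma> e"
  shows "val q M (addr_expr a (compile_exp e)) = addr n a (lval \<sigma> e) \<and>
    small q b M (addr_expr a (compile_exp e))"
  using compile_exp_correct[OF assms(1,3,4)] assms(1,2)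
  by (auto simp: rep_def addr_expr_def addr_def base_def numeral_small)

lemma exec_put:
  assumes "rep M \<sigma>" "wf_com (Put a i e)" "ok (Put a i e) \<sigma>"
  shows "\<exists>t M'. exec q (put a i e) M t M' \<and> rep M' (run (Put a i e) \<sigma>) \<and>
    t \<le> put_weight a i e * (b + 1)"
proof -
  from assms have wf: "a < 32" "wf_exp i" "wf_exp e"
    and ok: "ok_exp \<sigma> i" "ok_exp \<sigma> e" "cell a (lval \<sigma> i)" "lval \<sigma> e < 2 ^ b"
    by auto
  have b: "0 < b" and M: "\<And>a. M a < 2 ^ b" using b_large assms(1) by (auto simp: rep_def)
  note A = addr_expr_correct[OF assms(1) wf(1,2) ok(1)]
  note E = compile_exp_correct[OF assms(1) wf(3) ok(2)]
  let ?a = "addr_expr a (compile_exp i)" and ?e = "compile_exp e"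
  have "exec q (put a i e) M (1 + eval_cost q M ?a + eval_cost q M ?e)
      (M(val q M ?a := val q M ?e))"
    by (rule exec.Store)
  moreover have "rep (M(val q M ?a := val q M ?e)) (run (Put a i e) \<sigma>)"
    using rep_upd[OF assms(1) wf(1) ok(3,4)] A E by simp
  moreover have "1 + eval_cost q M ?a + eval_cost q M ?e \<le> put_weight a i e * (b + 1)"
    using eval_cost_bound[where e = ?a and q = q and M = M, OF M b] eval_cost_bound[where e = ?e and q = q and M = M, OF M b] A E
    by (simp add: algebra_simps)
  ultimately show ?thesis by blast
qed

lemma run_frame: "a \<notin> writes c \<Longrightarrow> run c \<sigma> a = \<sigma> a"
proof (induction c arbitrary: \<sigma>)
  case (For a' e c)
  have "((\<lambda>\<tau>. bump a' (run c \<tau>)) ^^ m) \<tau> a = \<tau> a" for m \<tau>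
    by (induction m) (use For in \<open>auto simp: bump_def\<close>)
  then show ?case using For by (simp add: loop_init_def)
qed auto

lemma run_loop_counter:
  assumes "a \<notin> writes c"
  shows "((\<lambda>\<tau>. bump a (run c \<tau>)) ^^ j) (loop_init a m \<sigma>) a = (\<sigma> a)(0 := j, 1 := m)"
  by (induction j) (use run_frame[OF assms] in \<open>auto simp: bump_def loop_init_def\<close>)

lemma power_le_mult_power: "weight c * (X + 1) ^ d \<le> weight c * (X + 1) ^ (d + d')"
  by (simp add: power_increasing)

text \<open>Induction on the number of rounds that remain, which is the value of the test. The
  strict bound on the cost of the test leaves room for the unit that \<open>While\<close> itself is
  charged.\<close>

lemma exec_loop:
  assumes body: "\<And>M j. j < m \<Longrightarrow> rep M (f j) \<Longrightarrow>
      \<exists>t M'. exec q P M t M' \<and> rep M' (f (Suc j)) \<and> t \<le> s"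
    and test: "\<And>M j. j \<le> m \<Longrightarrow> rep M (f j) \<Longrightarrow> val q M e = m - j \<and> eval_cost q M e < s'"
    and "j \<le> m" "rep M (f j)"
  shows "\<exists>t M'. exec q (While e P) M t M' \<and> rep M' (f m) \<and> t \<le> (m - j) * (s + s') + s'"
  using assms(3,4)
proof (induction "m - j" arbitrary: j M)
  case 0
  then show ?case using test[of j M] While_False[of q M e P] by fastforce
next
  case (Suc i)
  then have "j < m" by linarith
  from body[OF this Suc.prems(2)] obtain t M' where
    1: "exec q P M t M'" "rep M' (f (Suc j))" "t \<le> s" by blast
  have "i = m - Suc j" "Suc j \<le> m" using Suc.hyps(2) by auto
  from Suc.hyps(1)[OF this 1(2)] obtain t' M'' where
    2: "exec q (While e P) M' t' M''" "rep M'' (f m)" "t' \<le> (m - Suc j) * (s + s') + s'"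
    by blast
  have e: "val q M e = m - j" "eval_cost q M e < s'" using test[of j M] Suc.prems by auto
  have "exec q (While e P) M (1 + eval_cost q M e + t + t') M''"
    using While_True[OF _ 1(1) 2(1)] e \<open>j < m\<close> by simp
  moreover have "m - j = Suc (m - Suc j)" using \<open>j < m\<close> by simp
  then have "1 + eval_cost q M e + t + t' \<le> (m - j) * (s + s') + s'"
    using e 1(3) 2(3) by simp
  ultimately show ?case using 2(2) by blast
qed

text \<open>Every expression costs a constant times \<open>b + 1\<close>, and every nested loop
  multiplies the time by at most \<open>X + 1\<close>.\<close>

theorem compile_correct:
  assumes "wf_com c" "rep M \<sigma>" "ok c \<sigma>"
  shows "\<exists>t M'. exec q (compile c) M t M' \<and> rep M' (run c \<sigma>) \<and>
    t \<le> weight c * (X + 1) ^ depth c * (b + 1)"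
  using assms
proof (induction c arbitrary: M \<sigma>)
  case (Put a i e)
  then show ?case using exec_put[of M \<sigma> a i e] by (simp del: run.simps)
next
  case (Comp c d)
  from Comp.IH(1)[of M \<sigma>] Comp.prems obtain s M' where
    1: "exec q (compile c) M s M'" "rep M' (run c \<sigma>)"
      "s \<le> weight c * (X + 1) ^ depth c * (b + 1)" by auto
  from Comp.IH(2)[OF _ 1(2)] Comp.prems obtain t M'' where
    2: "exec q (compile d) M' t M''" "rep M'' (run d (run c \<sigma>))"
      "t \<le> weight d * (X + 1) ^ depth d * (b + 1)" by auto
  have "s \<le> weight c * (X + 1) ^ (depth c + depth d) * (b + 1)"
    using 1(3) power_le_mult_power[of c "depth c" "depth d"] by (meson le_trans mult_le_mono1)
  moreover have "t \<le> weight d * (X + 1) ^ (depth c + depth d) * (b + 1)"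
    using 2(3) power_le_mult_power[of d "depth d" "depth c"]
    by (metis add.commute le_trans mult_le_mono1)
  ultimately have "s + t \<le> weight (c ;; d) * (X + 1) ^ depth (c ;; d) * (b + 1)"
    by (simp add: distrib_right)
  moreover have "exec q (compile (c ;; d)) M (s + t) M''"
    using exec.Seq[OF 1(1) 2(1)] by simp
  ultimately show ?case using 2(2) by auto
next
  case (If1 e c)
  have b: "0 < b" and M: "\<And>a. M a < 2 ^ b" using b_large If1.prems(2) by (auto simp: rep_def)
  have E: "val q M (compile_exp e) = lval \<sigma> e" "small q b M (compile_exp e)"
    using compile_exp_correct[OF If1.prems(2), of e] If1.prems by auto
  have cost: "eval_cost q M (compile_exp e) \<le> expr_weight (compile_exp e) * (b + 1)"
    by (rule eval_cost_bound[OF M b E(2)])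
  let ?Y = "(X + 1) ^ depth c"
  have Y: "1 \<le> ?Y" by simp
  have W: "weight (If1 e c) * ?Y * (b + 1) =
      (2 + expr_weight (compile_exp e)) * (b + 1) * ?Y + weight c * ?Y * (b + 1)"
    by (simp add: algebra_simps)
  have W': "(2 + expr_weight (compile_exp e)) * (b + 1) * 1 \<le>
      (2 + expr_weight (compile_exp e)) * (b + 1) * ?Y"
    using Y by (rule mult_le_mono2)
  show ?case
  proof (cases "lval \<sigma> e = 0")
    case True
    then have "exec q (compile (If1 e c)) M (1 + eval_cost q M (compile_exp e) + 1) M"
      using Cond_False[OF _ exec.Skip] E by simp
    moreover have "1 + eval_cost q M (compile_exp e) + 1 \<le> weight (If1 e c) * ?Y * (b + 1)"
      using cost W W' by (simp add: algebra_simps)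
    ultimately show ?thesis using True If1.prems by auto
  next
    case False
    with If1 obtain t M' where t: "exec q (compile c) M t M'" "rep M' (run c \<sigma>)"
      "t \<le> weight c * ?Y * (b + 1)" by fastforce
    have "exec q (compile (If1 e c)) M (1 + eval_cost q M (compile_exp e) + t) M'"
      using Cond_True[OF _ t(1)] E False by simp
    moreover have "1 + eval_cost q M (compile_exp e) + t \<le> weight (If1 e c) * ?Y * (b + 1)"
      using cost W W' t(3) by (simp add: algebra_simps)
    ultimately show ?thesis using False t(2) by auto
  qed
next
  case (For a e c)
  have b: "0 < b" using b_large by simp
  from For.prems have wf: "0 < a" "a < 32" "wf_exp e" "a \<notin> writes c" "wf_com c" by auto
  define m where "m = lval \<sigma> e"
  define f where "f j = ((\<lambda>\<tau>. bump a (run c \<tau>)) ^^ j) (loop_init a m \<sigma>)" for j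
  have mX: "m \<le> X" and okb: "\<And>j. j < m \<Longrightarrow> ok c (f j)" and oke: "ok_exp \<sigma> e"
    using For.prems by (auto simp: m_def f_def)
  have fa: "f j a = (\<sigma> a)(0 := j, 1 := m)" for j
    unfolding f_def using run_loop_counter[OF wf(4)] .
  have cell: "cell a x" for x using wf by (simp add: cell_def)
  have lits: "0 < (2::nat) ^ b" "1 < (2::nat) ^ b" using numeral_small[of 0] numeral_small[of 1] by auto
  let ?put1 = "put_weight a (Lit 1) e" and ?put2 = "put_weight a (Lit 0) (Lit 0)"
  let ?put3 = "put_weight a (Lit 0) (Arr a (Lit 0) +: Lit 1)"
  let ?t = "compile_exp (Arr a (Lit 1) -: Arr a (Lit 0))"
  let ?Y = "(X + 1) ^ depth c"
  have "ok (Put a (Lit 1) e) \<sigma>" using oke cell lits mX X_small by (simp add: m_def)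
  with exec_put[OF For.prems(2), of a "Lit 1" e] wf obtain t1 M1 where
    1: "exec q (put a (Lit 1) e) M t1 M1" "rep M1 (run (Put a (Lit 1) e) \<sigma>)"
      "t1 \<le> ?put1 * (b + 1)" by auto
  have "ok (Put a (Lit 0) (Lit 0)) (run (Put a (Lit 1) e) \<sigma>)" using cell lits by simp
  with exec_put[OF 1(2), of a "Lit 0" "Lit 0"] wf obtain t2 M2 where
    2: "exec q (put a (Lit 0) (Lit 0)) M1 t2 M2"
      "rep M2 (run (Put a (Lit 0) (Lit 0)) (run (Put a (Lit 1) e) \<sigma>))"
      "t2 \<le> ?put2 * (b + 1)" by auto
  have f0: "rep M2 (f 0)" using 2(2) by (simp add: f_def loop_init_def m_def)
  have body: "\<exists>t M'. exec q (Seq (compile c) (put a (Lit 0) (Arr a (Lit 0) +: Lit 1))) M t M' \<and>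
      rep M' (f (Suc j)) \<and> t \<le> weight c * ?Y * (b + 1) + ?put3 * (b + 1)"
    if j: "j < m" and M: "rep M (f j)" for M j
  proof -
    from For.IH[OF wf(5) M okb[OF j]] obtain t M' where
      t: "exec q (compile c) M t M'" "rep M' (run c (f j))" "t \<le> weight c * ?Y * (b + 1)" by blast
    have ra: "run c (f j) a = f j a" using run_frame[OF wf(4)] .
    have "ok (Put a (Lit 0) (Arr a (Lit 0) +: Lit 1)) (run c (f j))"
      using cell lits ra j mX X_small by (simp add: fa)
    with exec_put[OF t(2), of a "Lit 0" "Arr a (Lit 0) +: Lit 1"] wf obtain t' M'' where
      t': "exec q (put a (Lit 0) (Arr a (Lit 0) +: Lit 1)) M' t' M''"
        "rep M'' (run (Put a (Lit 0) (Arr a (Lit 0) +: Lit 1)) (run c (f j)))"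
        "t' \<le> ?put3 * (b + 1)" by auto
    have "f (Suc j) = run (Put a (Lit 0) (Arr a (Lit 0) +: Lit 1)) (run c (f j))"
      by (simp add: f_def bump_def)
    then show ?thesis using exec.Seq[OF t(1) t'(1)] t t' by (metis add_mono)
  qed
  have test: "val q M ?t = m - j \<and> eval_cost q M ?t < (1 + expr_weight ?t) * (b + 1)"
    if "rep M (f j)" for M j
  proof -
    have ok: "ok_exp (f j) (Arr a (Lit 1) -: Arr a (Lit 0))"
      and w: "wf_exp (Arr a (Lit 1) -: Arr a (Lit 0))"
      using cell lits wf by auto
    have "val q M ?t = m - j" "small q b M ?t"
      using compile_exp_correct[OF that w ok] fa by auto
    moreover have "eval_cost q M ?t \<le> expr_weight ?t * (b + 1)"
      using eval_cost_bound[of M b q ?t] that b calculation(2) by (auto simp: rep_def)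
    ultimately show ?thesis by simp
  qed
  from exec_loop[of m f, OF body test _ f0] obtain t3 M3 where
    3: "exec q (While ?t (Seq (compile c) (put a (Lit 0) (Arr a (Lit 0) +: Lit 1)))) M2 t3 M3"
      "rep M3 (f m)"
      "t3 \<le> m * (weight c * ?Y * (b + 1) + ?put3 * (b + 1) + (1 + expr_weight ?t) * (b + 1))
          + (1 + expr_weight ?t) * (b + 1)"
    by auto
  have "exec q (compile (For a e c)) M (t1 + (t2 + t3)) M3"
    using exec.Seq[OF 1(1) exec.Seq[OF 2(1) 3(1)]] by simp
  moreover have "rep M3 (run (For a e c) \<sigma>)" using 3(2) by (simp add: f_def m_def)
  moreover have "t1 + (t2 + t3) \<le> weight (For a e c) * (X + 1) ^ depth (For a e c) * (b + 1)"
  proof -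
    have Y: "1 \<le> ?Y" by simp
    define A where "A = ?put1 + ?put2"
    define T where "T = 1 + expr_weight ?t"
    define P where "P = ?put3"
    define w where "w = weight c"
    define Z where "Z = ?Y"
    have Z1: "1 \<le> Z" using Y by (simp add: Z_def)
    have "t1 + (t2 + t3) \<le> (A + m * (w * Z + P + T) + T) * (b + 1)"
      using 1(3) 2(3) 3(3) unfolding A_def T_def P_def w_def Z_def by (simp add: algebra_simps)
    also have "A + m * (w * Z + P + T) + T \<le> (A + T + P + w) * (Z * (X + 1))"
    proof -
      have "A * 1 \<le> A * (Z * (X + 1))" using Z1 by (intro mult_le_mono2) simp
      \<comment> \<open>The test is evaluated once more than the body; the 1 in \<open>X + 1\<close>
        pays for this.\<close>
      moreover have "T + m * T \<le> T * (Z * (X + 1))"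
      proof -
        have "T + m * T = T * (1 * (m + 1))" by simp
        also have "\<dots> \<le> T * (Z * (X + 1))"
          using Z1 mX by (intro mult_le_mono2 mult_le_mono) auto
        finally show ?thesis .
      qed
      moreover have "m * P \<le> P * (Z * (X + 1))"
      proof -
        have "m * P = P * (1 * m)" by simp
        also have "\<dots> \<le> P * (Z * (X + 1))"
          using Z1 mX by (intro mult_le_mono2 mult_le_mono) auto
        finally show ?thesis .
      qed
      moreover have "m * (w * Z) \<le> w * (Z * (X + 1))"
      proof -
        have "m * (w * Z) = w * (Z * m)" by simp
        also have "\<dots> \<le> w * (Z * (X + 1))"
          using mX by (intro mult_le_mono2) auto
        finally show ?thesis .
      qed
      ultimately show ?thesis by (simp add: algebra_simps)
    qed
    finally have "t1 + (t2 + t3) \<le> (A + T + P + w) * (Z * (X + 1)) * (b + 1)"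
      by (meson le_trans mult_le_mono1)
    then show ?thesis unfolding A_def T_def P_def w_def Z_def
      by (simp only: weight.simps depth.simps power_Suc mult.commute[of "X + 1"])
  qed
  ultimately show ?case by blast
qed


subsection \<open>Program logic\<close>

text \<open>As \<open>run\<close> is a function, total correctness is a predicate on a single
  initial state, and sequential composition becomes nesting of postconditions.\<close>

definition spec :: "com \<Rightarrow> arrays \<Rightarrow> (arrays \<Rightarrow> bool) \<Rightarrow> bool" where
  "spec c \<sigma> Q \<longleftrightarrow> ok c \<sigma> \<and> Q (run c \<sigma>)"

lemma spec_Comp: "spec c \<sigma> (\<lambda>\<tau>. spec d \<tau> Q) \<Longrightarrow> spec (c ;; d) \<sigma> Q"
  by (simp add: spec_def)

lemma spec_simps:
  "spec (Put a i e) \<sigma> Q \<longleftrightarrow> ok_exp \<sigma> i \<and> ok_exp \<sigma> e \<and> cell a (lval \<sigma> i) \<and> lval \<sigma> e < 2 ^ b \<and>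
    Q (upd \<sigma> a (lval \<sigma> i) (lval \<sigma> e))"
  "spec (c ;; d) \<sigma> Q \<longleftrightarrow> spec c \<sigma> (\<lambda>\<tau>. spec d \<tau> Q)"
  "spec (If1 e c) \<sigma> Q \<longleftrightarrow> ok_exp \<sigma> e \<and> (if lval \<sigma> e = 0 then Q \<sigma> else spec c \<sigma> Q)"
  by (auto simp: spec_def)

text \<open>Consequence and frame rule in one: facts about unwritten arrays survive a command
  without being listed in its postcondition.\<close>

lemma spec_mono:
  assumes "spec c \<sigma> P"
    and "\<And>\<tau>. (\<And>a. a \<notin> writes c \<Longrightarrow> \<tau> a = \<sigma> a) \<Longrightarrow> P \<tau> \<Longrightarrow> Q \<tau>"
  shows "spec c \<sigma> Q"
  using assms run_frame[of _ c \<sigma>] unfolding spec_def by blast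

text \<open>The invariant must be insensitive to the loop's own array (\<open>indep\<close>), so
  that it survives both the initialisation and the increment of the counter. The step obtains the
  counter from \<open>\<tau> a 0 = j\<close> instead.\<close>

lemma spec_For:
  assumes "ok_exp \<sigma> e" "lval \<sigma> e = m" "m \<le> X" "a \<notin> writes c"
    and init: "Inv 0 \<sigma>"
    and indep: "\<And>j \<tau> f. Inv j \<tau> \<Longrightarrow> Inv j (\<tau>(a := f))"
    and step: "\<And>j \<tau>. j < m \<Longrightarrow> Inv j \<tau> \<Longrightarrow> \<tau> a 0 = j \<Longrightarrow>
      (\<And>x. x \<notin> insert a (writes c) \<Longrightarrow> \<tau> x = \<sigma> x) \<Longrightarrow> spec c \<tau> (Inv (Suc j))"
  shows "spec (For a e c) \<sigma> (Inv m)"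
proof -
  define f where "f j = ((\<lambda>\<tau>. bump a (run c \<tau>)) ^^ j) (loop_init a m \<sigma>)" for j
  have fa: "f j a = (\<sigma> a)(0 := j, 1 := m)" for j
    unfolding f_def using run_loop_counter[OF assms(4)] .
  have frame: "f j x = \<sigma> x" if "x \<notin> insert a (writes c)" for j x
    by (induction j) (use that run_frame[of x c] in \<open>auto simp: f_def bump_def loop_init_def\<close>)
  have Inv: "Inv j (f j)" if "j \<le> m" for j
    using that
  proof (induction j)
    case 0
    have "Inv 0 (loop_init a m \<sigma>)" unfolding loop_init_def by (rule indep[OF init])
    then show ?case by (simp add: f_def)
  next
    case (Suc j)
    then have "spec c (f j) (Inv (Suc j))"
      by (intro step) (auto simp: fa frame)
    then have "Inv (Suc j) (bump a (run c (f j)))"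
      unfolding spec_def bump_def by (intro indep) simp
    then show ?case by (simp add: f_def)
  qed
  have "ok c (f j)" if "j < m" for j
    using step[OF that Inv] that fa frame by (simp add: spec_def)
  then show ?thesis using assms(1-3) Inv[of m] by (simp add: spec_def f_def)
qed

end


section \<open>States of the dynamic program\<close>

text \<open>The hypothesis rules out a carry, so only digit \<open>c\<close> changes. The second
  part is what keeps states below \<open>Suc n ^ classes\<close>.\<close>

lemma digit_add:
  fixes B s c c' :: nat
  assumes "s div B ^ c mod B + 1 < B"
  shows "(s + B ^ c) div B ^ c' mod B = s div B ^ c' mod B + (if c' = c then 1 else 0)" (is ?thesis1)
    and "c < c' \<Longrightarrow> (s + B ^ c) div B ^ c' = s div B ^ c'" (is "_ \<Longrightarrow> ?thesis2")
proof -
  have B: "1 < B" using assms by simp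
  define x where "x = s div B ^ c"
  have x: "(s + B ^ c) div B ^ c = x + 1" using B by (simp add: x_def)
  have xB: "(x + 1) div B = x div B" "(x + 1) mod B = x mod B + 1"
    using assms B unfolding x_def[symmetric] by (simp_all add: div_Suc mod_Suc)
  have gt: "(s + B ^ c) div B ^ c' = s div B ^ c'" if "c < c'"
  proof -
    define e where "e = c' - Suc c"
    have c': "B ^ c' = B ^ c * (B * B ^ e)"
      using that by (simp add: e_def flip: power_add power_Suc)
    show ?thesis
      unfolding c' div_mult2_eq x xB by (simp add: x_def)
  qed
  show ?thesis2 if "c < c'" using gt[OF that] .
  consider "c' < c" | "c' = c" | "c < c'" by linarith
  then show ?thesis1
  proof cases
    case 1
    define e where "e = c - Suc c'"
    have "B ^ c = B * B ^ e * B ^ c'" using 1 by (simp add: e_def flip: power_add power_Suc)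
    then have "(s + B ^ c) div B ^ c' = s div B ^ c' + B * B ^ e" using B by simp
    with 1 show ?thesis by simp
  next
    case 2
    then show ?thesis using x xB by (simp add: x_def)
  next
    case 3
    then show ?thesis using gt by simp
  qed
qed

text \<open>The maximum of \<open>f\<close> over \<open>X\<close> is a lower bound on
  \<open>Y\<close>; both sums are compared with multiples of it.\<close>

lemma sum_le_of_card_le:
  fixes f :: "'a \<Rightarrow> nat"
  assumes "finite X" "finite Y" "card X \<le> card Y" "\<And>x y. x \<in> X \<Longrightarrow> y \<in> Y \<Longrightarrow> f x \<le> f y"
  shows "sum f X \<le> sum f Y"
proof (cases "X = {}")
  case False
  define m where "m = Max (f ` X)"
  have "m \<in> f ` X" unfolding m_def using assms(1) False by (intro Max_in) auto
  then have "m \<le> f y" if "y \<in> Y" for y using assms(4) that by auto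
  then have "card Y * m \<le> sum f Y" using sum_bounded_below[of Y m f] by simp
  moreover have "sum f X \<le> card X * m"
    using sum_bounded_above[of X f m] assms(1) by (simp add: m_def)
  ultimately show ?thesis using assms(3) by (meson le_trans mult_le_mono1)
qed simp

text \<open>Job \<open>j\<close> has processing time \<open>p j\<close>, release date \<open>r j\<close> and cost function \<open>v j \<cdot> g\<^bsub>u j\<^esub>\<close>.\<close>

locale jobs =
  fixes n :: nat and p r u v :: "nat \<Rightarrow> nat"
begin

definition key :: "nat \<Rightarrow> nat \<times> nat \<times> nat" where
  "key j = (r j, u j, v j)"

text \<open>Classes are numbered by first appearance, which is the order in which the program
  discovers them.\<close>

definition cls :: "nat \<Rightarrow> nat" where
  "cls j = card (key ` {..<LEAST i. key i = key j})"

definition classes :: nat where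
  "classes = card (key ` {..<n})"

definition place :: "nat \<Rightarrow> nat" where
  "place j = Suc n ^ cls j"

text \<open>Breaking ties by index makes the ranks within a class distinct.\<close>

definition before :: "nat \<Rightarrow> nat \<Rightarrow> bool" where
  "before i j \<longleftrightarrow> p i < p j \<or> p i = p j \<and> i < j"

definition rank :: "nat \<Rightarrow> nat" where
  "rank j = card {i. i < n \<and> key i = key j \<and> before i j}"

text \<open>A state is a number in base \<open>n + 1\<close>. The digit of a class counts the jobs of the class that
  have been taken, the shortest ones first.\<close>

definition digit :: "nat \<Rightarrow> nat \<Rightarrow> nat" where
  "digit s j = s div place j mod Suc n"

definition taken :: "nat \<Rightarrow> nat set" where
  "taken s = {j. j < n \<and> rank j < digit s j}"

text \<open>Marks the longest taken job of a class, the one that may be assumed to finish last among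
  the taken jobs of that class.\<close>

definition last_taken :: "nat \<Rightarrow> nat \<Rightarrow> bool" where
  "last_taken s j \<longleftrightarrow> digit s j = Suc (rank j)"

definition state :: "nat set \<Rightarrow> nat" where
  "state A = (\<Sum>j\<in>A. place j)"

definition demand :: "nat set \<Rightarrow> nat \<Rightarrow> nat" where
  "demand A x = (\<Sum>i\<in>{i \<in> A. x \<le> r i}. p i)"

text \<open>The time at which a schedule of the jobs in \<open>A\<close> that never idles unnecessarily ends.\<close>

definition makespan :: "nat set \<Rightarrow> nat" where
  "makespan A = Max (insert 0 ((\<lambda>j. r j + demand A (r j)) ` A))"


section \<open>Class numbers, ranks and digits\<close>

lemma key_Least: "key (LEAST i. key i = key j) = key j"
  by (rule LeastI[of "\<lambda>i. key i = key j" j]) simp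

text \<open>The first job of a class contributes a key that no earlier job has, which makes the
  inclusion of key sets strict.\<close>

lemma cls_less_card: "(LEAST i. key i = key j) < m \<Longrightarrow> cls j < card (key ` {..<m})"
proof -
  let ?l = "LEAST i. key i = key j"
  assume "?l < m"
  moreover have "key ?l \<notin> key ` {..<?l}"
  proof
    assume "key ?l \<in> key ` {..<?l}"
    then obtain i where "i < ?l" "key i = key ?l" by auto
    then show False using key_Least[of j] not_less_Least[of i "\<lambda>i. key i = key j"] by simp
  qed
  ultimately have "key ` {..<?l} \<subset> key ` {..<m}" by auto
  then show ?thesis unfolding cls_def by (intro psubset_card_mono) auto
qed

lemma cls_eq_iff: "cls i = cls j \<longleftrightarrow> key i = key j"
proof
  assume "cls i = cls j"
  then have "\<not> (LEAST x. key x = key i) < (LEAST x. key x = key j)"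
    "\<not> (LEAST x. key x = key j) < (LEAST x. key x = key i)"
    using cls_less_card[of i "LEAST x. key x = key j"] cls_less_card[of j "LEAST x. key x = key i"]
    by (auto simp: cls_def)
  then show "key i = key j" using key_Least[of i] key_Least[of j] by (metis linorder_neqE_nat)
qed (simp add: cls_def)

lemma cls_less: "j < m \<Longrightarrow> cls j < card (key ` {..<m})"
  using Least_le[of "\<lambda>i. key i = key j" j] by (intro cls_less_card) simp

lemma cls_new: "(\<And>i. i < j \<Longrightarrow> key i \<noteq> key j) \<Longrightarrow> cls j = card (key ` {..<j})"
  unfolding cls_def by (subst Least_equality[of _ j]) (auto simp: not_less[symmetric])

lemma place_pos: "0 < place j"
  by (simp add: place_def)

lemma digit_cong: "key i = key j \<Longrightarrow> digit s i = digit s j"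
  by (simp add: digit_def place_def cls_def)

lemma rank_strict: "i < n \<Longrightarrow> key i = key j \<Longrightarrow> before i j \<Longrightarrow> rank i < rank j"
proof -
  assume "i < n" "key i = key j" "before i j"
  then have "{x. x < n \<and> key x = key i \<and> before x i} \<subseteq> {x. x < n \<and> key x = key j \<and> before x j}"
    by (auto simp: before_def)
  moreover have "i \<in> {x. x < n \<and> key x = key j \<and> before x j}" "\<not> before i i"
    using \<open>i < n\<close> \<open>key i = key j\<close> \<open>before i j\<close> by (simp_all add: before_def)
  ultimately have "{x. x < n \<and> key x = key i \<and> before x i} \<subset> {x. x < n \<and> key x = key j \<and> before x j}"
    by auto
  then show ?thesis unfolding rank_def by (rule psubset_card_mono[rotated]) simp
qed

lemma rank_inj: "i < n \<Longrightarrow> j < n \<Longrightarrow> key i = key j \<Longrightarrow> rank i = rank j \<Longrightarrow> i = j"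
  using rank_strict[of i j] rank_strict[of j i] unfolding before_def
  by (metis less_irrefl linorder_less_linear)

lemma rank_mono: "j < n \<Longrightarrow> key i = key j \<Longrightarrow> rank i < rank j \<Longrightarrow> p i \<le> p j"
  using rank_strict[of j i] by (cases "p j < p i") (auto simp: before_def)

lemma rank_less: "j < n \<Longrightarrow> rank j < card {i. i < n \<and> key i = key j}"
  unfolding rank_def by (intro psubset_card_mono) (auto simp: before_def)

text \<open>Ranks are injective on a class and below its size, so they fill an initial segment.
  Hence every count from 1 to the class size has a last job.\<close>

lemma rank_image: "rank ` {i. i < n \<and> key i = y} = {..<card {i. i < n \<and> key i = y}}"
proof (rule card_subset_eq)
  show "rank ` {i. i < n \<and> key i = y} \<subseteq> {..<card {i. i < n \<and> key i = y}}"
    using rank_less by auto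
  have "inj_on rank {i. i < n \<and> key i = y}" by (auto intro!: inj_onI intro: rank_inj)
  then show "card (rank ` {i. i < n \<and> key i = y}) = card {..<card {i. i < n \<and> key i = y}}"
    by (simp add: card_image)
qed simp

lemma state_insert: "finite A \<Longrightarrow> a \<notin> A \<Longrightarrow> state (insert a A) = state A + place a"
  by (simp add: state_def add.commute)

text \<open>Jobs are added one at a time. A digit never exceeds the number of jobs added before,
  which is less than \<open>n\<close>, so there is no carry in base \<open>Suc n\<close>. The size
  bound rests on the same absence of carries and therefore shares the induction.\<close>

lemma digit_state_aux:
  assumes "finite A" "A \<subseteq> {..<n}"
  shows "(\<forall>j. digit (state A) j = card {i \<in> A. key i = key j}) \<and> state A < Suc n ^ classes"
  using assms
proof (induction A rule: finite_induct)
  case empty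
  then show ?case by (simp add: state_def digit_def)
next
  case (insert a A)
  have "A \<subseteq> {..<n} - {a}" using insert by auto
  then have "card A \<le> card ({..<n} - {a})" by (intro card_mono) auto
  with insert.prems have "card A < n" by auto
  moreover have "card {i \<in> A. key i = key a} \<le> card A" using insert by (intro card_mono) auto
  ultimately have less: "state A div Suc n ^ cls a mod Suc n + 1 < Suc n"
    using insert by (simp add: digit_def place_def)
  have *: "state (insert a A) = state A + Suc n ^ cls a"
    using insert by (simp add: state_insert place_def)
  have "digit (state (insert a A)) j = card {i \<in> insert a A. key i = key j}" for j
  proof -
    have "digit (state (insert a A)) j = digit (state A) j + (if cls j = cls a then 1 else 0)"
      using digit_add(1)[OF less, of "cls j"] by (simp add: * digit_def place_def)
    also have "\<dots> = card {i \<in> A. key i = key j} + (if key a = key j then 1 else 0)"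
      using insert by (auto simp: cls_eq_iff)
    also have "\<dots> = card {i \<in> insert a A. key i = key j}"
    proof (cases "key a = key j")
      case True
      then have "{i \<in> insert a A. key i = key j} = insert a {i \<in> A. key i = key j}" by auto
      then show ?thesis using True insert by simp
    next
      case False
      then have "{i \<in> insert a A. key i = key j} = {i \<in> A. key i = key j}" by auto
      then show ?thesis using False by simp
    qed
    finally show ?thesis .
  qed
  moreover have "cls a < classes" using insert.prems cls_less by (simp add: classes_def)
  then have "state (insert a A) div Suc n ^ classes = 0"
    using digit_add(2)[OF less, of classes] insert by (simp add: *)
  then have "state (insert a A) < Suc n ^ classes"
    by (metis div_eq_0_iff nat.simps(3) power_not_zero)
  ultimately show ?case by blast
qed

lemma digit_state: "A \<subseteq> {..<n} \<Longrightarrow> digit (state A) j = card {i \<in> A. key i = key j}"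
  using digit_state_aux finite_subset by blast

lemma state_less: "A \<subseteq> {..<n} \<Longrightarrow> state A < Suc n ^ classes"
  using digit_state_aux finite_subset by blast

lemma finite_taken: "finite (taken s)"
  by (simp add: taken_def)

lemma taken_subset: "taken s \<subseteq> {..<n}"
  by (auto simp: taken_def)

lemma not_last_taken_0: "\<not> last_taken 0 j"
  by (simp add: last_taken_def digit_def)

lemma taken_full: "taken (state {..<n}) = {..<n}"
  using rank_less by (auto simp: taken_def digit_state)

text \<open>Subtracting the place value lowers one digit from \<open>Suc (rank j)\<close> to
  \<open>rank j\<close>, and within the class of \<open>j\<close> only \<open>j\<close> itself has
  this rank.\<close>

lemma taken_diff:
  assumes "j < n" "last_taken s j"
  shows "place j \<le> s" "j \<in> taken s" "taken (s - place j) = taken s - {j}"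
proof -
  have d: "digit s j = Suc (rank j)" using assms(2) by (simp add: last_taken_def)
  then have "s div place j \<noteq> 0" by (metis digit_def mod_0 nat.simps(3))
  then show le: "place j \<le> s" by (metis div_less not_le)
  show "j \<in> taken s" using assms(1) d by (simp add: taken_def)
  define s' where "s' = s - place j"
  have s: "s = s' + Suc n ^ cls j" using le by (simp add: s'_def place_def)
  \<comment> \<open>If this digit of \<open>s'\<close> were already \<open>n\<close>, the addition
    would wrap it to 0, whereas the digit of \<open>s\<close> is positive.\<close>
  have less: "s' div Suc n ^ cls j mod Suc n + 1 < Suc n"
  proof (rule ccontr)
    assume "\<not> ?thesis"
    moreover have "s' div Suc n ^ cls j mod Suc n < Suc n" by simp
    ultimately have "s' div Suc n ^ cls j mod Suc n = n" by linarith
    moreover have "s div Suc n ^ cls j = s' div Suc n ^ cls j + 1" by (simp add: s)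
    then have "s div Suc n ^ cls j mod Suc n = (s' div Suc n ^ cls j mod Suc n + 1) mod Suc n"
      by (simp add: mod_Suc)
    ultimately have "digit s j = 0" by (simp add: digit_def place_def)
    with d show False by simp
  qed
  have dig: "digit s i = digit s' i + (if key i = key j then 1 else 0)" for i
    using digit_add(1)[OF less, of "cls i"] by (simp add: s digit_def place_def cls_eq_iff)
  have "rank i < digit s' i \<longleftrightarrow> rank i < digit s i \<and> i \<noteq> j" if "i < n" for i
  proof (cases "key i = key j")
    case True
    then have "digit s' i = rank j" "digit s i = Suc (rank j)"
      using dig[of i] d digit_cong[OF True] by auto
    then show ?thesis using rank_inj[OF that assms(1) True] by (auto simp: less_Suc_eq)
  next
    case False
    then show ?thesis using dig[of i] by auto
  qed
  then show "taken (s - place j) = taken s - {j}" by (auto simp: taken_def s'_def)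
qed

text \<open>The job found need not lie in \<open>A\<close>: a state only knows how many jobs of each
  class there are, and \<open>j\<close> is the one whose rank is this count minus 1.\<close>

lemma ex_last_taken:
  assumes "A \<subseteq> {..<n}" "a \<in> A"
  obtains j where "j < n" "key j = key a" "last_taken (state A) j"
proof -
  have fin: "finite A" using assms finite_subset by blast
  have "0 < card {i \<in> A. key i = key a}" using assms fin by (auto simp: card_gt_0_iff)
  moreover have "card {i \<in> A. key i = key a} \<le> card {i. i < n \<and> key i = key a}"
    using assms by (intro card_mono) auto
  ultimately have "card {i \<in> A. key i = key a} - 1 \<in> rank ` {i. i < n \<and> key i = key a}"
    unfolding rank_image by simp
  then obtain j where "j < n" "key j = key a" "rank j = card {i \<in> A. key i = key a} - 1" by auto
  with \<open>0 < card _\<close> show ?thesis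
    using that digit_state[OF assms(1), of j] by (simp add: last_taken_def)
qed

text \<open>Place values depend on the class only, so exchanging a job for another one of its class
  does not affect the remaining state.\<close>

lemma state_diff:
  assumes "finite A" "a \<in> A" "key j = key a"
  shows "state A - place j = state (A - {a})"
proof -
  have "state A = state (A - {a}) + place a"
    using assms state_insert[of "A - {a}" a] by (simp add: insert_absorb)
  moreover have "place j = place a" using assms(3) by (simp add: place_def cls_def)
  ultimately show ?thesis by simp
qed

text \<open>Among all sets with the same number of jobs in each class, \<open>taken s\<close> has the least demand.\<close>

lemma demand_taken_le:
  assumes "A \<subseteq> {..<n}"
  shows "demand (taken (state A)) x \<le> demand A x"
proof -
  let ?T = "taken (state A)"
  have fin: "finite A" using assms finite_subset by blast
  have group: "demand D x = (\<Sum>y\<in>key ` {..<n}. sum p {i \<in> {i \<in> D. x \<le> r i}. key i = y})"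
    if "D \<subseteq> {..<n}" for D
    unfolding demand_def
    by (rule sum.group[symmetric]) (use that finite_subset[OF that] in auto)
  have "sum p {i \<in> {i \<in> ?T. x \<le> r i}. key i = y} \<le> sum p {i \<in> {i \<in> A. x \<le> r i}. key i = y}" for y
  \<comment> \<open>All jobs of a class share the release date \<open>fst y\<close>, so a class
    counts towards the demand entirely or not at all.\<close>
  proof (cases "x \<le> fst y")
    case False
    then have "{i \<in> {i \<in> ?T. x \<le> r i}. key i = y} = {}" by (auto simp: key_def)
    then show ?thesis by (simp only: sum.empty)
  next
    case True
    define I where "I = {i \<in> ?T. key i = y}"
    define D where "D = {i \<in> A. key i = y}"
    define d where "d = card D"
    have fD: "finite D" "finite I" using fin finite_taken by (auto simp: D_def I_def)
    have I: "I = {i. i < n \<and> key i = y \<and> rank i < d}"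
      using digit_state[OF assms] by (auto simp: I_def taken_def d_def D_def)
    have "rank ` I = {..<d}"
    proof -
      have "d \<le> card {i. i < n \<and> key i = y}"
        unfolding d_def D_def using assms by (intro card_mono) auto
      then have "rank ` {i. i < n \<and> key i = y} \<inter> {..<d} = {..<d}" unfolding rank_image by auto
      moreover have "rank ` I = rank ` {i. i < n \<and> key i = y} \<inter> {..<d}" by (auto simp: I)
      ultimately show ?thesis by simp
    qed
    moreover have "inj_on rank I" by (auto intro!: inj_onI intro: rank_inj simp: I)
    ultimately have cI: "card I = card D" by (metis card_image card_lessThan d_def)
    \<comment> \<open>Exchange argument: after removing the common jobs, \<open>I\<close> keeps only
      ranks below \<open>d\<close> and \<open>D\<close> only ranks from \<open>d\<close> on, so
      every job left in \<open>D\<close> is at least as long.\<close>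
    have "card (I - D) \<le> card (D - I)"
      using cI fD by (simp add: card_Diff_subset_Int Int_commute)
    then have "sum p (I - D) \<le> sum p (D - I)"
    proof (rule sum_le_of_card_le[rotated 2])
      fix a b assume "a \<in> I - D" "b \<in> D - I"
      then have "rank a < d" "key a = y" "b < n" "key b = y" "\<not> rank b < d"
        using assms by (auto simp: I D_def)
      then show "p a \<le> p b" by (intro rank_mono) auto
    qed (use fD in auto)
    then have "sum p I \<le> sum p D"
      using sum.Int_Diff[OF fD(1), of p I] sum.Int_Diff[OF fD(2), of p D]
      by (simp add: Int_commute)
    moreover have "{i \<in> {i \<in> ?T. x \<le> r i}. key i = y} = I"
      "{i \<in> {i \<in> A. x \<le> r i}. key i = y} = D"
      using True by (auto simp: I_def D_def key_def)
    ultimately show ?thesis by simp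
  qed
  then show ?thesis unfolding group[OF assms] group[OF taken_subset] by (rule sum_mono)
qed

section \<open>Time windows and the makespan\<close>

lemma demand_mono: "finite A' \<Longrightarrow> A \<subseteq> A' \<Longrightarrow> demand A x \<le> demand A' x"
  unfolding demand_def by (rule sum_mono2) auto

lemma makespan_least: "finite A \<Longrightarrow> (\<And>j. j \<in> A \<Longrightarrow> r j + demand A (r j) \<le> t) \<Longrightarrow> makespan A \<le> t"
  by (auto simp: makespan_def)

lemma makespan_upper: "finite A \<Longrightarrow> j \<in> A \<Longrightarrow> r j + demand A (r j) \<le> makespan A"
  by (auto simp: makespan_def)

text \<open>\<open>makespan\<close> looks only at windows that begin with a release date. Any other
  \<open>x\<close> can be moved up to the next release date in \<open>A\<close> without changing the
  demand.\<close>

lemma makespan_window: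
  assumes "finite A" "0 < demand A x"
  shows "x + demand A x \<le> makespan A"
proof -
  have ne: "{i \<in> A. x \<le> r i} \<noteq> {}" using assms(2) by (intro notI) (simp add: demand_def)
  define j where "j = arg_min_on r {i \<in> A. x \<le> r i}"
  have j: "j \<in> A" "x \<le> r j" "\<And>i. i \<in> A \<Longrightarrow> x \<le> r i \<Longrightarrow> r j \<le> r i"
    using arg_min_if_finite[of "{i \<in> A. x \<le> r i}" r] assms(1) ne
    by (auto simp: j_def not_less[symmetric])
  have "demand A x = demand A (r j)"
    unfolding demand_def using j by (intro sum.cong) (auto intro: le_trans)
  then show ?thesis using makespan_upper[OF assms(1) j(1)] j(2) by linarith
qed

text \<open>Lower bound for the optimum: follow the order in which the jobs complete in a schedule, and
  replace each job by the shortest job of its class that has not been taken yet.\<close>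

theorem dp_lower_bound:
  fixes val :: "nat \<Rightarrow> real" and f :: "nat \<Rightarrow> nat \<Rightarrow> real" and c F :: "nat \<Rightarrow> real"
  assumes p_pos: "\<And>j. j < n \<Longrightarrow> 0 < p j"
    and val_0: "val 0 \<le> 0"
    and val_step: "\<And>s j. s < Suc n ^ classes \<Longrightarrow> j < n \<Longrightarrow> last_taken s j \<Longrightarrow>
      val s \<le> val (s - place j) + f j (makespan (taken s))"
    and f_key: "\<And>i j. key i = key j \<Longrightarrow> f i = f j"
    and f_le: "\<And>j t. j < n \<Longrightarrow> real t \<le> c j \<Longrightarrow> f j t \<le> F j"
    and window: "\<And>j x. j < n \<Longrightarrow> 0 < demand {i. i < n \<and> c i \<le> c j} x \<Longrightarrow>
      real x + real (demand {i. i < n \<and> c i \<le> c j} x) \<le> c j"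
    and c_nonneg: "\<And>j. j < n \<Longrightarrow> 0 \<le> c j"
  shows "val (state {..<n}) \<le> (\<Sum>j<n. F j)"
proof -
  have "A \<subseteq> {..<n} \<longrightarrow> val (state A) \<le> (\<Sum>j\<in>A. F j)" if "finite A" for A
    using that
  \<comment> \<open>Ranking by \<open>c\<close> makes the inserted job one that completes last, so
    the whole set lies inside the window condition for \<open>a\<close>.\<close>
  proof (induction A rule: finite_ranking_induct[where f = c])
    case empty
    then show ?case using val_0 by (simp add: state_def)
  next
    case (insert a A)
    show ?case
    proof (cases "a \<in> A")
      case True
      then show ?thesis using insert by (simp add: insert_absorb)
    next
      case False
      show ?thesis
      proof
        assume sub: "insert a A \<subseteq> {..<n}"
        let ?s = "state (insert a A)"
        obtain j where j: "j < n" "key j = key a" "last_taken ?s j"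
          using ex_last_taken[OF sub] by blast
        have a: "a < n" using sub by simp
        have less: "?s < Suc n ^ classes" by (rule state_less[OF sub])
        have "?s - place j = state A"
          using state_diff[of "insert a A" a j] insert.hyps(1) j(2) False by simp
        \<comment> \<open>The program removes \<open>j\<close> where the schedule finishes
          \<open>a\<close>; equal keys give equal cost functions and the same smaller state.\<close>
        then have "val ?s \<le> val (state A) + f a (makespan (taken ?s))"
          using val_step[OF less j(1,3)] f_key[OF j(2)] by simp
        moreover have "real (makespan (taken ?s)) \<le> c a"
        proof -
          \<comment> \<open>The makespan is a natural number while \<open>c a\<close> is real, so
            the bounds are first collected below the floor.\<close>
          have "makespan (taken ?s) \<le> nat \<lfloor>c a\<rfloor>"
          proof (rule makespan_least[OF finite_taken])
            fix i assume i: "i \<in> taken ?s"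
            let ?C = "{i. i < n \<and> c i \<le> c a}"
            have "demand (taken ?s) (r i) \<le> demand (insert a A) (r i)"
              by (rule demand_taken_le[OF sub])
            also have "\<dots> \<le> demand ?C (r i)"
              using sub insert by (intro demand_mono) auto
            finally have le: "demand (taken ?s) (r i) \<le> demand ?C (r i)" .
            have "p i \<le> demand (taken ?s) (r i)"
              unfolding demand_def using i finite_taken by (intro member_le_sum) auto
            with le have "0 < demand ?C (r i)"
              using p_pos[of i] i taken_subset by fastforce
            then have "real (r i) + real (demand ?C (r i)) \<le> c a" using window[OF a] by blast
            with le have "real (r i + demand (taken ?s) (r i)) \<le> c a" by simp
            then show "r i + demand (taken ?s) (r i) \<le> nat \<lfloor>c a\<rfloor>" by (simp add: le_nat_floor)
          qed
          then show ?thesis using c_nonneg[OF a] by linarith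
        qed
        then have "f a (makespan (taken ?s)) \<le> F a" by (rule f_le[OF a])
        ultimately show "val ?s \<le> (\<Sum>j\<in>insert a A. F j)"
          using insert sub False by simp
      qed
    qed
  qed
  then show ?thesis by simp
qed

end


section \<open>Schedules by priority\<close>

definition work :: "nat \<Rightarrow> (nat \<times> nat \<times> nat) list \<Rightarrow> nat" where
  "work j L = (\<Sum>(i, a, b)\<leftarrow>L. if i = j then b - a else 0)"

lemma work_append: "work j (L @ L') = work j L + work j L'"
  by (simp add: work_def)

lemma work_single: "work j [(i, a, b)] = (if i = j then b - a else 0)"
  by (simp add: work_def)

locale priorities = jobs +
  fixes ord :: "nat \<Rightarrow> nat"
  assumes ord: "bij_betw ord {..<n} {..<n}"
begin

definition firsts :: "nat \<Rightarrow> nat set" where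
  "firsts l = ord ` {..l}"

definition left :: "(nat \<Rightarrow> nat) \<Rightarrow> nat set \<Rightarrow> nat \<Rightarrow> nat" where
  "left rem A x = (\<Sum>i\<in>{i \<in> A. x \<le> r i}. rem i)"

text \<open>The pieces \<open>L\<close> have been scheduled up to time \<open>t\<close>, the next release date is \<open>x\<close>, and
  \<open>rem j\<close> units of job \<open>j\<close> are left. The second and third conjunct say that the remaining work
  fits before the deadlines \<open>makespan (firsts l)\<close>.\<close>

definition on_time :: "nat \<Rightarrow> nat \<Rightarrow> (nat \<Rightarrow> nat) \<Rightarrow> (nat \<times> nat \<times> nat) list \<Rightarrow> bool" where
  "on_time x t rem L \<longleftrightarrow>
     (\<forall>(j, a, b) \<in> set L. r j \<le> a \<and> a < b \<and> b \<le> t \<and>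
        (\<exists>l<n. j = ord l \<and> b \<le> makespan (firsts l))) \<and>
     (\<forall>l<n. 0 < sum rem (firsts l) \<longrightarrow> t + sum rem (firsts l) \<le> makespan (firsts l)) \<and>
     (\<forall>l<n. \<forall>y\<ge>x. 0 < left rem (firsts l) y \<longrightarrow> y + left rem (firsts l) y \<le> makespan (firsts l)) \<and>
     sorted_wrt (\<lambda>(_, _, b) (_, a', _). b \<le> a') L \<and>
     (\<forall>j<n. rem j + work j L = p j)"

lemma on_time_fits:
  "on_time x t rem L \<Longrightarrow> l < n \<Longrightarrow> 0 < sum rem (firsts l) \<Longrightarrow> t + sum rem (firsts l) \<le> makespan (firsts l)"
  by (simp add: on_time_def)

lemma on_time_fits_left:
  "on_time x t rem L \<Longrightarrow> l < n \<Longrightarrow> x \<le> y \<Longrightarrow> 0 < left rem (firsts l) y \<Longrightarrow>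
    y + left rem (firsts l) y \<le> makespan (firsts l)"
  by (simp add: on_time_def)

lemma finite_firsts: "finite (firsts l)"
  by (simp add: firsts_def)

lemma firsts_subset: "l < n \<Longrightarrow> firsts l \<subseteq> {..<n}"
  using ord by (auto simp: firsts_def bij_betw_def)

lemma ord_less: "l < n \<Longrightarrow> ord l < n"
  using ord by (auto simp: bij_betw_def)

lemma ord_mem_firsts: "l < n \<Longrightarrow> l' < n \<Longrightarrow> ord l \<in> firsts l' \<longleftrightarrow> l \<le> l'"
proof -
  assume "l < n" "l' < n"
  moreover have "inj_on ord {..<n}" using ord by (simp add: bij_betw_def)
  ultimately show ?thesis unfolding firsts_def by (auto dest!: inj_onD)
qed

text \<open>Before any work is done, both deadline conditions are instances of
  \<open>makespan_window\<close>, one of them with window start 0.\<close>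

lemma on_time_start:
  assumes "\<And>j. j < n \<Longrightarrow> rem j = p j"
  shows "on_time x 0 rem []"
proof -
  have left: "left rem (firsts l) y = demand (firsts l) y" if "l < n" for l y
    unfolding left_def demand_def using assms firsts_subset[OF that] by (intro sum.cong) auto
  have "sum rem (firsts l) = demand (firsts l) 0" if "l < n" for l
    using left[OF that, of 0] by (simp add: left_def)
  then show ?thesis
    using makespan_window[OF finite_firsts, of _ 0] makespan_window[OF finite_firsts] left assms
    by (simp add: on_time_def work_def)
qed

text \<open>When each of the first jobs is either finished or released at \<open>x\<close> or later,
  all of their remaining work is future work.\<close>

lemma sum_eq_left:
  assumes "l < n" and late: "\<And>i. i \<le> l \<Longrightarrow> rem (ord i) = 0 \<or> x \<le> r (ord i)"
  shows "sum rem (firsts l) = left rem (firsts l) x"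
  unfolding left_def
proof (rule sum.mono_neutral_right[OF finite_firsts])
  show "\<forall>i\<in>firsts l - {i \<in> firsts l. x \<le> r i}. rem i = 0"
  proof
    fix i assume "i \<in> firsts l - {i \<in> firsts l. x \<le> r i}"
    then obtain j where "i = ord j" "j \<le> l" "\<not> x \<le> r i" by (auto simp: firsts_def)
    then show "rem i = 0" using late[of j] by simp
  qed
qed auto

text \<open>For prefixes that contain \<open>ord l\<close>, clock and remaining work change by
  \<open>d\<close> in opposite directions. Shorter prefixes lose time without progress, but by
  \<open>prior\<close> all of their remaining work is released at \<open>x\<close> or later, so the
  window condition at \<open>x\<close> still secures their deadlines.\<close>

lemma on_time_piece:
  assumes inv: "on_time x t rem L" and l: "l < n"
    and rel: "r (ord l) \<le> t"
    and prior: "\<And>i. i < l \<Longrightarrow> rem (ord i) = 0 \<or> x \<le> r (ord i)"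
    and d: "0 < d" "d \<le> rem (ord l)" "t + d \<le> x"
  shows "on_time x (t + d) (rem(ord l := rem (ord l) - d)) (L @ [(ord l, t, t + d)])"
proof -
  define rem' where "rem' = rem(ord l := rem (ord l) - d)"
  have mem: "ord l \<in> firsts l' \<longleftrightarrow> l \<le> l'" if "l' < n" for l' using ord_mem_firsts[OF l that] .
  have "r (ord l) < x" using rel d by linarith
  \<comment> \<open>The job being processed was released before \<open>x\<close>, hence does not
    occur in windows that begin at \<open>x\<close> or later.\<close>
  then have left: "left rem' A y = left rem A y" if "x \<le> y" for A y
    unfolding left_def rem'_def using that by (intro sum.cong) auto
  have sum_ge: "sum rem (firsts l') = sum rem' (firsts l') + d" if "l' < n" "l \<le> l'" for l'
  proof -
    have i: "ord l \<in> firsts l'" using mem that by simp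
    show ?thesis
      unfolding sum.remove[OF finite_firsts i, of rem] sum.remove[OF finite_firsts i, of rem']
      using d(2) by (simp add: rem'_def)
  qed
  have sum_lt: "sum rem' (firsts l') = left rem (firsts l') x" if "l' < n" "l' < l" for l'
  proof -
    have "sum rem' (firsts l') = sum rem (firsts l')"
      unfolding rem'_def using mem[OF that(1)] that(2) by (intro sum.cong) auto
    then show ?thesis using sum_eq_left[OF that(1)] prior that(2) by simp
  qed
  have 1: "t + d + sum rem' (firsts l') \<le> makespan (firsts l')" if "l' < n" "0 < sum rem' (firsts l')" for l'
  proof (cases "l \<le> l'")
    case True
    then show ?thesis using sum_ge[OF that(1)] on_time_fits[OF inv that(1)] d(1) by simp
  next
    case False
    then have "x + left rem (firsts l') x \<le> makespan (firsts l')"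
      using sum_lt[OF that(1)] on_time_fits_left[OF inv that(1)] that by simp
    then show ?thesis using sum_lt[OF that(1)] False d(3) by simp
  qed
  have 2: "t + d \<le> makespan (firsts l)"
  proof -
    have "0 < sum rem (firsts l)" "d \<le> sum rem (firsts l)" using sum_ge[OF l] d by auto
    then show ?thesis using on_time_fits[OF inv l] by linarith
  qed
  have 3: "rem' j + work j (L @ [(ord l, t, t + d)]) = p j" if "j < n" for j
    using inv that d by (auto simp: on_time_def rem'_def work_append work_single)
  have 4: "sorted_wrt (\<lambda>(_, _, b) (_, a', _). b \<le> a') (L @ [(ord l, t, t + d)])"
    using inv by (auto simp: on_time_def sorted_wrt_append)
  have 5: "r j \<le> a \<and> a < b \<and> b \<le> t + d \<and> (\<exists>l<n. j = ord l \<and> b \<le> makespan (firsts l))"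
    if "(j, a, b) \<in> set (L @ [(ord l, t, t + d)])" for j a b
  proof (cases "(j, a, b) \<in> set L")
    case True
    then show ?thesis using inv unfolding on_time_def by fastforce
  next
    case False
    then show ?thesis using that rel d 2 l by auto
  qed
  have 6: "\<forall>l<n. \<forall>y\<ge>x. 0 < left rem' (firsts l) y \<longrightarrow> y + left rem' (firsts l) y \<le> makespan (firsts l)"
    using inv left by (simp add: on_time_def)
  show ?thesis
    unfolding rem'_def[symmetric] on_time_def using 1 3 4 5 6 by fast
qed

text \<open>Serves two purposes: letting the clock run to \<open>x\<close> when no released work is
  left, and, with \<open>t = x\<close>, replacing the next release date \<open>x\<close> by a later
  \<open>x'\<close>.\<close>

lemma on_time_idle:
  assumes inv: "on_time x t rem L" and "t \<le> x" "x \<le> x'"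
    and late: "t = x \<or> (\<forall>i<n. rem (ord i) = 0 \<or> x \<le> r (ord i))"
  shows "on_time x' x rem L"
proof -
  have "x + sum rem (firsts l) \<le> makespan (firsts l)" if "l < n" "0 < sum rem (firsts l)" for l
  proof (cases "t = x")
    case True
    then show ?thesis using on_time_fits[OF inv] that by simp
  next
    case False
    with late have "sum rem (firsts l) = left rem (firsts l) x" using that by (intro sum_eq_left) auto
    then show ?thesis using on_time_fits_left[OF inv that(1)] that by simp
  qed
  moreover have "\<forall>(j, a, b) \<in> set L. r j \<le> a \<and> a < b \<and> b \<le> x \<and>
      (\<exists>l<n. j = ord l \<and> b \<le> makespan (firsts l))"
    using inv \<open>t \<le> x\<close> unfolding on_time_def by fastforce
  moreover have "\<forall>l<n. \<forall>y\<ge>x'. 0 < left rem (firsts l) y \<longrightarrow> y + left rem (firsts l) y \<le> makespan (firsts l)"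
    using inv \<open>x \<le> x'\<close> by (simp add: on_time_def)
  moreover have "sorted_wrt (\<lambda>(_, _, b) (_, a', _). b \<le> a') L" "\<forall>j<n. rem j + work j L = p j"
    using inv by (simp_all add: on_time_def)
  ultimately show ?thesis unfolding on_time_def by fast
qed

text \<open>Remaining work of a prefix would have to be done after \<open>t\<close> and yet before a
  makespan that is at most \<open>t\<close>.\<close>

lemma on_time_finished:
  assumes "on_time x t rem L" "\<And>A. A \<subseteq> {..<n} \<Longrightarrow> makespan A \<le> t" "j < n"
  shows "rem j = 0"
proof (rule ccontr)
  assume "rem j \<noteq> 0"
  have "j \<in> ord ` {..<n}" using ord assms(3) by (simp add: bij_betw_def)
  then obtain l where l: "l < n" "ord l = j" by auto
  have "rem j \<le> sum rem (firsts l)"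
    using l finite_firsts by (intro member_le_sum) (auto simp: ord_mem_firsts)
  then have "0 < sum rem (firsts l)" using \<open>rem j \<noteq> 0\<close> by simp
  moreover from this have "t + sum rem (firsts l) \<le> makespan (firsts l)"
    using on_time_fits[OF assms(1) l(1)] by simp
  ultimately show False using assms(2)[OF firsts_subset[OF l(1)]] by simp
qed

end


section \<open>The program\<close>

text \<open>Names of arrays: the prefix \<open>a\<close> marks tables, \<open>x\<close> scalars kept
  in cell 0, and \<open>i\<close> loop counters with an array of their own.\<close>

abbreviation "aP \<equiv> 2 :: nat"
abbreviation "aR \<equiv> 3 :: nat"
abbreviation "aV \<equiv> 4 :: nat"
abbreviation "aU \<equiv> 5 :: nat"
abbreviation "aPlace \<equiv> 6 :: nat"
abbreviation "aRank \<equiv> 7 :: nat"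
abbreviation "aNum \<equiv> 8 :: nat"
abbreviation "aDen \<equiv> 9 :: nat"
abbreviation "aChoice \<equiv> 10 :: nat"
abbreviation "aRem \<equiv> 11 :: nat"
abbreviation "aOrd \<equiv> 12 :: nat"
abbreviation "aDigit \<equiv> 13 :: nat"
abbreviation "xStates \<equiv> 14 :: nat"
abbreviation "xEnd \<equiv> 15 :: nat"
abbreviation "xSum \<equiv> 16 :: nat"
abbreviation "xNum \<equiv> 17 :: nat"
abbreviation "xDen \<equiv> 18 :: nat"
abbreviation "xState \<equiv> 19 :: nat"
abbreviation "xHor \<equiv> 20 :: nat"
abbreviation "xStart \<equiv> 21 :: nat"
abbreviation "xNext \<equiv> 22 :: nat"
abbreviation "xTime \<equiv> 23 :: nat"
abbreviation "xCount \<equiv> 24 :: nat"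
abbreviation "xLen \<equiv> 25 :: nat"
abbreviation "xJob \<equiv> 26 :: nat"
abbreviation "iJ \<equiv> 27 :: nat"
abbreviation "iI \<equiv> 28 :: nat"
abbreviation "iS \<equiv> 29 :: nat"

abbreviation var :: "nat \<Rightarrow> lexp" where "var a \<equiv> Arr a (Lit 0)"
abbreviation assign :: "nat \<Rightarrow> lexp \<Rightarrow> com" where "assign a e \<equiv> Put a (Lit 0) e"

text \<open>Truncated subtraction supplies the tests: \<open>1 - (x - y)\<close> is 1 or 0, so that
  products of tests act as conjunctions.\<close>

definition le_e :: "lexp \<Rightarrow> lexp \<Rightarrow> lexp" where
  "le_e x y = Lit 1 -: (x -: y)"

definition lt_e :: "lexp \<Rightarrow> lexp \<Rightarrow> lexp" where
  "lt_e x y = Lit 1 -: ((x +: Lit 1) -: y)"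

definition eq_e :: "lexp \<Rightarrow> lexp \<Rightarrow> lexp" where
  "eq_e x y = Lit 1 -: ((x -: y) +: (y -: x))"

definition mod_e :: "lexp \<Rightarrow> lexp \<Rightarrow> lexp" where
  "mod_e x y = x -: x /: y *: y"

definition max_e :: "lexp \<Rightarrow> lexp \<Rightarrow> lexp" where
  "max_e x y = x +: (y -: x)"

definition min_e :: "lexp \<Rightarrow> lexp \<Rightarrow> lexp" where
  "min_e x y = x -: (x -: y)"

definition same_e :: "lexp \<Rightarrow> lexp \<Rightarrow> lexp" where
  "same_e x y = eq_e (Arr aR x) (Arr aR y) *: eq_e (Arr aU x) (Arr aU y) *: eq_e (Arr aV x) (Arr aV y)"

definition before_e :: "lexp \<Rightarrow> lexp \<Rightarrow> lexp" where
  "before_e x y = lt_e (Arr aP x) (Arr aP y) +: eq_e (Arr aP x) (Arr aP y) *: lt_e x y"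

text \<open>The grid point after \<open>x\<close>. The part \<open>x div N\<close> keeps the
  relative step near \<open>1/N\<close>, the unit guarantees progress for small
  \<open>x\<close>.\<close>

definition grid_e :: "nat \<Rightarrow> lexp \<Rightarrow> lexp" where
  "grid_e N x = x +: Lit 1 +: x /: Lit N"

text \<open>Every grid step advances by at least 1, so as many rounds as the weight itself suffice.
  This is affordable because weights are quasi-polynomial, and it needs no knowledge of their
  bound.\<close>

definition round_loop :: "nat \<Rightarrow> com" where
  "round_loop N = For iI (Arr 0 (Lit 4 *: var iJ +: Lit 4))
     (If1 (le_e (grid_e N (Arr aV (var iJ))) (Arr 0 (Lit 4 *: var iJ +: Lit 4)))
        (Put aV (var iJ) (grid_e N (Arr aV (var iJ)))))"

definition load :: "nat \<Rightarrow> com" where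
  "load N = For iJ Size
    (Put aP (var iJ) (Arr 0 (Lit 4 *: var iJ +: Lit 2)) ;;
     Put aR (var iJ) (Arr 0 (Lit 4 *: var iJ +: Lit 3)) ;;
     Put aU (var iJ) (Arr 0 (Lit 4 *: var iJ +: Lit 5)) ;;
     Put aV (var iJ) (Lit 0) ;;
     round_loop N)"

definition place_loop :: com where
  "place_loop = For iI (var iJ)
     (If1 (same_e (var iI) (var iJ)) (Put aPlace (var iJ) (Arr aPlace (var iI))))"

definition rank_loop :: com where
  "rank_loop = For iI Size
     (If1 (same_e (var iI) (var iJ) *: before_e (var iI) (var iJ))
        (Put aRank (var iJ) (Arr aRank (var iJ) +: Lit 1)))"

text \<open>\<open>xStates\<close> is the place value reserved for the next new class. Each job
  receives it first; an earlier job with the same key overwrites it by a smaller power. If the two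
  are still equal afterwards, a class has been opened.\<close>

definition classify :: com where
  "classify =
     assign xStates (Lit 1) ;;
     For iJ Size
      (Put aPlace (var iJ) (var xStates) ;;
       place_loop ;;
       If1 (eq_e (Arr aPlace (var iJ)) (var xStates))
         (assign xStates (var xStates *: (Size +: Lit 1))) ;;
       Put aRank (var iJ) (Lit 0) ;;
       rank_loop)"

definition digit_loop :: com where
  "digit_loop = For iJ Size
     (Put aDigit (var iJ) (mod_e (var iS /: Arr aPlace (var iJ)) (Size +: Lit 1)))"

definition demand_loop :: com where
  "demand_loop = For iI Size
     (assign xSum (var xSum +: lt_e (Arr aRank (var iI)) (Arr aDigit (var iI)) *:
        le_e (Arr aR (var iJ)) (Arr aR (var iI)) *: Arr aP (var iI)))"

definition makespan_loop :: com where
  "makespan_loop =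
     assign xEnd (Lit 0) ;;
     For iJ Size
      (assign xSum (Arr aR (var iJ)) ;;
       demand_loop ;;
       assign xEnd (max_e (var xEnd)
         (lt_e (Arr aRank (var iJ)) (Arr aDigit (var iJ)) *: var xSum)))"

text \<open>Fractions are added without reduction and compared by cross multiplication. Against the
  entry 1/0 the test reads \<open>0 < xDen\<close>, so the first candidate is accepted.\<close>

definition try_job :: com where
  "try_job =
     assign xNum
       (Arr aNum (var iS -: Arr aPlace (var iJ)) *: QD (Arr aU (var iJ)) (var xEnd) +:
        Arr aV (var iJ) *: QN (Arr aU (var iJ)) (var xEnd) *:
          Arr aDen (var iS -: Arr aPlace (var iJ))) ;;
     assign xDen
       (Arr aDen (var iS -: Arr aPlace (var iJ)) *: QD (Arr aU (var iJ)) (var xEnd)) ;;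
     If1 (lt_e (var xNum *: Arr aDen (var iS)) (Arr aNum (var iS) *: var xDen))
       (Put aNum (var iS) (var xNum) ;;
        Put aDen (var iS) (var xDen) ;;
        Put aChoice (var iS) (var iJ))"

definition choice_loop :: com where
  "choice_loop = For iJ Size
     (If1 (eq_e (Arr aDigit (var iJ)) (Arr aRank (var iJ) +: Lit 1)) try_job)"

text \<open>The fraction 1/0 stands for infinity.\<close>

definition dp :: com where
  "dp = For iS (var xStates)
    (digit_loop ;;
     makespan_loop ;;
     Put aNum (var iS) (Lit 1) ;;
     Put aDen (var iS) (Lit 0) ;;
     choice_loop ;;
     If1 (eq_e (Arr aDen (var iS)) (Lit 0))
       (Put aNum (var iS) (Lit 0) ;;
        Put aDen (var iS) (Lit 1)))"

definition full_loop :: com where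
  "full_loop = For iJ Size (assign xState (var xState +: Arr aPlace (var iJ)))"

text \<open>\<open>aChoice\<close> names the job that finishes last, so the positions are filled
  from the end.\<close>

definition order_loop :: com where
  "order_loop = For iJ Size
    (Put aOrd (Size -: Lit 1 -: var iJ) (Arr aChoice (var xState)) ;;
     assign xState (var xState -: Arr aPlace (Arr aChoice (var xState))))"

definition backtrack :: com where
  "backtrack = assign xState (Lit 0) ;; full_loop ;; order_loop"

definition horizon_loop :: com where
  "horizon_loop = For iJ Size (assign xHor (max_e (var xHor) (Arr aR (var iJ))))"

definition rem_loop :: com where
  "rem_loop = For iJ Size
    (assign xHor (var xHor +: Arr aP (var iJ)) ;;
     Put aRem (var iJ) (Arr aP (var iJ)))"

definition next_loop :: com where
  "next_loop = For iJ Size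
    (If1 (lt_e (var xStart) (Arr aR (var iJ)))
       (assign xNext (min_e (var xNext) (Arr aR (var iJ)))))"

text \<open>No job is released between \<open>xStart\<close> and \<open>xNext\<close>. One pass over
  the jobs in priority order therefore realises the preemptive rule for the whole phase, each job
  running until it is finished or the phase ends.\<close>

definition piece :: com where
  "piece =
     assign xJob (Arr aOrd (var iJ)) ;;
     assign xLen (le_e (Arr aR (var xJob)) (var xStart) *:
       min_e (Arr aRem (var xJob)) (var xNext -: var xTime)) ;;
     If1 (var xLen)
       (Put 0 (Lit 3 *: var xCount +: Lit 1) (var xJob) ;;
        Put 0 (Lit 3 *: var xCount +: Lit 2) (var xTime) ;;
        Put 0 (Lit 3 *: var xCount +: Lit 3) (var xTime +: var xLen) ;;
        assign xCount (var xCount +: Lit 1) ;;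
        Put aRem (var xJob) (Arr aRem (var xJob) -: var xLen) ;;
        assign xTime (var xTime +: var xLen))"

definition piece_loop :: com where
  "piece_loop = For iJ Size piece"

text \<open>One phase begins at 0 and one at each distinct positive release date, which makes at
  most \<open>n + 1\<close>. The horizon stands in for the release date after the last one.\<close>

definition schedule_jobs :: com where
  "schedule_jobs =
     assign xHor (Lit 0) ;;
     horizon_loop ;;
     rem_loop ;;
     assign xStart (Lit 0) ;;
     assign xCount (Lit 0) ;;
     For iS (Size +: Lit 1)
      (assign xNext (var xHor) ;;
       next_loop ;;
       assign xTime (var xStart) ;;
       piece_loop ;;
       assign xStart (var xNext))"

definition gsp_com :: "nat \<Rightarrow> com" where
  "gsp_com N = load N ;; classify ;; dp ;; backtrack ;; schedule_jobs"

definition gsp_prog :: "nat \<Rightarrow> prog" where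
  "gsp_prog N = Seq (compile (gsp_com N)) (Store (Const 0) (compile_exp (var xCount)))"

lemmas com_defs = round_loop_def load_def place_loop_def rank_loop_def classify_def digit_loop_def
  demand_loop_def makespan_loop_def try_job_def choice_loop_def dp_def full_loop_def order_loop_def
  backtrack_def horizon_loop_def rem_loop_def next_loop_def piece_def piece_loop_def
  schedule_jobs_def gsp_com_def

lemmas exp_defs = le_e_def lt_e_def eq_e_def mod_e_def max_e_def min_e_def same_e_def before_e_def
  grid_e_def

lemma writes_coms [simp]:
  "writes (round_loop N) = {iI, aV}"
  "writes (load N) = {iJ, aP, aR, aU, aV, iI}"
  "writes place_loop = {iI, aPlace}"
  "writes rank_loop = {iI, aRank}"
  "writes classify = {xStates, iJ, aPlace, iI, aRank}"
  "writes digit_loop = {iJ, aDigit}"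
  "writes demand_loop = {iI, xSum}"
  "writes makespan_loop = {xEnd, iJ, xSum, iI}"
  "writes try_job = {xNum, xDen, aNum, aDen, aChoice}"
  "writes choice_loop = {iJ, xNum, xDen, aNum, aDen, aChoice}"
  "writes dp = {iS, iJ, aDigit, xEnd, xSum, iI, aNum, aDen, xNum, xDen, aChoice}"
  "writes full_loop = {iJ, xState}"
  "writes order_loop = {iJ, aOrd, xState}"
  "writes backtrack = {xState, iJ, aOrd}"
  "writes horizon_loop = {iJ, xHor}"
  "writes rem_loop = {iJ, xHor, aRem}"
  "writes next_loop = {iJ, xNext}"
  "writes piece = {xJob, xLen, 0, xCount, aRem, xTime}"
  "writes piece_loop = {iJ, xJob, xLen, 0, xCount, aRem, xTime}"
  by (auto simp: com_defs)

lemma wf_gsp_com: "wf_com (gsp_com N)"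
  by (simp add: com_defs exp_defs)

section \<open>Rounding the weights and loading the input\<close>

definition grid_step :: "nat \<Rightarrow> nat \<Rightarrow> nat \<Rightarrow> nat" where
  "grid_step N w x = (if x + 1 + x div N \<le> w then x + 1 + x div N else x)"

definition rounded :: "nat \<Rightarrow> nat \<Rightarrow> nat" where
  "rounded N w = (grid_step N w ^^ w) 0"

lemma grid_iter_le: "(grid_step N w ^^ i) 0 \<le> w"
  by (induction i) (auto simp: grid_step_def)

context machine
begin

declare numeral_small [simp]

lemma b_pos [simp]: "0 < b"
  using b_large by simp

lemma cell_pos [simp]: "a \<noteq> 0 \<Longrightarrow> cell a x"
  by (simp add: cell_def)

lemma lval_exps [simp]:
  "lval \<sigma> (le_e x y) = of_bool (lval \<sigma> x \<le> lval \<sigma> y)"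
  "lval \<sigma> (lt_e x y) = of_bool (lval \<sigma> x < lval \<sigma> y)"
  "lval \<sigma> (eq_e x y) = of_bool (lval \<sigma> x = lval \<sigma> y)"
  "lval \<sigma> (mod_e x y) = lval \<sigma> x mod lval \<sigma> y"
  "lval \<sigma> (max_e x y) = max (lval \<sigma> x) (lval \<sigma> y)"
  "lval \<sigma> (min_e x y) = min (lval \<sigma> x) (lval \<sigma> y)"
  by (auto simp: exp_defs minus_div_mult_eq_mod)

lemma ok_exps [simp]:
  "ok_exp \<sigma> (le_e x y) \<longleftrightarrow> ok_exp \<sigma> x \<and> ok_exp \<sigma> y"
  "ok_exp \<sigma> (lt_e x y) \<longleftrightarrow> ok_exp \<sigma> x \<and> ok_exp \<sigma> y"
  "ok_exp \<sigma> (eq_e x y) \<longleftrightarrow> ok_exp \<sigma> x \<and> ok_exp \<sigma> y"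
  "ok_exp \<sigma> (mod_e x y) \<longleftrightarrow> ok_exp \<sigma> x \<and> ok_exp \<sigma> y"
  "ok_exp \<sigma> (max_e x y) \<longleftrightarrow> ok_exp \<sigma> x \<and> ok_exp \<sigma> y"
  "ok_exp \<sigma> (min_e x y) \<longleftrightarrow> ok_exp \<sigma> x \<and> ok_exp \<sigma> y"
  "ok_exp \<sigma> (same_e x y) \<longleftrightarrow> ok_exp \<sigma> x \<and> ok_exp \<sigma> y"
  "ok_exp \<sigma> (before_e x y) \<longleftrightarrow> ok_exp \<sigma> x \<and> ok_exp \<sigma> y"
  by (auto simp: exp_defs)

lemma spec_round_loop:
  assumes j: "\<sigma> iJ 0 = j" "j < n" and w: "\<sigma> 0 (4 * j + 4) = w" "w \<le> X" and N: "N < 2 ^ b"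
    and V: "\<sigma> aV j = 0"
  shows "spec (round_loop N) \<sigma> (\<lambda>\<tau>. \<tau> aV = (\<sigma> aV)(j := rounded N w))"
proof -
  have c: "cell 0 (4 * j + 4)" using j(2) by (simp add: cell_def base_def)
  define Inv where "Inv i \<tau> \<longleftrightarrow> \<tau> aV = (\<sigma> aV)(j := (grid_step N w ^^ i) 0)" for i and \<tau> :: arrays
  have "spec (round_loop N) \<sigma> (Inv w)"
    unfolding round_loop_def
  proof (rule spec_For)
    fix i and \<tau> :: arrays
    assume "i < w" and Inv: "Inv i \<tau>" and "\<tau> iI 0 = i" and
      frame: "\<And>x. x \<notin> insert iI (writes (If1 (le_e (grid_e N (Arr aV (var iJ)))
        (Arr 0 (Lit 4 *: var iJ +: Lit 4))) (Put aV (var iJ) (grid_e N (Arr aV (var iJ)))))) \<Longrightarrow> \<tau> x = \<sigma> x"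
    have f: "\<tau> iJ = \<sigma> iJ" "\<tau> 0 = \<sigma> 0" by (rule frame; simp)+
    have "w < 2 ^ b" using w(2) X_small by simp
    then show "spec (If1 (le_e (grid_e N (Arr aV (var iJ))) (Arr 0 (Lit 4 *: var iJ +: Lit 4)))
        (Put aV (var iJ) (grid_e N (Arr aV (var iJ))))) \<tau> (Inv (Suc i))"
      using Inv c j w N f
      by (auto simp: spec_simps Inv_def grid_e_def grid_step_def)
  qed (use c w j V in \<open>auto simp: Inv_def\<close>)
  then show ?thesis by (rule spec_mono) (simp add: Inv_def rounded_def)
qed

lemma spec_load:
  assumes w: "\<And>j. j < n \<Longrightarrow> \<sigma> 0 (4 * j + 4) \<le> X" and N: "N < 2 ^ b" and n: "n \<le> X"
    and small: "\<And>x. \<sigma> 0 x < 2 ^ b"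
  shows "spec (load N) \<sigma> (\<lambda>\<tau>. \<forall>j<n. \<tau> aP j = \<sigma> 0 (4 * j + 2) \<and> \<tau> aR j = \<sigma> 0 (4 * j + 3) \<and>
    \<tau> aV j = rounded N (\<sigma> 0 (4 * j + 4)) \<and> \<tau> aU j = \<sigma> 0 (4 * j + 5))"
proof -
  define Inv where "Inv m \<tau> \<longleftrightarrow> (\<forall>j<m. \<tau> aP j = \<sigma> 0 (4 * j + 2) \<and> \<tau> aR j = \<sigma> 0 (4 * j + 3) \<and>
    \<tau> aV j = rounded N (\<sigma> 0 (4 * j + 4)) \<and> \<tau> aU j = \<sigma> 0 (4 * j + 5))" for m and \<tau> :: arrays
  let ?c = "Put aP (var iJ) (Arr 0 (Lit 4 *: var iJ +: Lit 2)) ;;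
     Put aR (var iJ) (Arr 0 (Lit 4 *: var iJ +: Lit 3)) ;;
     Put aU (var iJ) (Arr 0 (Lit 4 *: var iJ +: Lit 5)) ;;
     Put aV (var iJ) (Lit 0) ;;
     round_loop N"
  have "spec (load N) \<sigma> (Inv n)"
    unfolding load_def
  proof (rule spec_For)
    fix j and \<tau> :: arrays
    assume j: "j < n" and Inv: "Inv j \<tau>" and \<tau>j: "\<tau> iJ 0 = j" and
      frame: "\<And>x. x \<notin> insert iJ (writes ?c) \<Longrightarrow> \<tau> x = \<sigma> x"
    have f: "\<tau> 0 = \<sigma> 0" by (rule frame) simp
    have c: "cell 0 (4 * j + 2)" "cell 0 (4 * j + 3)" "cell 0 (4 * j + 5)"
      using j by (simp_all add: cell_def base_def)
    define \<tau>' where "\<tau>' = upd (upd (upd (upd \<tau> aP j (\<sigma> 0 (4 * j + 2))) aR j (\<sigma> 0 (4 * j + 3)))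
      aU j (\<sigma> 0 (4 * j + 5))) aV j 0"
    have "spec (round_loop N) \<tau>' (\<lambda>\<tau>''. \<tau>'' aV = (\<tau>' aV)(j := rounded N (\<sigma> 0 (4 * j + 4))))"
      by (rule spec_round_loop) (use j w \<tau>j N f in \<open>auto simp: \<tau>'_def\<close>)
    then have "spec (round_loop N) \<tau>' (Inv (Suc j))"
    proof (rule spec_mono)
      fix \<tau>'' assume fr: "\<And>a. a \<notin> writes (round_loop N) \<Longrightarrow> \<tau>'' a = \<tau>' a"
        and V: "\<tau>'' aV = (\<tau>' aV)(j := rounded N (\<sigma> 0 (4 * j + 4)))"
      have "\<tau>'' aP = \<tau>' aP" "\<tau>'' aR = \<tau>' aR" "\<tau>'' aU = \<tau>' aU" by (rule fr; simp)+
      with V Inv show "Inv (Suc j) \<tau>''" by (auto simp: Inv_def \<tau>'_def less_Suc_eq)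
    qed
    then show "spec ?c \<tau> (Inv (Suc j))"
      using \<tau>j f c small by (simp add: spec_simps \<tau>'_def)
  qed (use n in \<open>auto simp: Inv_def\<close>)
  then show ?thesis by (rule spec_mono) (simp add: Inv_def)
qed

end

section \<open>Correctness of the dynamic program\<close>

text \<open>\<open>L\<close> bounds the length of oracle answers, \<open>b\<close> that of all
  stored numbers. Adding at most \<open>X\<close> unreduced fractions leads to denominators up to
  \<open>2 ^ (L * X)\<close> and numerators up to \<open>X * X * 2 ^ (L * X)\<close>, whence
  \<open>b_bound\<close>.\<close>

locale instance_data = machine q n k h b X + jobs n p r u v
  for q n k h b X p r u v +
  fixes L :: nat
  assumes n_le: "n + 1 \<le> X"
    and states_le: "Suc n ^ classes \<le> X"
    and p_pos: "\<And>j. j < n \<Longrightarrow> 0 < p j"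
    and u_less: "\<And>j. j < n \<Longrightarrow> u j < k"
    and v_le: "\<And>j. j < n \<Longrightarrow> v j \<le> X"
    and h_le: "\<And>j. j < n \<Longrightarrow> r j + (\<Sum>i<n. p i) \<le> h"
    and h_small: "h < 2 ^ b"
    and q_bound: "\<And>i t. i < k \<Longrightarrow> t \<le> h \<Longrightarrow> fst (q i t) < 2 ^ L \<and> snd (q i t) < 2 ^ L \<and> 0 < snd (q i t)"
    and b_bound: "X * X * 2 ^ (L * X) < 2 ^ b"
begin

definition loaded :: "arrays \<Rightarrow> bool" where
  "loaded \<sigma> \<longleftrightarrow> \<sigma> aP = p \<and> \<sigma> aR = r \<and> \<sigma> aU = u \<and> \<sigma> aV = v"

definition classified :: "arrays \<Rightarrow> bool" where
  "classified \<sigma> \<longleftrightarrow> \<sigma> xStates 0 = Suc n ^ classes \<and> (\<forall>j<n. \<sigma> aPlace j = place j \<and> \<sigma> aRank j = rank j)"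

lemma loaded_frame:
  "loaded \<sigma> \<Longrightarrow> \<tau> aP = \<sigma> aP \<Longrightarrow> \<tau> aR = \<sigma> aR \<Longrightarrow> \<tau> aU = \<sigma> aU \<Longrightarrow> \<tau> aV = \<sigma> aV \<Longrightarrow> loaded \<tau>"
  by (simp add: loaded_def)

lemma classified_frame:
  "classified \<sigma> \<Longrightarrow> \<tau> xStates = \<sigma> xStates \<Longrightarrow> \<tau> aPlace = \<sigma> aPlace \<Longrightarrow> \<tau> aRank = \<sigma> aRank \<Longrightarrow>
    classified \<tau>"
  by (simp add: classified_def)

lemma lval_same: "loaded \<sigma> \<Longrightarrow> lval \<sigma> (same_e x y) = of_bool (key (lval \<sigma> x) = key (lval \<sigma> y))"
  by (auto simp: same_e_def loaded_def key_def)

lemma lval_before: "loaded \<sigma> \<Longrightarrow> lval \<sigma> (before_e x y) = of_bool (before (lval \<sigma> x) (lval \<sigma> y))"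
  by (auto simp: before_e_def loaded_def before_def)

lemma n_le_X: "n \<le> X" and n_small': "Suc n < 2 ^ b"
  using n_le X_small by auto

lemma card_keys_le: "m \<le> n \<Longrightarrow> Suc n ^ card (key ` {..<m}) \<le> X"
proof -
  assume "m \<le> n"
  then have "card (key ` {..<m}) \<le> classes" unfolding classes_def by (intro card_mono) auto
  then have "Suc n ^ card (key ` {..<m}) \<le> Suc n ^ classes" by (intro power_increasing) auto
  then show ?thesis using states_le by simp
qed

lemma place_less: "j < n \<Longrightarrow> place j < 2 ^ b"
proof -
  assume "j < n"
  then have "place j \<le> Suc n ^ classes"
    unfolding place_def classes_def using cls_less[of j n] by (intro power_increasing) auto
  then show ?thesis using states_le X_small by simp
qed

lemma spec_place_loop:
  assumes "loaded \<sigma>" "\<sigma> iJ 0 = j" "j < n" "\<And>i. i < j \<Longrightarrow> \<sigma> aPlace i = place i"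
  shows "spec place_loop \<sigma> (\<lambda>\<tau>. \<tau> aPlace =
    (\<sigma> aPlace)(j := if \<exists>i<j. key i = key j then place j else \<sigma> aPlace j))"
proof -
  define Inv where "Inv m \<tau> \<longleftrightarrow> \<tau> aPlace =
      (\<sigma> aPlace)(j := if \<exists>i<m. key i = key j then place j else \<sigma> aPlace j)" for m and \<tau> :: arrays
  let ?c = "If1 (same_e (var iI) (var iJ)) (Put aPlace (var iJ) (Arr aPlace (var iI)))"
  have "spec place_loop \<sigma> (Inv j)"
    unfolding place_loop_def
  proof (rule spec_For)
    fix i and \<tau> :: arrays
    assume i: "i < j" and Inv: "Inv i \<tau>" and \<tau>i: "\<tau> iI 0 = i" and
      frame: "\<And>x. x \<notin> insert iI (writes ?c) \<Longrightarrow> \<tau> x = \<sigma> x"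
    have l: "loaded \<tau>" by (rule loaded_frame[OF assms(1)]; rule frame; simp)
    have "\<tau> iJ = \<sigma> iJ" by (rule frame) simp
    then have \<tau>j: "\<tau> iJ 0 = j" using assms by simp
    have pl: "\<tau> aPlace i = place i" using Inv i assms(4) by (simp add: Inv_def)
    show "spec ?c \<tau> (Inv (Suc i))"
    proof (cases "key i = key j")
      case True
      then have "place i = place j" by (simp add: place_def cls_def)
      with True show ?thesis
        using Inv pl place_less[of j] assms(3) \<tau>i \<tau>j
        by (auto simp: spec_simps lval_same[OF l] Inv_def less_Suc_eq)
    next
      case False
      then have "(\<exists>i'<Suc i. key i' = key j) \<longleftrightarrow> (\<exists>i'<i. key i' = key j)" by (auto simp: less_Suc_eq)
      with False show ?thesis
        using Inv \<tau>i \<tau>j by (simp add: spec_simps lval_same[OF l] Inv_def)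
    qed
  qed (use assms n_le_X in \<open>auto simp: Inv_def\<close>)
  then show ?thesis by (rule spec_mono) (simp add: Inv_def)
qed

lemma spec_rank_loop:
  assumes "loaded \<sigma>" "\<sigma> iJ 0 = j" "j < n" "\<sigma> aRank j = 0"
  shows "spec rank_loop \<sigma> (\<lambda>\<tau>. \<tau> aRank = (\<sigma> aRank)(j := rank j))"
proof -
  define f where "f m = card {i. i < m \<and> key i = key j \<and> before i j}" for m
  define Inv where "Inv m \<tau> \<longleftrightarrow> \<tau> aRank = (\<sigma> aRank)(j := f m)" for m and \<tau> :: arrays
  let ?c = "If1 (same_e (var iI) (var iJ) *: before_e (var iI) (var iJ))
        (Put aRank (var iJ) (Arr aRank (var iJ) +: Lit 1))"
  have "spec rank_loop \<sigma> (Inv n)"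
    unfolding rank_loop_def
  proof (rule spec_For)
    fix i and \<tau> :: arrays
    assume i: "i < n" and Inv: "Inv i \<tau>" and \<tau>i: "\<tau> iI 0 = i" and
      frame: "\<And>x. x \<notin> insert iI (writes ?c) \<Longrightarrow> \<tau> x = \<sigma> x"
    have l: "loaded \<tau>" by (rule loaded_frame[OF assms(1)]; rule frame; simp)
    have "\<tau> iJ = \<sigma> iJ" by (rule frame) simp
    then have \<tau>j: "\<tau> iJ 0 = j" using assms by simp
    have "{x. x < Suc i \<and> key x = key j \<and> before x j} =
        (if key i = key j \<and> before i j then insert i else (\<lambda>A. A)) {x. x < i \<and> key x = key j \<and> before x j}"
      by (auto simp: less_Suc_eq)
    then have f: "f (Suc i) = f i + of_bool (key i = key j \<and> before i j)"
      by (simp add: f_def)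
    have "f i \<le> card {..<i}" unfolding f_def by (intro card_mono) auto
    then have "f i + 1 < 2 ^ b" using i n_small' by simp
    then show "spec ?c \<tau> (Inv (Suc i))"
      using Inv \<tau>i \<tau>j by (simp add: spec_simps lval_same[OF l] lval_before[OF l] Inv_def f)
  qed (use assms n_le_X in \<open>auto simp: Inv_def f_def\<close>)
  then show ?thesis by (rule spec_mono) (simp add: Inv_def f_def rank_def)
qed

lemma spec_classify:
  assumes "loaded \<sigma>"
  shows "spec classify \<sigma> classified"
proof -
  define Inv where "Inv m \<tau> \<longleftrightarrow> \<tau> xStates 0 = Suc n ^ card (key ` {..<m}) \<and>
    (\<forall>j<m. \<tau> aPlace j = place j \<and> \<tau> aRank j = rank j)" for m and \<tau> :: arrays
  let ?d = "If1 (eq_e (Arr aPlace (var iJ)) (var xStates))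
         (assign xStates (var xStates *: (Size +: Lit 1))) ;;
       Put aRank (var iJ) (Lit 0) ;;
       rank_loop"
  let ?c = "Put aPlace (var iJ) (var xStates) ;; place_loop ;; ?d"
  define \<sigma>' where "\<sigma>' = upd \<sigma> xStates 0 1"
  have l': "loaded \<sigma>'" using assms by (simp add: loaded_def \<sigma>'_def)
  have "spec (For iJ Size ?c) \<sigma>' (Inv n)"
  proof (rule spec_For)
    fix j and \<tau> :: arrays
    assume j: "j < n" and Inv: "Inv j \<tau>" and \<tau>j: "\<tau> iJ 0 = j" and
      frame: "\<And>x. x \<notin> insert iJ (writes ?c) \<Longrightarrow> \<tau> x = \<sigma>' x"
    have l: "loaded \<tau>" by (rule loaded_frame[OF l']; rule frame; simp)
    let ?S = "Suc n ^ card (key ` {..<j})"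
    have S: "\<tau> xStates 0 = ?S" "?S < 2 ^ b"
      using Inv card_keys_le[of j] j X_small by (auto simp: Inv_def)
    let ?\<tau>1 = "upd \<tau> aPlace j ?S"
    have l1: "loaded ?\<tau>1" using l by (simp add: loaded_def)
    have "spec place_loop ?\<tau>1 (\<lambda>\<tau>'. \<tau>' aPlace =
        (?\<tau>1 aPlace)(j := if \<exists>i<j. key i = key j then place j else ?\<tau>1 aPlace j))"
      by (rule spec_place_loop[OF l1]) (use j \<tau>j Inv in \<open>auto simp: Inv_def\<close>)
    then have "spec place_loop ?\<tau>1 (\<lambda>\<tau>'. spec ?d \<tau>' (Inv (Suc j)))"
    proof (rule spec_mono)
      fix \<tau>2 :: arrays
      assume fr: "\<And>a. a \<notin> writes place_loop \<Longrightarrow> \<tau>2 a = ?\<tau>1 a"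
        and pl: "\<tau>2 aPlace = (?\<tau>1 aPlace)(j := if \<exists>i<j. key i = key j then place j else ?\<tau>1 aPlace j)"
      have l2: "loaded \<tau>2" by (rule loaded_frame[OF l1]; rule fr; simp)
      have f2: "\<tau>2 iJ = \<tau> iJ" "\<tau>2 xStates = \<tau> xStates" "\<tau>2 aRank = \<tau> aRank" by (simp_all add: fr)
      have plj: "\<tau>2 aPlace j = place j"
        using pl cls_new[of j] by (auto simp: place_def)
      have pli: "\<tau>2 aPlace i = place i" if "i < j" for i using that pl Inv by (simp add: Inv_def)
      \<comment> \<open>A class seen before has a smaller exponent, so comparing place values
        decides whether \<open>j\<close> opens a class.\<close>
      have new: "place j = ?S \<longleftrightarrow> \<not> (\<exists>i<j. key i = key j)"
      proof (cases "\<exists>i<j. key i = key j")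
        case True
        then obtain i where "i < j" "key i = key j" by blast
        then have "cls j < card (key ` {..<j})" using cls_less[of i j] cls_eq_iff[of i j] by simp
        then have "place j < ?S" unfolding place_def using j by (intro power_strict_increasing) auto
        then show ?thesis using True by simp
      next
        case False
        then show ?thesis using cls_new[of j] by (auto simp: place_def)
      qed
      have card: "Suc n ^ card (key ` {..<Suc j}) = (if place j = ?S then ?S * (n + 1) else ?S)"
      proof (cases "place j = ?S")
        case True
        then have "key j \<notin> key ` {..<j}" using new by auto
        then show ?thesis using True by (simp add: lessThan_Suc)
      next
        case False
        then obtain i where "i < j" "key j = key i" using new by metis
        then have "key j \<in> key ` {..<j}" by auto
        then show ?thesis using False by (simp add: lessThan_Suc insert_absorb)
      qed
      have small: "Suc n ^ card (key ` {..<Suc j}) < 2 ^ b"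
        using card_keys_le[of "Suc j"] j X_small by simp
      define \<tau>3 where "\<tau>3 = upd (if place j = ?S then upd \<tau>2 xStates 0 (?S * (n + 1)) else \<tau>2) aRank j 0"
      have l3: "loaded \<tau>3" using l2 by (simp add: loaded_def \<tau>3_def)
      have st3: "\<tau>3 xStates 0 = Suc n ^ card (key ` {..<Suc j})"
        using card S f2 by (simp add: \<tau>3_def)
      have "spec rank_loop \<tau>3 (\<lambda>\<tau>'. \<tau>' aRank = (\<tau>3 aRank)(j := rank j))"
        by (rule spec_rank_loop[OF l3]) (use j \<tau>j f2 in \<open>auto simp: \<tau>3_def\<close>)
      then have "spec rank_loop \<tau>3 (Inv (Suc j))"
      proof (rule spec_mono)
        fix \<tau>4 :: arrays
        assume fr4: "\<And>a. a \<notin> writes rank_loop \<Longrightarrow> \<tau>4 a = \<tau>3 a"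
          and rk: "\<tau>4 aRank = (\<tau>3 aRank)(j := rank j)"
        have f4: "\<tau>4 xStates = \<tau>3 xStates" "\<tau>4 aPlace = \<tau>2 aPlace" by (simp_all add: fr4 \<tau>3_def)
        have "\<tau>3 aRank i = rank i" if "i < j" for i
          using that Inv f2 by (simp add: Inv_def \<tau>3_def)
        then show "Inv (Suc j) \<tau>4"
          using rk f4 st3 plj pli by (simp add: Inv_def less_Suc_eq)
      qed
      then show "spec ?d \<tau>2 (Inv (Suc j))"
        using plj S f2 \<tau>j card small by (auto simp: spec_simps \<tau>3_def split: if_splits)
    qed
    then show "spec ?c \<tau> (Inv (Suc j))"
      using S \<tau>j by (simp add: spec_simps)
  qed (use n_le_X in \<open>auto simp: Inv_def \<sigma>'_def\<close>)
  then have "spec (For iJ Size ?c) \<sigma>' classified"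
    by (rule spec_mono) (simp add: Inv_def classified_def classes_def)
  then show ?thesis by (simp add: classify_def spec_simps \<sigma>'_def)
qed

lemma spec_digit_loop:
  assumes "classified \<sigma>" "\<sigma> iS 0 = s"
  shows "spec digit_loop \<sigma> (\<lambda>\<tau>. \<forall>j<n. \<tau> aDigit j = digit s j)"
proof -
  define Inv where "Inv m \<tau> \<longleftrightarrow> (\<forall>j<m. \<tau> aDigit j = digit s j)" for m and \<tau> :: arrays
  let ?c = "Put aDigit (var iJ) (mod_e (var iS /: Arr aPlace (var iJ)) (Size +: Lit 1))"
  have "spec digit_loop \<sigma> (Inv n)"
    unfolding digit_loop_def
  proof (rule spec_For)
    fix j and \<tau> :: arrays
    assume j: "j < n" and Inv: "Inv j \<tau>" and \<tau>j: "\<tau> iJ 0 = j" and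
      frame: "\<And>x. x \<notin> insert iJ (writes ?c) \<Longrightarrow> \<tau> x = \<sigma> x"
    have f: "\<tau> iS = \<sigma> iS" "\<tau> aPlace = \<sigma> aPlace" by (rule frame; simp)+
    have "digit s j < 2 ^ b"
      unfolding digit_def using n_small' by (meson less_trans mod_less_divisor zero_less_Suc)
    then show "spec ?c \<tau> (Inv (Suc j))"
      using Inv f \<tau>j assms j by (auto simp: spec_simps Inv_def digit_def classified_def less_Suc_eq)
  qed (use n_le_X in \<open>auto simp: Inv_def\<close>)
  then show ?thesis by (rule spec_mono) (simp add: Inv_def)
qed

lemma demand_le: "A \<subseteq> {..<n} \<Longrightarrow> demand A x \<le> (\<Sum>i<n. p i)"
  unfolding demand_def by (rule sum_mono2) auto

lemma spec_demand_loop: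
  assumes "loaded \<sigma>" "classified \<sigma>" "\<And>i. i < n \<Longrightarrow> \<sigma> aDigit i = digit s i"
    and "\<sigma> iJ 0 = j" "j < n" "\<sigma> xSum 0 = r j"
  shows "spec demand_loop \<sigma> (\<lambda>\<tau>. \<tau> xSum 0 = r j + demand (taken s) (r j))"
proof -
  define f where "f m = demand (taken s \<inter> {..<m}) (r j)" for m
  define Inv where "Inv m \<tau> \<longleftrightarrow> \<tau> xSum 0 = r j + f m" for m and \<tau> :: arrays
  let ?c = "assign xSum (var xSum +: lt_e (Arr aRank (var iI)) (Arr aDigit (var iI)) *:
        le_e (Arr aR (var iJ)) (Arr aR (var iI)) *: Arr aP (var iI))"
  have "spec demand_loop \<sigma> (Inv n)"
    unfolding demand_loop_def
  proof (rule spec_For)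
    fix i and \<tau> :: arrays
    assume i: "i < n" and Inv: "Inv i \<tau>" and \<tau>i: "\<tau> iI 0 = i" and
      frame: "\<And>x. x \<notin> insert iI (writes ?c) \<Longrightarrow> \<tau> x = \<sigma> x"
    have l: "loaded \<tau>" by (rule loaded_frame[OF assms(1)]; rule frame; simp)
    have c: "classified \<tau>" by (rule classified_frame[OF assms(2)]; rule frame; simp)
    have fr: "\<tau> iJ = \<sigma> iJ" "\<tau> aDigit = \<sigma> aDigit" by (rule frame; simp)+
    have "{x \<in> taken s \<inter> {..<Suc i}. r j \<le> r x} =
      (if i \<in> taken s \<and> r j \<le> r i then insert i else (\<lambda>A. A)) {x \<in> taken s \<inter> {..<i}. r j \<le> r x}"
      by (auto simp: less_Suc_eq)
    then have f: "f (Suc i) = f i + of_bool (i \<in> taken s) * of_bool (r j \<le> r i) * p i"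
      by (simp add: f_def demand_def)
    have mem: "i \<in> taken s \<longleftrightarrow> rank i < digit s i" using i by (simp add: taken_def)
    have "f (Suc i) \<le> (\<Sum>i<n. p i)" unfolding f_def using taken_subset by (intro demand_le) auto
    then have "r j + f (Suc i) < 2 ^ b" using h_le[OF assms(5)] h_small by linarith
    then show "spec ?c \<tau> (Inv (Suc i))"
      using Inv \<tau>i fr l c assms i
      by (simp add: spec_simps Inv_def f mem loaded_def classified_def del: of_bool_eq)
  qed (use assms n_le_X in \<open>auto simp: Inv_def f_def demand_def\<close>)
  moreover have "taken s \<inter> {..<n} = taken s" using taken_subset by auto
  ultimately show ?thesis by (auto elim!: spec_mono simp: Inv_def f_def)
qed

lemma makespan_le_h: "A \<subseteq> {..<n} \<Longrightarrow> makespan A \<le> h"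
proof (rule makespan_least)
  assume A: "A \<subseteq> {..<n}"
  then show "finite A" by (rule finite_subset) simp
  show "r j + demand A (r j) \<le> h" if "j \<in> A" for j
    using demand_le[OF A, of "r j"] h_le[of j] that A by fastforce
qed

lemma spec_makespan_loop:
  assumes "loaded \<sigma>" "classified \<sigma>" "\<And>i. i < n \<Longrightarrow> \<sigma> aDigit i = digit s i"
  shows "spec makespan_loop \<sigma> (\<lambda>\<tau>. \<tau> xEnd 0 = makespan (taken s))"
proof -
  define f where "f m = Max (insert 0 ((\<lambda>j. r j + demand (taken s) (r j)) ` (taken s \<inter> {..<m})))" for m
  define Inv where "Inv m \<tau> \<longleftrightarrow> \<tau> xEnd 0 = f m" for m and \<tau> :: arrays
  let ?d = "assign xEnd (max_e (var xEnd)
         (lt_e (Arr aRank (var iJ)) (Arr aDigit (var iJ)) *: var xSum))"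
  let ?c = "assign xSum (Arr aR (var iJ)) ;; demand_loop ;; ?d"
  define \<sigma>' where "\<sigma>' = upd \<sigma> xEnd 0 0"
  have l': "loaded \<sigma>'" and c': "classified \<sigma>'"
    using assms by (simp_all add: loaded_def classified_def \<sigma>'_def)
  have "spec (For iJ Size ?c) \<sigma>' (Inv n)"
  proof (rule spec_For)
    fix j and \<tau> :: arrays
    assume j: "j < n" and Inv: "Inv j \<tau>" and \<tau>j: "\<tau> iJ 0 = j" and
      frame: "\<And>x. x \<notin> insert iJ (writes ?c) \<Longrightarrow> \<tau> x = \<sigma>' x"
    have l: "loaded \<tau>" by (rule loaded_frame[OF l']; rule frame; simp)
    have c: "classified \<tau>" by (rule classified_frame[OF c']; rule frame; simp)
    have dg: "\<tau> aDigit = \<sigma> aDigit" by (simp add: frame \<sigma>'_def)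
    let ?\<tau>1 = "upd \<tau> xSum 0 (r j)"
    have l1: "loaded ?\<tau>1" and c1: "classified ?\<tau>1"
      using l c by (simp_all add: loaded_def classified_def)
    let ?D = "r j + demand (taken s) (r j)"
    have small: "?D \<le> h"
      using demand_le[OF taken_subset, of s "r j"] h_le[OF j] by linarith
    have f: "f (Suc j) = max (f j) (of_bool (j \<in> taken s) * ?D)"
    proof (cases "j \<in> taken s")
      case True
      then have "taken s \<inter> {..<Suc j} = insert j (taken s \<inter> {..<j})" by (auto simp: less_Suc_eq)
      then have "f (Suc j) = Max (insert ?D (insert 0
          ((\<lambda>j. r j + demand (taken s) (r j)) ` (taken s \<inter> {..<j}))))"
        by (simp only: f_def image_insert insert_commute)
      also have "\<dots> = max ?D (f j)"
        unfolding f_def by (rule Max_insert) (use finite_taken in auto)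
      finally show ?thesis using True by (simp add: max.commute)
    next
      case False
      then have "taken s \<inter> {..<Suc j} = taken s \<inter> {..<j}" by (auto simp: less_Suc_eq)
      then show ?thesis using False by (simp add: f_def)
    qed
    have mem: "j \<in> taken s \<longleftrightarrow> rank j < digit s j" using j by (simp add: taken_def)
    have "f (Suc j) \<le> makespan (taken s)"
      unfolding f_def makespan_def using finite_taken by (intro Max_mono) auto
    then have fs: "f (Suc j) < 2 ^ b" using makespan_le_h[OF taken_subset, of s] h_small by linarith
    have "spec demand_loop ?\<tau>1 (\<lambda>\<tau>. \<tau> xSum 0 = ?D)"
      by (rule spec_demand_loop[OF l1 c1]) (use \<tau>j j dg assms in auto)
    then have "spec demand_loop ?\<tau>1 (\<lambda>\<tau>'. spec ?d \<tau>' (Inv (Suc j)))"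
    proof (rule spec_mono)
      fix \<tau>2 :: arrays
      assume fr: "\<And>a. a \<notin> writes demand_loop \<Longrightarrow> \<tau>2 a = ?\<tau>1 a" and D: "\<tau>2 xSum 0 = ?D"
      have "\<tau>2 aRank = \<tau> aRank" "\<tau>2 aDigit = \<tau> aDigit" "\<tau>2 xEnd = \<tau> xEnd" "\<tau>2 iJ = \<tau> iJ"
        by (simp_all add: fr)
      then show "spec ?d \<tau>2 (Inv (Suc j))"
        using D f fs mem Inv \<tau>j c j dg assms(3)
        by (simp add: spec_simps Inv_def classified_def del: of_bool_eq max_less_iff_conj)
    qed
    then show "spec ?c \<tau> (Inv (Suc j))"
      using \<tau>j l small h_small by (simp add: spec_simps loaded_def)
  qed (use n_le_X in \<open>auto simp: Inv_def f_def \<sigma>'_def\<close>)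
  then have "spec (For iJ Size ?c) \<sigma>' (\<lambda>\<tau>. \<tau> xEnd 0 = makespan (taken s))"
  proof (rule spec_mono)
    have "taken s \<inter> {..<n} = taken s" using taken_subset by auto
    then show "\<tau> xEnd 0 = makespan (taken s)" if "Inv n \<tau>" for \<tau>
      using that by (simp add: Inv_def f_def makespan_def)
  qed
  then show ?thesis by (simp add: makespan_loop_def spec_simps \<sigma>'_def)
qed

end


section \<open>The table of unreduced fractions\<close>

context instance_data
begin

definition g_val :: "nat \<Rightarrow> nat \<Rightarrow> real" where
  "g_val i t = real (fst (q i t)) / real (snd (q i t))"

definition candidate :: "(nat \<Rightarrow> nat) \<Rightarrow> (nat \<Rightarrow> nat) \<Rightarrow> nat \<Rightarrow> nat \<Rightarrow> real" where
  "candidate num den s j = real (num (s - place j)) / real (den (s - place j)) +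
     real (v j) * g_val (u j) (makespan (taken s))"

text \<open>Taking one more job multiplies numerator and denominator by a number below
  \<open>2 ^ L\<close> and adds at most \<open>X * 2 ^ L\<close> times the old denominator to the
  numerator. Counting the taken jobs makes the bound reproduce itself.\<close>

definition fits :: "nat \<Rightarrow> nat \<Rightarrow> nat \<Rightarrow> bool" where
  "fits s x y \<longleftrightarrow> 0 < y \<and> x \<le> card (taken s) * X * 2 ^ (L * card (taken s)) \<and>
     y \<le> 2 ^ (L * card (taken s))"

definition best :: "(nat \<Rightarrow> nat) \<Rightarrow> (nat \<Rightarrow> nat) \<Rightarrow> nat \<Rightarrow> nat \<Rightarrow> nat \<Rightarrow> nat \<Rightarrow> nat \<Rightarrow> bool" where
  "best num den s m x y z \<longleftrightarrow>
     (if \<exists>j<m. last_taken s j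
      then fits s x y \<and> z < n \<and> last_taken s z \<and> real x / real y = candidate num den s z \<and>
        (\<forall>j<m. last_taken s j \<longrightarrow> real x / real y \<le> candidate num den s j)
      else x = 1 \<and> y = 0)"

text \<open>The table also has entries for numbers that encode no set of jobs. Whatever has no
  last-taken job, such as the empty state 0, receives the value 0.\<close>

definition solved :: "(nat \<Rightarrow> nat) \<Rightarrow> (nat \<Rightarrow> nat) \<Rightarrow> (nat \<Rightarrow> nat) \<Rightarrow> nat \<Rightarrow> bool" where
  "solved num den ch s \<longleftrightarrow> fits s (num s) (den s) \<and>
     (if \<exists>j<n. last_taken s j then best num den s n (num s) (den s) (ch s) else num s = 0)"

lemma X_ge1: "1 \<le> X"
  using n_le by simp

lemma card_taken_le: "card (taken s) \<le> X"
proof -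
  have "card (taken s) \<le> card {..<n}" using taken_subset by (intro card_mono) auto
  then show ?thesis using n_le_X by simp
qed

lemma fits_small: "fits s x y \<Longrightarrow> x < 2 ^ b \<and> y < 2 ^ b"
proof -
  assume f: "fits s x y"
  let ?c = "card (taken s)"
  have c: "2 ^ (L * ?c) \<le> (2::nat) ^ (L * X)" using card_taken_le by (intro power_increasing) auto
  have "x \<le> ?c * X * 2 ^ (L * ?c)" using f by (simp add: fits_def)
  also have "\<dots> \<le> X * X * 2 ^ (L * X)" using c card_taken_le by (intro mult_le_mono) auto
  finally have x: "x < 2 ^ b" using b_bound by linarith
  have "y \<le> 1 * 1 * 2 ^ (L * ?c)" using f by (simp add: fits_def)
  also have "\<dots> \<le> X * X * 2 ^ (L * X)" using c X_ge1 by (intro mult_le_mono) auto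
  finally show ?thesis using x b_bound by linarith
qed

text \<open>Place values are positive, so candidates for \<open>s\<close> read only entries below
  \<open>s\<close> and are unaffected while entry \<open>s\<close> is overwritten.\<close>

lemma candidate_cong:
  "(\<And>t. t < s \<Longrightarrow> num t = num' t \<and> den t = den' t) \<Longrightarrow> j < n \<Longrightarrow> last_taken s j \<Longrightarrow>
    candidate num den s j = candidate num' den' s j"
proof -
  assume *: "\<And>t. t < s \<Longrightarrow> num t = num' t \<and> den t = den' t" and j: "j < n" "last_taken s j"
  have "s - place j < s" using taken_diff(1)[OF j] place_pos[of j] by linarith
  then show ?thesis using * by (simp add: candidate_def)
qed

lemma best_cong:
  assumes "\<And>t. t < s \<Longrightarrow> num t = num' t \<and> den t = den' t" "m \<le> n"
  shows "best num den s m x y z \<longleftrightarrow> best num' den' s m x y z"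
proof -
  have "candidate num den s j = candidate num' den' s j" if "j < n" "last_taken s j" for j
    by (rule candidate_cong[OF assms(1) that])
  then show ?thesis using assms(2) unfolding best_def
    by (smt (verit, best) order_less_le_trans)
qed

lemma solved_cong:
  assumes "\<And>t. t \<le> s \<Longrightarrow> num t = num' t \<and> den t = den' t \<and> ch t = ch' t"
  shows "solved num den ch s \<longleftrightarrow> solved num' den' ch' s"
  using assms best_cong[of s num num' den den' n] unfolding solved_def
  by (cases "\<exists>j<n. last_taken s j") (simp_all only: if_True if_False order_refl less_imp_le)

lemma spec_try_job:
  assumes l: "loaded \<sigma>" and c: "classified \<sigma>" and E: "\<sigma> xEnd 0 = makespan (taken s)"
    and s: "\<sigma> iS 0 = s" "s < Suc n ^ classes" and j: "\<sigma> iJ 0 = j" "j < n" "last_taken s j"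
    and tab: "\<sigma> aNum = num(s := x)" "\<sigma> aDen = den(s := y)" "\<sigma> aChoice = ch(s := z)"
    and best: "best num den s j x y z"
    and IH: "\<And>t. t < s \<Longrightarrow> solved num den ch t"
  shows "spec try_job \<sigma> (\<lambda>\<tau>. \<exists>x y z. \<tau> aNum = num(s := x) \<and> \<tau> aDen = den(s := y) \<and>
    \<tau> aChoice = ch(s := z) \<and> best num den s (Suc j) x y z)"
proof -
  define t where "t = s - place j"
  have ts: "t < s" unfolding t_def using taken_diff(1)[OF j(2,3)] place_pos[of j] by linarith
  let ?E = "makespan (taken s)"
  define a d where "a = fst (q (u j) ?E)" and "d = snd (q (u j) ?E)"
  have Eh: "?E \<le> h" by (rule makespan_le_h[OF taken_subset])
  have uk: "u j < k" by (rule u_less[OF j(2)])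
  have ad: "a < 2 ^ L" "d < 2 ^ L" "0 < d" using q_bound[OF uk Eh] by (auto simp: a_def d_def)
  define cn cd where "cn = num t * d + v j * a * den t" and "cd = den t * d"
  have fit_t: "fits t (num t) (den t)" using IH[OF ts] by (simp add: solved_def)
  let ?c = "card (taken t)"
  have card: "card (taken s) = Suc ?c"
    using taken_diff(2,3)[OF j(2,3)] finite_taken[of s]
    by (metis card_Suc_Diff1 t_def)
  have fit: "fits s cn cd"
  proof -
    have "num t * d \<le> (?c * X * 2 ^ (L * ?c)) * 2 ^ L"
      using fit_t ad(2) by (intro mult_le_mono) (auto simp: fits_def)
    moreover have "v j * a * den t \<le> X * 2 ^ L * 2 ^ (L * ?c)"
      using fit_t ad(1) v_le[OF j(2)] by (intro mult_le_mono) (auto simp: fits_def)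
    ultimately have "cn \<le> (?c * X * 2 ^ (L * ?c)) * 2 ^ L + X * 2 ^ L * 2 ^ (L * ?c)"
      unfolding cn_def by (rule add_mono)
    also have "\<dots> = Suc ?c * X * 2 ^ (L * Suc ?c)" by (simp add: algebra_simps power_add)
    finally have 1: "cn \<le> Suc ?c * X * 2 ^ (L * Suc ?c)" .
    have "cd \<le> 2 ^ (L * ?c) * 2 ^ L"
      unfolding cd_def using fit_t ad(2) by (intro mult_le_mono) (auto simp: fits_def)
    also have "\<dots> = 2 ^ (L * Suc ?c)" by (simp add: power_add)
    finally have 2: "cd \<le> 2 ^ (L * Suc ?c)" .
    have "0 < cd" using fit_t ad(3) by (simp add: cd_def fits_def)
    with 1 2 show ?thesis unfolding fits_def card by blast
  qed
  have small: "cn < 2 ^ b" "cd < 2 ^ b" using fits_small[OF fit] by auto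
  have cd: "0 < cd" using fit by (simp add: fits_def)
  have cand: "real cn / real cd = candidate num den s j"
    using fit_t ad(3)
    by (simp add: cn_def cd_def candidate_def g_val_def fits_def a_def[symmetric] d_def[symmetric]
        t_def[symmetric] field_simps)
  have less: "j < 2 ^ b" using j(2) n_small by simp
  have upd: "best num den s (Suc j) cn cd j" if "cn * y < x * cd"
  proof -
    have "real cn / real cd \<le> candidate num den s i" if "i < j" "last_taken s i" for i
    proof -
      have b: "fits s x y" "real x / real y \<le> candidate num den s i"
        using best that by (auto simp: best_def split: if_splits)
      have "real (cn * y) \<le> real (x * cd)" using \<open>cn * y < x * cd\<close> by (intro of_nat_mono) simp
      then have "real cn / real cd \<le> real x / real y"
        using b(1) cd by (simp add: fits_def divide_le_eq le_divide_eq field_simps)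
      then show ?thesis using b(2) by simp
    qed
    then show ?thesis using fit j cand by (auto simp: best_def less_Suc_eq)
  qed
  have keep: "best num den s (Suc j) x y z" if "\<not> cn * y < x * cd"
  proof -
    \<comment> \<open>With \<open>y = 0\<close> the entry is still 1/0, and then the comparison
      would have succeeded.\<close>
    have y: "y \<noteq> 0"
    proof
      assume "y = 0"
      then have "x = 1" using best by (auto simp: best_def fits_def split: if_splits)
      with that \<open>y = 0\<close> cd show False by simp
    qed
    then have ex: "\<exists>i<j. last_taken s i" using best by (auto simp: best_def split: if_splits)
    have "real (x * cd) \<le> real (cn * y)" using that by (intro of_nat_mono) simp
    then have "real x / real y \<le> real cn / real cd"
      using y cd by (simp add: divide_le_eq le_divide_eq field_simps)
    then show ?thesis using best ex cand j by (auto simp: best_def less_Suc_eq)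
  qed
  have vals: "\<sigma> aPlace j = place j" "\<sigma> aU j = u j" "\<sigma> aV j = v j"
    using l c j by (auto simp: loaded_def classified_def)
  show ?thesis
  proof (cases "cn * y < x * cd")
    case True
    have "num(s := x, s := cn) = num(s := cn)" "den(s := y, s := cd) = den(s := cd)" by simp_all
    with True show ?thesis
      using s j E tab vals small less uk Eh ts upd
      by (auto simp: try_job_def spec_simps cn_def cd_def a_def d_def t_def)
  next
    case False
    then show ?thesis
      using s j E tab vals small less uk Eh ts keep
      by (auto simp: try_job_def spec_simps cn_def cd_def a_def d_def t_def)
  qed
qed

lemma spec_choice_loop:
  assumes l: "loaded \<sigma>" and c: "classified \<sigma>" and E: "\<sigma> xEnd 0 = makespan (taken s)"
    and dg: "\<And>i. i < n \<Longrightarrow> \<sigma> aDigit i = digit s i"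
    and s: "\<sigma> iS 0 = s" "s < Suc n ^ classes"
    and tab: "\<sigma> aNum = num(s := 1)" "\<sigma> aDen = den(s := 0)" "\<sigma> aChoice = ch"
    and IH: "\<And>t. t < s \<Longrightarrow> solved num den ch t"
  shows "spec choice_loop \<sigma> (\<lambda>\<tau>. \<exists>x y z. \<tau> aNum = num(s := x) \<and> \<tau> aDen = den(s := y) \<and>
    \<tau> aChoice = ch(s := z) \<and> best num den s n x y z)"
proof -
  define Inv where "Inv m \<tau> \<longleftrightarrow> (\<exists>x y z. \<tau> aNum = num(s := x) \<and> \<tau> aDen = den(s := y) \<and>
    \<tau> aChoice = ch(s := z) \<and> best num den s m x y z)" for m and \<tau> :: arrays
  let ?c = "If1 (eq_e (Arr aDigit (var iJ)) (Arr aRank (var iJ) +: Lit 1)) try_job"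
  have "spec choice_loop \<sigma> (Inv n)"
    unfolding choice_loop_def
  proof (rule spec_For)
    show "Inv 0 \<sigma>"
      unfolding Inv_def
      by (rule exI[of _ 1], rule exI[of _ 0], rule exI[of _ "ch s"]) (simp add: tab best_def)
    fix j and \<tau> :: arrays
    assume j: "j < n" and Inv: "Inv j \<tau>" and \<tau>j: "\<tau> iJ 0 = j" and
      frame: "\<And>x. x \<notin> insert iJ (writes ?c) \<Longrightarrow> \<tau> x = \<sigma> x"
    have l': "loaded \<tau>" by (rule loaded_frame[OF l]; rule frame; simp)
    have c': "classified \<tau>" by (rule classified_frame[OF c]; rule frame; simp)
    have f: "\<tau> xEnd = \<sigma> xEnd" "\<tau> iS = \<sigma> iS" "\<tau> aDigit = \<sigma> aDigit" by (rule frame; simp)+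
    from Inv obtain x y z where xyz: "\<tau> aNum = num(s := x)" "\<tau> aDen = den(s := y)"
      "\<tau> aChoice = ch(s := z)" "best num den s j x y z" by (auto simp: Inv_def)
    have test: "lval \<tau> (eq_e (Arr aDigit (var iJ)) (Arr aRank (var iJ) +: Lit 1)) = of_bool (last_taken s j)"
      using c' j \<tau>j f dg by (simp add: classified_def last_taken_def)
    show "spec ?c \<tau> (Inv (Suc j))"
    proof (cases "last_taken s j")
      case True
      have "spec try_job \<tau> (Inv (Suc j))"
        unfolding Inv_def by (rule spec_try_job[OF l' c']) (use f E s j \<tau>j True xyz IH in auto)
      then show ?thesis unfolding spec_simps test using True by simp
    next
      case False
      then have "i < Suc j \<and> last_taken s i \<longleftrightarrow> i < j \<and> last_taken s i" for i
        by (auto simp: less_Suc_eq)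
      then have "best num den s (Suc j) x y z"
        using xyz(4) by (simp only: best_def imp_conjL[symmetric])
      then have "Inv (Suc j) \<tau>" using xyz unfolding Inv_def by blast
      then show ?thesis unfolding spec_simps test using False by simp
    qed
  qed (use n_le_X in \<open>auto simp: Inv_def\<close>)
  then show ?thesis unfolding Inv_def .
qed

text \<open>Increasing numerical order is a valid evaluation order because every predecessor
  \<open>s - place j\<close> is smaller than \<open>s\<close>.\<close>

lemma spec_dp:
  assumes l: "loaded \<sigma>" and c: "classified \<sigma>"
  shows "spec dp \<sigma> (\<lambda>\<tau>. \<forall>s<Suc n ^ classes. solved (\<tau> aNum) (\<tau> aDen) (\<tau> aChoice) s)"
proof -
  define Inv where "Inv m \<tau> \<longleftrightarrow> (\<forall>s<m. solved (\<tau> aNum) (\<tau> aDen) (\<tau> aChoice) s)"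
    for m and \<tau> :: arrays
  let ?e = "If1 (eq_e (Arr aDen (var iS)) (Lit 0))
       (Put aNum (var iS) (Lit 0) ;; Put aDen (var iS) (Lit 1))"
  let ?d = "Put aNum (var iS) (Lit 1) ;; Put aDen (var iS) (Lit 0) ;; choice_loop ;; ?e"
  let ?c = "digit_loop ;; makespan_loop ;; ?d"
  have "spec dp \<sigma> (Inv (Suc n ^ classes))"
    unfolding dp_def
  proof (rule spec_For)
    fix s and \<tau> :: arrays
    assume s: "s < Suc n ^ classes" and Inv: "Inv s \<tau>" and \<tau>s: "\<tau> iS 0 = s" and
      frame: "\<And>x. x \<notin> insert iS (writes ?c) \<Longrightarrow> \<tau> x = \<sigma> x"
    have l1: "loaded \<tau>" by (rule loaded_frame[OF l]; rule frame; simp)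
    have c1: "classified \<tau>" by (rule classified_frame[OF c]; rule frame; simp)
    define num den ch where "num = \<tau> aNum" and "den = \<tau> aDen" and "ch = \<tau> aChoice"
    have IH: "solved num den ch t" if "t < s" for t
      using Inv that by (simp add: Inv_def num_def den_def ch_def)
    have "spec digit_loop \<tau> (\<lambda>\<tau>'. spec (makespan_loop ;; ?d) \<tau>' (Inv (Suc s)))"
    proof (rule spec_mono[OF spec_digit_loop[OF c1 \<tau>s]])
      fix \<tau>2 :: arrays
      assume fr2: "\<And>a. a \<notin> writes digit_loop \<Longrightarrow> \<tau>2 a = \<tau> a"
        and dg: "\<forall>j<n. \<tau>2 aDigit j = digit s j"
      have l2: "loaded \<tau>2" by (rule loaded_frame[OF l1]; rule fr2; simp)
      have c2: "classified \<tau>2" by (rule classified_frame[OF c1]; rule fr2; simp)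
      have f2: "\<tau>2 iS = \<tau> iS" "\<tau>2 aNum = num" "\<tau>2 aDen = den" "\<tau>2 aChoice = ch"
        by (simp_all add: fr2 num_def den_def ch_def)
      have "spec makespan_loop \<tau>2 (\<lambda>\<tau>'. spec ?d \<tau>' (Inv (Suc s)))"
      proof (rule spec_mono[OF spec_makespan_loop[OF l2 c2, of s]])
        show "\<tau>2 aDigit i = digit s i" if "i < n" for i using dg that by simp
        fix \<tau>3 :: arrays
        assume fr3: "\<And>a. a \<notin> writes makespan_loop \<Longrightarrow> \<tau>3 a = \<tau>2 a"
          and E: "\<tau>3 xEnd 0 = makespan (taken s)"
        have l3: "loaded \<tau>3" by (rule loaded_frame[OF l2]; rule fr3; simp)
        have c3: "classified \<tau>3" by (rule classified_frame[OF c2]; rule fr3; simp)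
        have f3: "\<tau>3 iS = \<tau> iS" "\<tau>3 aNum = num" "\<tau>3 aDen = den" "\<tau>3 aChoice = ch"
          "\<tau>3 aDigit = \<tau>2 aDigit"
          by (simp_all add: fr3 f2)
        define \<tau>4 where "\<tau>4 = upd (upd \<tau>3 aNum s 1) aDen s 0"
        have l4: "loaded \<tau>4" and c4: "classified \<tau>4"
          using l3 c3 by (simp_all add: loaded_def classified_def \<tau>4_def)
        have "spec choice_loop \<tau>4 (\<lambda>\<tau>'. \<exists>x y z. \<tau>' aNum = num(s := x) \<and> \<tau>' aDen = den(s := y) \<and>
            \<tau>' aChoice = ch(s := z) \<and> best num den s n x y z)"
          by (rule spec_choice_loop[OF l4 c4]) (use E f3 dg \<tau>s s IH in \<open>auto simp: \<tau>4_def\<close>)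
        then have "spec choice_loop \<tau>4 (\<lambda>\<tau>'. spec ?e \<tau>' (Inv (Suc s)))"
        proof (rule spec_mono)
          fix \<tau>5 :: arrays
          assume fr5: "\<And>a. a \<notin> writes choice_loop \<Longrightarrow> \<tau>5 a = \<tau>4 a"
            and ex: "\<exists>x y z. \<tau>5 aNum = num(s := x) \<and> \<tau>5 aDen = den(s := y) \<and>
              \<tau>5 aChoice = ch(s := z) \<and> best num den s n x y z"
          from ex obtain x y z where xyz: "\<tau>5 aNum = num(s := x)" "\<tau>5 aDen = den(s := y)"
            "\<tau>5 aChoice = ch(s := z)" "best num den s n x y z" by blast
          have s5: "\<tau>5 iS 0 = s" using fr5[of iS] f3 \<tau>s by (simp add: \<tau>4_def)
          have old: "solved (num(s := x')) (den(s := y')) (ch(s := z)) t" if "t < s" for t x' y'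
            using IH[OF that] solved_cong[of t num "num(s := x')" den "den(s := y')" ch "ch(s := z)"] that
            by simp
          show "spec ?e \<tau>5 (Inv (Suc s))"
          proof (cases "\<exists>j<n. last_taken s j")
            case True
            then have fit: "fits s x y" using xyz(4) by (simp add: best_def)
            have "best (num(s := x)) (den(s := y)) s n x y z"
              using xyz(4) best_cong[of s num "num(s := x)" den "den(s := y)" n] by simp
            then have "solved (num(s := x)) (den(s := y)) (ch(s := z)) s"
              using True fit by (simp add: solved_def)
            then have "Inv (Suc s) \<tau>5" using xyz old by (simp add: Inv_def less_Suc_eq all_conj_distrib)
            then show ?thesis using s5 xyz fit by (simp add: spec_simps fits_def)
          next
            case False
            then have "x = 1" "y = 0" using xyz(4) by (auto simp: best_def)
            \<comment> \<open>Without a last-taken job the entry is still 1/0, which the final test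
              of the loop turns into 0/1.\<close>
            moreover have "solved (num(s := 0)) (den(s := 1)) (ch(s := z)) s"
              using False by (auto simp: solved_def fits_def)
            then have "Inv (Suc s) (upd (upd \<tau>5 aNum s 0) aDen s 1)"
              using xyz old[of _ 0 1] by (auto simp: Inv_def less_Suc_eq)
            ultimately show ?thesis using s5 xyz by (simp add: spec_simps)
          qed
        qed
        then show "spec ?d \<tau>3 (Inv (Suc s))" using f3 \<tau>s by (simp add: spec_simps \<tau>4_def)
      qed
      then show "spec (makespan_loop ;; ?d) \<tau>2 (Inv (Suc s))" by (rule spec_Comp)
    qed
    then show "spec ?c \<tau> (Inv (Suc s))" by (rule spec_Comp)
  qed (use states_le c in \<open>auto simp: Inv_def classified_def\<close>)
  then show ?thesis unfolding Inv_def .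
qed

end


section \<open>Correctness of the schedule\<close>

definition pieces :: "arrays \<Rightarrow> nat \<Rightarrow> (nat \<times> nat \<times> nat) list" where
  "pieces \<sigma> c = map (\<lambda>i. (\<sigma> 0 (3 * i + 1), \<sigma> 0 (3 * i + 2), \<sigma> 0 (3 * i + 3))) [0..<c]"

lemma pieces_cong: "\<tau> 0 = \<sigma> 0 \<Longrightarrow> pieces \<tau> c = pieces \<sigma> c"
  by (simp add: pieces_def)

lemma pieces_Suc:
  assumes "\<tau> 0 = (\<sigma> 0)(3 * c + 1 := x, 3 * c + 2 := y, 3 * c + 3 := z)"
  shows "pieces \<tau> (Suc c) = pieces \<sigma> c @ [(x, y, z)]"
  using assms by (auto simp: pieces_def)

section \<open>Recovering a priority order from the table\<close>

context instance_data
begin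

lemma state_small: "A \<subseteq> {..<n} \<Longrightarrow> state A < 2 ^ b"
  using state_less[of A] states_le X_small by simp

lemma spec_full_loop:
  assumes c: "classified \<sigma>" and "\<sigma> xState 0 = 0"
  shows "spec full_loop \<sigma> (\<lambda>\<tau>. \<tau> xState 0 = state {..<n})"
proof -
  define Inv where "Inv m \<tau> \<longleftrightarrow> \<tau> xState 0 = state {..<m}" for m and \<tau> :: arrays
  let ?c = "assign xState (var xState +: Arr aPlace (var iJ))"
  have "spec full_loop \<sigma> (Inv n)"
    unfolding full_loop_def
  proof (rule spec_For)
    fix j and \<tau> :: arrays
    assume j: "j < n" and Inv: "Inv j \<tau>" and \<tau>j: "\<tau> iJ 0 = j" and
      frame: "\<And>x. x \<notin> insert iJ (writes ?c) \<Longrightarrow> \<tau> x = \<sigma> x"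
    have c': "classified \<tau>" by (rule classified_frame[OF c]; rule frame; simp)
    have "state {..<Suc j} = state {..<j} + place j"
      by (simp add: state_insert lessThan_Suc)
    moreover have "state {..<Suc j} < 2 ^ b" using j by (intro state_small) auto
    ultimately show "spec ?c \<tau> (Inv (Suc j))"
      using Inv c' j \<tau>j by (simp add: spec_simps Inv_def classified_def)
  qed (use assms n_le_X in \<open>auto simp: Inv_def state_def\<close>)
  then show ?thesis by (rule spec_mono) (simp add: Inv_def)
qed

definition step_cost :: "(nat \<Rightarrow> nat) \<Rightarrow> nat set \<Rightarrow> nat \<Rightarrow> real" where
  "step_cost ord A l = real (v (ord l)) * g_val (u (ord l)) (makespan A)"

text \<open>Invariant of backtracking after \<open>m\<close> steps. The prefix up to position
  \<open>l\<close> is written as the complement of the later positions because only these are fixed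
  so far. \<open>s = state (taken s)\<close> keeps \<open>s\<close> a code of an actual set, so that
  a last-taken job exists while jobs remain.\<close>

definition chain :: "(nat \<Rightarrow> real) \<Rightarrow> nat \<Rightarrow> nat \<Rightarrow> (nat \<Rightarrow> nat) \<Rightarrow> bool" where
  "chain opt m s ord \<longleftrightarrow> inj_on ord {n - m..<n} \<and> ord ` {n - m..<n} \<subseteq> {..<n} \<and>
     taken s = {..<n} - ord ` {n - m..<n} \<and> s = state (taken s) \<and>
     opt (state {..<n}) = opt s + (\<Sum>l\<in>{n - m..<n}. step_cost ord ({..<n} - ord ` {l<..<n}) l)"

lemma chain_step:
  assumes ch: "chain opt m s ord" and m: "m < n"
    and sol: "\<exists>j<n. last_taken s j \<Longrightarrow> z < n \<and> last_taken s z \<and>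
      opt s = opt (s - place z) + real (v z) * g_val (u z) (makespan (taken s))"
  shows "chain opt (Suc m) (s - place z) (ord(n - 1 - m := z))" "z < n"
proof -
  define l where "l = n - 1 - m"
  define ord' where "ord' = ord(l := z)"
  define A where "A = {..<n} - ord ` {n - m..<n}"
  have l: "n - m = Suc l" "n - Suc m = l" "l < n" using m by (auto simp: l_def)
  have A: "taken s = A" "s = state A" "A \<subseteq> {..<n}"
    using ch by (auto simp: chain_def A_def)
  have "card A = n - card (ord ` {n - m..<n})"
    unfolding A_def using ch by (subst card_Diff_subset) (auto simp: chain_def)
  also have "card (ord ` {n - m..<n}) = m"
    using ch m by (subst card_image) (auto simp: chain_def)
  finally have "A \<noteq> {}" using m by auto
  then obtain a where "a \<in> A" by blast
  \<comment> \<open>This is where \<open>s\<close> being the code of the nonempty set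
    \<open>A\<close> is used.\<close>
  then have "\<exists>j<n. last_taken s j" using ex_last_taken[OF A(3)] A(2) by metis
  note z = sol[OF this]
  show "z < n" using z by simp
  have zl: "z < n" "last_taken s z" using z by auto
  have zA: "z \<in> A" and td: "taken (s - place z) = A - {z}"
    using taken_diff(2,3)[OF zl] A(1) by auto
  have st: "s - place z = state (A - {z})"
    using state_diff[of A z z] zA A finite_subset[of A "{..<n}"] by auto
  have same: "ord' ` {Suc l..<n} = ord ` {Suc l..<n}"
    by (rule image_cong) (auto simp: ord'_def)
  have ins: "{l..<n} = insert l {Suc l..<n}" using l(3) by auto
  have img: "ord' ` {l..<n} = insert z (ord ` {Suc l..<n})"
    unfolding ins image_insert same by (simp only: ord'_def fun_upd_same)
  have 1: "inj_on ord' {l..<n}"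
  proof -
    have "inj_on ord {Suc l..<n}" using ch l by (simp add: chain_def)
    then have "inj_on ord' {Suc l..<n}" by (auto simp: inj_on_def ord'_def)
    moreover have "ord' l \<notin> ord' ` {Suc l..<n}"
      unfolding same using zA l by (simp add: A_def ord'_def)
    ultimately show ?thesis unfolding ins by (simp add: inj_on_insert)
  qed
  have 2: "A - {z} = {..<n} - ord' ` {l..<n}" unfolding img A_def l(1) by auto
  have 3: "opt (state {..<n}) =
      opt (s - place z) + (\<Sum>i\<in>{l..<n}. step_cost ord' ({..<n} - ord' ` {i<..<n}) i)"
  proof -
    \<comment> \<open>Costs charged earlier look only at positions after \<open>l\<close>, which the
      new entry leaves untouched.\<close>
    have "(\<Sum>i\<in>{Suc l..<n}. step_cost ord' ({..<n} - ord' ` {i<..<n}) i) =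
        (\<Sum>i\<in>{Suc l..<n}. step_cost ord ({..<n} - ord ` {i<..<n}) i)"
    proof (rule sum.cong[OF refl])
      fix i assume i: "i \<in> {Suc l..<n}"
      then have "ord' ` {i<..<n} = ord ` {i<..<n}" by (intro image_cong) (auto simp: ord'_def)
      then show "step_cost ord' ({..<n} - ord' ` {i<..<n}) i = step_cost ord ({..<n} - ord ` {i<..<n}) i"
        using i by (simp add: step_cost_def ord'_def)
    qed
    moreover have "{l<..<n} = {Suc l..<n}" by auto
    then have "step_cost ord' ({..<n} - ord' ` {l<..<n}) l =
        real (v z) * g_val (u z) (makespan A)"
      using same l by (simp add: step_cost_def ord'_def A_def)
    ultimately show ?thesis
      using ch z A(1) unfolding ins by (simp add: chain_def l)
  qed
  show "chain opt (Suc m) (s - place z) (ord(n - 1 - m := z))"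
    unfolding chain_def l(2) l_def[symmetric] ord'_def[symmetric]
    using 1 2 3 td st img zl ch by (auto simp: chain_def l)
qed

definition good_order :: "(nat \<Rightarrow> real) \<Rightarrow> (nat \<Rightarrow> nat) \<Rightarrow> bool" where
  "good_order opt ord \<longleftrightarrow> bij_betw ord {..<n} {..<n} \<and>
     opt (state {..<n}) = (\<Sum>l<n. step_cost ord (ord ` {..l}) l)"

lemma chain_complete:
  assumes "chain opt n s ord" "opt 0 = 0"
  shows "good_order opt ord"
proof -
  have inj: "inj_on ord {..<n}" and sub: "ord ` {..<n} \<subseteq> {..<n}"
    using assms(1) by (auto simp: chain_def atLeast0LessThan)
  have img: "ord ` {..<n} = {..<n}"
    using inj sub by (intro card_subset_eq) (auto simp: card_image)
  have "taken s = {}" "s = state (taken s)"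
    using assms(1) img by (auto simp: chain_def atLeast0LessThan)
  then have "s = 0" by (simp add: state_def)
  \<comment> \<open>Once all positions are fixed, injectivity turns the complement of the later
    positions into the prefix.\<close>
  have "{..<n} - ord ` {l<..<n} = ord ` {..l}" if "l < n" for l
  proof -
    have "{..<n} = ord ` ({..l} \<union> {l<..<n})" using img that by (simp add: ivl_disj_un)
    moreover have "ord ` {..l} \<inter> ord ` {l<..<n} = {}"
      using inj that by (subst inj_on_image_Int[symmetric]) auto
    ultimately show ?thesis by (auto simp: image_Un)
  qed
  then have "opt (state {..<n}) = (\<Sum>l<n. step_cost ord (ord ` {..l}) l)"
    using assms \<open>s = 0\<close> by (simp add: chain_def atLeast0LessThan)
  then show ?thesis using inj img by (simp add: good_order_def bij_betw_def)
qed

lemma spec_backtrack: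
  assumes c: "classified \<sigma>"
    and sol: "\<And>s. s < Suc n ^ classes \<Longrightarrow> solved (\<sigma> aNum) (\<sigma> aDen) (\<sigma> aChoice) s"
  shows "spec backtrack \<sigma> (\<lambda>\<tau>. good_order (\<lambda>s. real (\<sigma> aNum s) / real (\<sigma> aDen s)) (\<tau> aOrd))"
proof -
  define opt where "opt s = real (\<sigma> aNum s) / real (\<sigma> aDen s)" for s
  define Inv where "Inv m \<tau> \<longleftrightarrow> chain opt m (\<tau> xState 0) (\<tau> aOrd)" for m and \<tau> :: arrays
  let ?c = "Put aOrd (Size -: Lit 1 -: var iJ) (Arr aChoice (var xState)) ;;
     assign xState (var xState -: Arr aPlace (Arr aChoice (var xState)))"
  have opt0: "opt 0 = 0"
    using sol[of 0] not_last_taken_0 by (simp add: opt_def solved_def)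
  have order: "spec order_loop \<sigma>' (\<lambda>\<tau>. good_order opt (\<tau> aOrd))"
    if c': "classified \<sigma>'" and s': "\<sigma>' xState 0 = state {..<n}" and ch: "\<sigma>' aChoice = \<sigma> aChoice" for \<sigma>'
  proof -
    have "spec order_loop \<sigma>' (Inv n)"
      unfolding order_loop_def
    proof (rule spec_For)
      show "Inv 0 \<sigma>'" using s' by (simp add: Inv_def chain_def taken_full)
      fix m and \<tau> :: arrays
      assume m: "m < n" and Inv: "Inv m \<tau>" and \<tau>m: "\<tau> iJ 0 = m" and
        frame: "\<And>x. x \<notin> insert iJ (writes ?c) \<Longrightarrow> \<tau> x = \<sigma>' x"
      have c'': "classified \<tau>" by (rule classified_frame[OF c']; rule frame; simp)
      have ch': "\<tau> aChoice = \<sigma> aChoice" using ch frame[of aChoice] by simp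
      define s z where "s = \<tau> xState 0" and "z = \<sigma> aChoice s"
      have chn: "chain opt m s (\<tau> aOrd)" using Inv by (simp add: Inv_def s_def)
      have "s = state (taken s)" using chn unfolding chain_def by blast
      then have s: "s < Suc n ^ classes" using state_less[OF taken_subset, of s] by simp
      have "z < n \<and> last_taken s z \<and>
          opt s = opt (s - place z) + real (v z) * g_val (u z) (makespan (taken s))"
        if "\<exists>j<n. last_taken s j"
        using sol[OF s] that by (simp add: solved_def best_def candidate_def z_def opt_def)
      note step = chain_step[OF chn m this]
      have "\<tau> aPlace z = place z" using c'' step(2) by (simp add: classified_def)
      then show "spec ?c \<tau> (Inv (Suc m))"
        using step \<tau>m ch' s states_le X_small n_small
        by (simp add: spec_simps Inv_def s_def[symmetric] z_def[symmetric])
    qed (use n_le_X in \<open>auto simp: Inv_def\<close>)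
    then show ?thesis
      by (rule spec_mono) (use chain_complete opt0 in \<open>auto simp: Inv_def\<close>)
  qed
  define \<sigma>1 where "\<sigma>1 = upd \<sigma> xState 0 0"
  have c1: "classified \<sigma>1" using c by (simp add: classified_def \<sigma>1_def)
  have "spec full_loop \<sigma>1 (\<lambda>\<tau>. spec order_loop \<tau> (\<lambda>\<tau>. good_order opt (\<tau> aOrd)))"
  proof (rule spec_mono[OF spec_full_loop[OF c1]])
    show "\<sigma>1 xState 0 = 0" by (simp add: \<sigma>1_def)
    fix \<tau> :: arrays
    assume fr: "\<And>a. a \<notin> writes full_loop \<Longrightarrow> \<tau> a = \<sigma>1 a" and st: "\<tau> xState 0 = state {..<n}"
    have "classified \<tau>" by (rule classified_frame[OF c1]; rule fr; simp)
    moreover have "\<tau> aChoice = \<sigma> aChoice" by (simp add: fr \<sigma>1_def)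
    ultimately show "spec order_loop \<tau> (\<lambda>\<tau>. good_order opt (\<tau> aOrd))"
      using order st by blast
  qed
  then show ?thesis by (simp add: backtrack_def spec_simps \<sigma>1_def opt_def[abs_def])
qed


subsection \<open>Simulation of the priority rule\<close>

text \<open>The value that the program computes for itself; \<open>h\<close> is merely an upper
  bound for admissible oracle times.\<close>

definition hor :: nat where
  "hor = Max (insert 0 (r ` {..<n})) + (\<Sum>i<n. p i)"

lemma hor_ge: "j < n \<Longrightarrow> r j + (\<Sum>i<n. p i) \<le> hor"
  by (simp add: hor_def)

lemma hor_le: "hor \<le> h"
proof (cases "n = 0")
  case True
  then show ?thesis unfolding hor_def by simp
next
  case False
  have "Max (insert 0 (r ` {..<n})) \<in> insert 0 (r ` {..<n})" by (intro Max_in) auto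
  then consider "Max (insert 0 (r ` {..<n})) = 0" | j where "j < n" "Max (insert 0 (r ` {..<n})) = r j"
    by auto
  then show ?thesis
  proof cases
    case 1
    have "(\<Sum>i<n. p i) \<le> h" using h_le[of 0] False by linarith
    with 1 show ?thesis by (simp only: hor_def add_0)
  next
    case 2
    then show ?thesis using h_le[of j] by (simp only: hor_def)
  qed
qed

lemma hor_small: "hor < 2 ^ b"
  using hor_le h_small by simp

lemma r_less_hor: "j < n \<Longrightarrow> r j < hor"
proof -
  assume j: "j < n"
  have "p j \<le> (\<Sum>i<n. p i)" using j by (intro member_le_sum) auto
  then show ?thesis using hor_ge[OF j] p_pos[OF j] by linarith
qed

lemma makespan_le_hor: "A \<subseteq> {..<n} \<Longrightarrow> makespan A \<le> hor"
proof (rule makespan_least)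
  assume A: "A \<subseteq> {..<n}"
  then show "finite A" by (rule finite_subset) simp
  show "r j + demand A (r j) \<le> hor" if "j \<in> A" for j
    using demand_le[OF A, of "r j"] hor_ge[of j] that A by fastforce
qed

lemma spec_horizon_loop:
  assumes l: "loaded \<sigma>" and "\<sigma> xHor 0 = 0"
  shows "spec horizon_loop \<sigma> (\<lambda>\<tau>. \<tau> xHor 0 = Max (insert 0 (r ` {..<n})))"
proof -
  define Inv where "Inv m \<tau> \<longleftrightarrow> \<tau> xHor 0 = Max (insert 0 (r ` {..<m}))" for m and \<tau> :: arrays
  let ?c = "assign xHor (max_e (var xHor) (Arr aR (var iJ)))"
  have "spec horizon_loop \<sigma> (Inv n)"
    unfolding horizon_loop_def
  proof (rule spec_For)
    fix j and \<tau> :: arrays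
    assume j: "j < n" and Inv: "Inv j \<tau>" and \<tau>j: "\<tau> iJ 0 = j" and
      frame: "\<And>x. x \<notin> insert iJ (writes ?c) \<Longrightarrow> \<tau> x = \<sigma> x"
    have l': "loaded \<tau>" by (rule loaded_frame[OF l]; rule frame; simp)
    have "insert 0 (r ` {..<Suc j}) = insert (r j) (insert 0 (r ` {..<j}))"
      by (auto simp: lessThan_Suc)
    then have eq: "Max (insert 0 (r ` {..<Suc j})) = max (Max (insert 0 (r ` {..<j}))) (r j)"
      by (simp only: Max_insert finite_insert finite_imageI finite_lessThan insert_not_empty not_False_eq_True max.commute)
    have "Max (insert 0 (r ` {..<Suc j})) \<le> Max (insert 0 (r ` {..<n}))"
      using j by (intro Max_mono) auto
    also have "\<dots> \<le> hor" by (simp only: hor_def le_add1)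
    finally have "Max (insert 0 (r ` {..<Suc j})) < 2 ^ b" using hor_small by linarith
    then show "spec ?c \<tau> (Inv (Suc j))"
      using Inv l' \<tau>j unfolding eq Inv_def by (simp add: spec_simps loaded_def eq)
  qed (use assms n_le_X in \<open>auto simp: Inv_def\<close>)
  then show ?thesis by (rule spec_mono) (simp add: Inv_def)
qed

lemma spec_rem_loop:
  assumes l: "loaded \<sigma>" and "\<sigma> xHor 0 = Max (insert 0 (r ` {..<n}))"
  shows "spec rem_loop \<sigma> (\<lambda>\<tau>. \<tau> xHor 0 = hor \<and> (\<forall>j<n. \<tau> aRem j = p j))"
proof -
  define Inv where "Inv m \<tau> \<longleftrightarrow> \<tau> xHor 0 = Max (insert 0 (r ` {..<n})) + (\<Sum>i<m. p i) \<and>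
    (\<forall>j<m. \<tau> aRem j = p j)" for m and \<tau> :: arrays
  let ?c = "assign xHor (var xHor +: Arr aP (var iJ)) ;; Put aRem (var iJ) (Arr aP (var iJ))"
  have "spec rem_loop \<sigma> (Inv n)"
    unfolding rem_loop_def
  proof (rule spec_For)
    fix j and \<tau> :: arrays
    assume j: "j < n" and Inv: "Inv j \<tau>" and \<tau>j: "\<tau> iJ 0 = j" and
      frame: "\<And>x. x \<notin> insert iJ (writes ?c) \<Longrightarrow> \<tau> x = \<sigma> x"
    have l': "loaded \<tau>" by (rule loaded_frame[OF l]; rule frame; simp)
    have "(\<Sum>i<Suc j. p i) \<le> (\<Sum>i<n. p i)" using j by (intro sum_mono2) auto
    then have "Max (insert 0 (r ` {..<n})) + (\<Sum>i<j. p i) + p j < 2 ^ b"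
      using hor_small by (simp add: hor_def)
    then show "spec ?c \<tau> (Inv (Suc j))"
      using Inv l' \<tau>j by (simp add: spec_simps loaded_def Inv_def less_Suc_eq del: Max_insert)
  qed (use assms n_le_X in \<open>auto simp: Inv_def\<close>)
  then show ?thesis by (rule spec_mono) (simp add: Inv_def hor_def)
qed

text \<open>\<open>m\<close> is the number of jobs inspected so far; \<open>hor\<close> is the
  default when none of them is released after \<open>t\<close>.\<close>

definition next_release :: "nat \<Rightarrow> nat \<Rightarrow> nat \<Rightarrow> bool" where
  "next_release m t x \<longleftrightarrow> t \<le> x \<and> x \<le> hor \<and> (x = hor \<or> (\<exists>j<m. t < r j \<and> x = r j)) \<and>
     (\<forall>j<m. t < r j \<longrightarrow> x \<le> r j)"

lemma spec_next_loop:
  assumes l: "loaded \<sigma>" and t: "\<sigma> xStart 0 = t" "t \<le> hor" and "\<sigma> xNext 0 = hor"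
  shows "spec next_loop \<sigma> (\<lambda>\<tau>. next_release n t (\<tau> xNext 0))"
proof -
  define Inv where "Inv m \<tau> \<longleftrightarrow> next_release m t (\<tau> xNext 0)" for m and \<tau> :: arrays
  let ?c = "If1 (lt_e (var xStart) (Arr aR (var iJ)))
       (assign xNext (min_e (var xNext) (Arr aR (var iJ))))"
  have "spec next_loop \<sigma> (Inv n)"
    unfolding next_loop_def
  proof (rule spec_For)
    fix j and \<tau> :: arrays
    assume j: "j < n" and Inv: "Inv j \<tau>" and \<tau>j: "\<tau> iJ 0 = j" and
      frame: "\<And>x. x \<notin> insert iJ (writes ?c) \<Longrightarrow> \<tau> x = \<sigma> x"
    have l': "loaded \<tau>" by (rule loaded_frame[OF l]; rule frame; simp)
    have t': "\<tau> xStart 0 = t" using frame[of xStart] t by simp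
    let ?x = "\<tau> xNext 0"
    have "next_release (Suc j) t (min ?x (r j))" if "t < r j"
      using Inv that unfolding Inv_def next_release_def
      by (auto simp: less_Suc_eq min_def)
    moreover have "next_release (Suc j) t ?x" if "\<not> t < r j"
      using Inv that unfolding Inv_def next_release_def by (auto simp: less_Suc_eq)
    moreover have "?x < 2 ^ b" using Inv hor_small by (simp add: Inv_def next_release_def)
    ultimately show "spec ?c \<tau> (Inv (Suc j))"
      using \<tau>j t' l' by (auto simp: spec_simps Inv_def loaded_def)
  qed (use assms n_le_X in \<open>auto simp: Inv_def next_release_def\<close>)
  then show ?thesis by (rule spec_mono) (simp add: Inv_def)
qed

end

locale ordered_instance = instance_data q n k h b X p r u v L + priorities n p r u v ord
  for q n k h b X p r u v L ord
begin

text \<open>During a phase from release date \<open>t\<^sub>0\<close> to the next one \<open>x\<close>, the first \<open>i\<close> jobs in the order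
  have had their turn.\<close>

definition phase :: "nat \<Rightarrow> nat \<Rightarrow> nat \<Rightarrow> nat \<Rightarrow> arrays \<Rightarrow> bool" where
  "phase m t0 x i \<tau> \<longleftrightarrow> t0 \<le> \<tau> xTime 0 \<and> \<tau> xTime 0 \<le> x \<and>
     on_time x (\<tau> xTime 0) (\<tau> aRem) (pieces \<tau> (\<tau> xCount 0)) \<and>
     (\<tau> xTime 0 < x \<longrightarrow> (\<forall>l<i. \<tau> aRem (ord l) = 0 \<or> x \<le> r (ord l))) \<and>
     \<tau> xCount 0 \<le> m * n + i"

lemma spec_piece:
  assumes l: "loaded \<sigma>" and o: "\<sigma> aOrd = ord" and t0: "\<sigma> xStart 0 = t0" and x: "\<sigma> xNext 0 = x"
    and i: "\<sigma> iJ 0 = i" "i < n" and m: "m \<le> n" and nx: "next_release n t0 x"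
    and inv: "phase m t0 x i \<sigma>"
  shows "spec piece \<sigma> (phase m t0 x (Suc i))"
proof -
  define j t rem c where "j = ord i" and "t = \<sigma> xTime 0" and "rem = \<sigma> aRem" and "c = \<sigma> xCount 0"
  \<comment> \<open>Testing \<open>r j \<le> t0\<close> is the same as testing for release by the
    current time, as no release date lies strictly between \<open>t0\<close> and
    \<open>x\<close>.\<close>
  define d where "d = of_bool (r j \<le> t0) * min (rem j) (x - t)"
  have j: "j < n" using ord_less i by (simp add: j_def)
  have t: "t0 \<le> t" "t \<le> x" "on_time x t rem (pieces \<sigma> c)"
    and prior: "t < x \<Longrightarrow> l < i \<Longrightarrow> rem (ord l) = 0 \<or> x \<le> r (ord l)" and c: "c \<le> m * n + i" for l
    using inv by (auto simp: phase_def t_def rem_def c_def)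
  have xh: "x \<le> hor" using nx by (simp add: next_release_def)
  have d_small: "d \<le> x - t" by (auto simp: d_def)
  then have td: "t + d \<le> x" using t(2) by simp
  have small: "j < 2 ^ b" "d < 2 ^ b" "t < 2 ^ b" "t + d < 2 ^ b"
    using j n_small td xh hor_small by auto
  have rj: "\<sigma> aR j = r j" using l by (simp add: loaded_def)
  show ?thesis
  proof (cases "d = 0")
    case True
    let ?\<tau> = "upd (upd \<sigma> xJob 0 j) xLen 0 0"
    \<comment> \<open>A piece of length 0 with time left means that the job is finished or not
      released by \<open>t0\<close>; in the latter case the choice of \<open>x\<close> makes its
      release date at least \<open>x\<close>.\<close>
    have "rem j = 0 \<or> x \<le> r j" if "t < x"
      using True that nx j by (auto simp: d_def next_release_def min_def split: if_splits)
    then have "t < x \<longrightarrow> (\<forall>l<Suc i. rem (ord l) = 0 \<or> x \<le> r (ord l))"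
      using prior by (auto simp: less_Suc_eq j_def)
    moreover have "pieces ?\<tau> c = pieces \<sigma> c" by (rule pieces_cong) simp
    ultimately have "phase m t0 x (Suc i) ?\<tau>"
      using t c by (simp add: phase_def t_def rem_def c_def)
    moreover have "\<not> (r j \<le> t0 \<and> 0 < rem j \<and> t < x)" using True by (auto simp: d_def)
    ultimately show ?thesis
      using small True o rj i t0 x
      by (auto simp: piece_def spec_simps j_def[symmetric] t_def[symmetric] rem_def[symmetric]
          d_def[symmetric])
  next
    case False
    then have d: "0 < d" "d \<le> rem j" "r j \<le> t0" "d = min (rem j) (x - t)" "t < x"
      by (auto simp: d_def split: if_splits)
    define \<tau> where "\<tau> = upd (upd (upd (upd (upd (upd (upd (upd \<sigma> xJob 0 j) xLen 0 d)
      0 (3 * c + 1) j) 0 (3 * c + 2) t) 0 (3 * c + 3) (t + d)) xCount 0 (c + 1))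
      aRem j (rem j - d)) xTime 0 (t + d)"
    have "\<tau> 0 = (\<sigma> 0)(3 * c + 1 := j, 3 * c + 2 := t, 3 * c + 3 := t + d)" by (simp add: \<tau>_def)
    from pieces_Suc[of \<tau> \<sigma> c, OF this]
    have pc: "pieces \<tau> (Suc c) = pieces \<sigma> c @ [(j, t, t + d)]" .
    have ot: "on_time x (t + d) (rem(j := rem j - d)) (pieces \<sigma> c @ [(j, t, t + d)])"
      unfolding j_def
      by (rule on_time_piece[OF t(3) i(2)]) (use d t td prior in \<open>auto simp: j_def\<close>)
    \<comment> \<open>If time is left after the piece, the minimum in \<open>d\<close> was the
      remaining work, so \<open>j\<close> is now finished.\<close>
    have pr: "(rem(j := rem j - d)) (ord l) = 0 \<or> x \<le> r (ord l)" if "t + d < x" "l < Suc i" for l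
    proof (cases "ord l = j")
      case True
      then show ?thesis using d that by (auto simp: min_def split: if_splits)
    next
      case False
      then have "l < i" using that by (auto simp: less_Suc_eq j_def)
      then show ?thesis using prior that False by simp
    qed
    have ph: "phase m t0 x (Suc i) \<tau>"
      using t td c ot pr pc by (simp add: phase_def \<tau>_def rem_def)
    have cn: "c + 1 \<le> n * n + n"
    proof -
      have "m * n \<le> n * n" using m by simp
      then show ?thesis using c i by linarith
    qed
    have c_small: "c + 1 < 2 ^ b"
    proof -
      have "c + 1 \<le> n * (n + 1)" using cn by (simp add: algebra_simps)
      also have "\<dots> \<le> X * X" using n_le by (intro mult_le_mono) auto
      also have "\<dots> \<le> X * X * 2 ^ (L * X)" by simp
      finally show ?thesis using b_bound by linarith
    qed
    \<comment> \<open>At most \<open>n\<close> pieces in each of \<open>n + 1\<close> phases, three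
      cells each: this is what the quadratic size of \<open>base n\<close> provides for.\<close>
    have cells: "cell 0 (3 * c + 1)" "cell 0 (3 * c + 2)" "cell 0 (3 * c + 3)"
      using cn by (simp_all add: cell_def base_def algebra_simps)
    have "rem j - d < 2 ^ b"
    proof -
      have "rem j \<le> p j" using t(3) j unfolding on_time_def by (metis le_add1)
      also have "p j \<le> (\<Sum>i<n. p i)" using j by (intro member_le_sum) auto
      finally show ?thesis using hor_ge[OF j] hor_small by linarith
    qed
    with ph show ?thesis
      using small False o rj i t0 x cells c_small d(3) d(4)[symmetric]
      by (simp add: piece_def spec_simps j_def[symmetric] t_def[symmetric] rem_def[symmetric]
          c_def[symmetric] \<tau>_def)
  qed
qed

lemma phase_frame:
  assumes "phase m t0 x i \<sigma>" "\<tau> xTime = \<sigma> xTime" "\<tau> aRem = \<sigma> aRem" "\<tau> xCount = \<sigma> xCount" "\<tau> 0 = \<sigma> 0"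
  shows "phase m t0 x i \<tau>"
  using assms pieces_cong[of \<tau> \<sigma>] by (simp add: phase_def)

lemma spec_piece_loop:
  assumes l: "loaded \<sigma>" and o: "\<sigma> aOrd = ord" and t0: "\<sigma> xStart 0 = t0" and x: "\<sigma> xNext 0 = x"
    and m: "m \<le> n" and nx: "next_release n t0 x" and inv: "phase m t0 x 0 \<sigma>"
  shows "spec piece_loop \<sigma> (phase m t0 x n)"
  unfolding piece_loop_def
proof (rule spec_For[where Inv = "phase m t0 x" and m = n])
  show "phase m t0 x j (\<tau>(iJ := f))" if "phase m t0 x j \<tau>" for j \<tau> f
    by (rule phase_frame[OF that]) simp_all
  fix i and \<tau> :: arrays
  assume i: "i < n" "phase m t0 x i \<tau>" "\<tau> iJ 0 = i" and
    frame: "\<And>x. x \<notin> insert iJ (writes piece) \<Longrightarrow> \<tau> x = \<sigma> x"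
  have "loaded \<tau>" by (rule loaded_frame[OF l]; rule frame; simp)
  moreover have "\<tau> aOrd = \<sigma> aOrd" "\<tau> xStart = \<sigma> xStart" "\<tau> xNext = \<sigma> xNext" by (rule frame; simp)+
  ultimately show "spec piece \<tau> (phase m t0 x (Suc i))"
    by (intro spec_piece) (use i o t0 x m nx in auto)
qed (use inv n_le_X in auto)

definition finished :: "arrays \<Rightarrow> bool" where
  "finished \<tau> \<longleftrightarrow> \<tau> xCount 0 \<le> (n + 1) * n \<and> (\<exists>rem. on_time hor hor rem (pieces \<tau> (\<tau> xCount 0)) \<and> (\<forall>j<n. rem j = 0))"

text \<open>The last conjunct is the progress measure: a phase that does not end at
  \<open>hor\<close> ends at a release date and so reduces the number of those still ahead.\<close>

definition phases_done :: "nat \<Rightarrow> arrays \<Rightarrow> bool" where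
  "phases_done m \<tau> \<longleftrightarrow> \<tau> xStart 0 \<le> hor \<and> \<tau> xCount 0 \<le> m * n \<and>
     on_time (\<tau> xStart 0) (\<tau> xStart 0) (\<tau> aRem) (pieces \<tau> (\<tau> xCount 0)) \<and>
     (\<tau> xStart 0 = hor \<or> card {j. j < n \<and> \<tau> xStart 0 < r j} + m \<le> n)"

lemma spec_schedule_jobs:
  assumes l: "loaded \<sigma>" and o: "\<sigma> aOrd = ord"
  shows "spec schedule_jobs \<sigma> finished"
proof -
  let ?d = "assign xStart (var xNext)"
  let ?c = "assign xNext (var xHor) ;; next_loop ;; assign xTime (var xStart) ;; piece_loop ;; ?d"
  have main: "spec (For iS (Size +: Lit 1) ?c) \<rho> finished"
    if l: "loaded \<rho>" and o: "\<rho> aOrd = ord" and hr: "\<rho> xHor 0 = hor"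
      and rm: "\<And>j. j < n \<Longrightarrow> \<rho> aRem j = p j" and z: "\<rho> xStart 0 = 0" "\<rho> xCount 0 = 0" for \<rho>
  proof -
    have "spec (For iS (Size +: Lit 1) ?c) \<rho> (phases_done (n + 1))"
    proof (rule spec_For)
      have "pieces \<rho> 0 = []" by (simp add: pieces_def)
      then show "phases_done 0 \<rho>"
        using on_time_start[of "\<rho> aRem" 0] rm z card_mono[of "{..<n}" "{j. j < n \<and> 0 < r j}"]
        by (auto simp: phases_done_def)
      show "phases_done m (\<tau>(iS := f))" if "phases_done m \<tau>" for m \<tau> f
        using that pieces_cong[of "\<tau>(iS := f)" \<tau>] by (simp add: phases_done_def)
      fix m and \<tau> :: arrays
      assume m: "m < n + 1" and inv: "phases_done m \<tau>" and "\<tau> iS 0 = m" and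
        frame: "\<And>x. x \<notin> insert iS (writes ?c) \<Longrightarrow> \<tau> x = \<rho> x"
      define t0 where "t0 = \<tau> xStart 0"
      have t0: "t0 \<le> hor" "\<tau> xCount 0 \<le> m * n" "on_time t0 t0 (\<tau> aRem) (pieces \<tau> (\<tau> xCount 0))"
        "t0 = hor \<or> card {j. j < n \<and> t0 < r j} + m \<le> n"
        using inv by (simp_all add: phases_done_def t0_def)
      have l1: "loaded \<tau>" by (rule loaded_frame[OF l]; rule frame; simp)
      have f1: "\<tau> xHor = \<rho> xHor" "\<tau> aOrd = \<rho> aOrd" by (rule frame; simp)+
      define \<tau>1 where "\<tau>1 = upd \<tau> xNext 0 hor"
      have l1': "loaded \<tau>1" using l1 by (simp add: loaded_def \<tau>1_def)
      have "spec next_loop \<tau>1 (\<lambda>\<tau>'. spec (assign xTime (var xStart) ;; piece_loop ;; ?d) \<tau>' (phases_done (Suc m)))"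
      proof (rule spec_mono[OF spec_next_loop[OF l1' _ t0(1)]])
        show "\<tau>1 xStart 0 = t0" "\<tau>1 xNext 0 = hor" by (simp_all add: \<tau>1_def t0_def)
        fix \<tau>2 :: arrays
        assume fr2: "\<And>a. a \<notin> writes next_loop \<Longrightarrow> \<tau>2 a = \<tau>1 a"
          and nx: "next_release n t0 (\<tau>2 xNext 0)"
        define x where "x = \<tau>2 xNext 0"
        have l2: "loaded \<tau>2" by (rule loaded_frame[OF l1']; rule fr2; simp)
        have f2: "\<tau>2 xStart = \<tau> xStart" "\<tau>2 aOrd = \<rho> aOrd" "\<tau>2 aRem = \<tau> aRem"
          "\<tau>2 xCount = \<tau> xCount" "\<tau>2 0 = \<tau> 0"
          by (simp_all add: fr2 \<tau>1_def f1)
        have x: "t0 \<le> x" "x \<le> hor" using nx by (simp_all add: next_release_def x_def)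
        define \<tau>3 where "\<tau>3 = upd \<tau>2 xTime 0 t0"
        have l3: "loaded \<tau>3" using l2 by (simp add: loaded_def \<tau>3_def)
        \<comment> \<open>Here the clock stands still; only the next release date is advanced from
          \<open>t0\<close> to \<open>x\<close>.\<close>
        have "on_time x t0 (\<tau> aRem) (pieces \<tau> (\<tau> xCount 0))"
          by (rule on_time_idle[OF t0(3)]) (use x in auto)
        moreover have "pieces \<tau>3 c = pieces \<tau> c" for c by (rule pieces_cong) (simp add: \<tau>3_def f2)
        ultimately have ph: "phase m t0 x 0 \<tau>3"
          using x f2 t0(2) by (simp add: phase_def \<tau>3_def)
        have "spec piece_loop \<tau>3 (\<lambda>\<tau>'. spec ?d \<tau>' (phases_done (Suc m)))"
        proof (rule spec_mono[OF spec_piece_loop[OF l3 _ _ _ _ _ ph]])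
          show "\<tau>3 aOrd = ord" "\<tau>3 xStart 0 = t0" "\<tau>3 xNext 0 = x" "m \<le> n" "next_release n t0 x"
            using f2 o m nx by (simp_all add: \<tau>3_def t0_def x_def)
          fix \<tau>4 :: arrays
          assume fr4: "\<And>a. a \<notin> writes piece_loop \<Longrightarrow> \<tau>4 a = \<tau>3 a" and ph4: "phase m t0 x n \<tau>4"
          have x4: "\<tau>4 xNext 0 = x" by (simp add: fr4 \<tau>3_def x_def)
          \<comment> \<open>By the end of the pass either the clock has reached \<open>x\<close> or
            no released work is left, so idling until \<open>x\<close> is safe.\<close>
          have "on_time x x (\<tau>4 aRem) (pieces \<tau>4 (\<tau>4 xCount 0))"
            by (rule on_time_idle[where t = "\<tau>4 xTime 0" and x = x])
              (use ph4 in \<open>auto simp: phase_def\<close>)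
          moreover have "pieces (upd \<tau>4 xStart 0 x) c = pieces \<tau>4 c" for c
            by (rule pieces_cong) simp
          moreover have "x = hor \<or> card {j. j < n \<and> x < r j} + Suc m \<le> n"
          proof (cases "x = hor")
            case False
            then obtain j where j: "j < n" "t0 < r j" "x = r j"
              using nx by (auto simp: next_release_def x_def)
            then have "t0 \<noteq> hor" using r_less_hor[of j] by auto
            moreover have "{j. j < n \<and> x < r j} \<subset> {j. j < n \<and> t0 < r j}"
              using j x by auto
            then have "card {j. j < n \<and> x < r j} < card {j. j < n \<and> t0 < r j}"
              by (intro psubset_card_mono) auto
            ultimately show ?thesis using t0(4) by linarith
          qed simp
          ultimately have "phases_done (Suc m) (upd \<tau>4 xStart 0 x)"
            using ph4 x by (simp add: phases_done_def phase_def)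
          then show "spec ?d \<tau>4 (phases_done (Suc m))"
            using x4 x hor_small by (simp add: spec_simps)
        qed
        then show "spec (assign xTime (var xStart) ;; piece_loop ;; ?d) \<tau>2 (phases_done (Suc m))"
          using f2 t0(1) hor_small by (simp add: spec_simps \<tau>3_def t0_def)
      qed
      then show "spec ?c \<tau> (phases_done (Suc m))"
        using f1 hr hor_small by (simp add: spec_simps \<tau>1_def)
    qed (use n_le in auto)
    then show ?thesis
    proof (rule spec_mono)
      fix \<tau> assume d: "phases_done (n + 1) \<tau>"
      \<comment> \<open>After \<open>n + 1\<close> phases the counting alternative would need
        \<open>n + 1 \<le> n\<close>.\<close>
      then have "\<tau> xStart 0 = hor" by (simp add: phases_done_def)
      with d have ot: "on_time hor hor (\<tau> aRem) (pieces \<tau> (\<tau> xCount 0))"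
        by (simp add: phases_done_def)
      then show "finished \<tau>"
        using on_time_finished[OF ot makespan_le_hor] d unfolding finished_def phases_done_def by blast
    qed
  qed
  define \<sigma>1 where "\<sigma>1 = upd \<sigma> xHor 0 0"
  have l1: "loaded \<sigma>1" using l by (simp add: loaded_def \<sigma>1_def)
  let ?e = "assign xStart (Lit 0) ;; assign xCount (Lit 0) ;; For iS (Size +: Lit 1) ?c"
  have "spec horizon_loop \<sigma>1 (\<lambda>\<tau>. spec (rem_loop ;; ?e) \<tau> finished)"
  proof (rule spec_mono[OF spec_horizon_loop[OF l1]])
    show "\<sigma>1 xHor 0 = 0" by (simp add: \<sigma>1_def)
    fix \<tau> :: arrays
    assume fr: "\<And>a. a \<notin> writes horizon_loop \<Longrightarrow> \<tau> a = \<sigma>1 a"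
      and mx: "\<tau> xHor 0 = Max (insert 0 (r ` {..<n}))"
    have l2: "loaded \<tau>" by (rule loaded_frame[OF l1]; rule fr; simp)
    have o2: "\<tau> aOrd = ord" by (simp add: fr \<sigma>1_def o)
    have "spec rem_loop \<tau> (\<lambda>\<tau>'. spec ?e \<tau>' finished)"
    proof (rule spec_mono[OF spec_rem_loop[OF l2 mx]])
      fix \<tau>' :: arrays
      assume fr': "\<And>a. a \<notin> writes rem_loop \<Longrightarrow> \<tau>' a = \<tau> a"
        and rm: "\<tau>' xHor 0 = hor \<and> (\<forall>j<n. \<tau>' aRem j = p j)"
      define \<rho> where "\<rho> = upd (upd \<tau>' xStart 0 0) xCount 0 0"
      have "loaded \<tau>'" by (rule loaded_frame[OF l2]; rule fr'; simp)
      then have "loaded \<rho>" by (simp add: loaded_def \<rho>_def)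
      then have "spec (For iS (Size +: Lit 1) ?c) \<rho> finished"
        by (rule main) (use rm o2 fr' in \<open>auto simp: \<rho>_def\<close>)
      then show "spec ?e \<tau>' finished" by (simp add: spec_simps \<rho>_def)
    qed
    then show "spec (rem_loop ;; ?e) \<tau> finished" by (rule spec_Comp)
  qed
  then show ?thesis by (simp add: schedule_jobs_def spec_simps \<sigma>1_def)
qed

end


section \<open>Approximation guarantee\<close>

primrec grid :: "nat \<Rightarrow> nat \<Rightarrow> nat" where
  "grid N 0 = 0"
| "grid N (Suc i) = grid N i + 1 + grid N i div N"

lemma grid_ge: "i \<le> grid N i"
  by (induction i) auto

text \<open>Either all steps so far have moved, or the next grid point exceeds \<open>w\<close> and
  the iteration is stuck for good.\<close>

lemma grid_iter:
  "\<exists>j. (grid_step N w ^^ i) 0 = grid N j \<and>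
    (j = i \<or> w < grid N j + 1 + grid N j div N)"
proof (induction i)
  case 0
  show ?case by (intro exI[of _ 0]) simp
next
  case (Suc i)
  then obtain j where j: "(grid_step N w ^^ i) 0 = grid N j"
    "j = i \<or> w < grid N j + 1 + grid N j div N" by blast
  have step: "(grid_step N w ^^ Suc i) 0 = grid_step N w (grid N j)" using j(1) by simp
  show ?case unfolding step
  proof (cases "grid N j + 1 + grid N j div N \<le> w")
    case True
    then show "\<exists>j'. grid_step N w (grid N j) = grid N j' \<and> (j' = Suc i \<or> w < grid N j' + 1 + grid N j' div N)"
      using j(2) by (intro exI[of _ "Suc j"]) (auto simp: grid_step_def)
  next
    case False
    then show "\<exists>j'. grid_step N w (grid N j) = grid N j' \<and> (j' = Suc i \<or> w < grid N j' + 1 + grid N j' div N)"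
      by (intro exI[of _ j]) (auto simp: grid_step_def)
  qed
qed

lemma rounded_le: "rounded N w \<le> w"
  by (simp add: rounded_def grid_iter_le)

lemma rounded_grid:
  obtains j where "rounded N w = grid N j" "w \<le> grid N j + grid N j div N"
proof -
  obtain j where j: "rounded N w = grid N j" "j = w \<or> w < grid N j + 1 + grid N j div N"
    using grid_iter[where N = N and w = w and i = w] unfolding rounded_def by blast
  \<comment> \<open>If all \<open>w\<close> steps moved, the point reached is already at least
    \<open>w\<close>.\<close>
  have "w \<le> grid N j + grid N j div N" using j(2) grid_ge[of w N] by auto
  with j(1) show ?thesis by (rule that)
qed

text \<open>By integrality, a weight below the next grid point \<open>x + 1 + x div N\<close> is at
  most \<open>x + x div N\<close>, so the unit in the grid step costs nothing.\<close>

lemma rounded_approx: "0 < N \<Longrightarrow> real w \<le> (1 + 1 / real N) * real (rounded N w)"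
proof -
  assume N: "0 < N"
  obtain j where j: "rounded N w = grid N j" "w \<le> grid N j + grid N j div N"
    by (rule rounded_grid)
  have "real (grid N j div N) \<le> real (grid N j) / real N" by (rule of_nat_div_le_of_nat)
  then have "real w \<le> real (grid N j) + real (grid N j) / real N" using j(2) by linarith
  then show ?thesis by (simp add: j(1) algebra_simps)
qed

lemma grid_mono: "i \<le> j \<Longrightarrow> grid N i \<le> grid N j"
  by (rule lift_Suc_mono_le[of "grid N"]) auto

lemma grid_add: "grid N i + s * (1 + grid N i div N) \<le> grid N (i + s)"
proof (induction s)
  case (Suc s)
  have "grid N i div N \<le> grid N (i + s) div N" by (intro div_le_mono grid_mono) simp
  then show ?case using Suc by simp
qed simp

text \<open>\<open>N\<close> steps of length at least \<open>1 + x div N\<close> add more than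
  \<open>x\<close>, so \<open>N\<close> steps double the value. Hence the number of grid points
  below \<open>2 ^ t\<close> is linear in \<open>t\<close>.\<close>

lemma grid_exp: "0 < N \<Longrightarrow> 2 ^ t \<le> grid N (1 + N * t)"
proof (induction t)
  case (Suc t)
  let ?x = "grid N (1 + N * t)"
  have "?x < N * (1 + ?x div N)"
    using Suc.prems by (metis dividend_less_times_div mult.commute plus_1_eq_Suc mult_Suc)
  then have "2 * ?x \<le> grid N (1 + N * t + N)" using grid_add[of N "1 + N * t" N] by linarith
  then show ?case using Suc by (simp add: algebra_simps)
qed simp

lemma rounded_mem: "0 < N \<Longrightarrow> w < 2 ^ t \<Longrightarrow> rounded N w \<in> grid N ` {..<1 + N * t}"
proof -
  assume N: "0 < N" and w: "w < 2 ^ t"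
  obtain j where j: "rounded N w = grid N j" by (rule rounded_grid)
  have "j < 1 + N * t"
  proof (rule ccontr)
    assume "\<not> ?thesis"
    then have "2 ^ t \<le> grid N j" using grid_exp[OF N, of t] grid_mono[of "1 + N * t" j N] by simp
    then show False using w rounded_le[of N w] j by simp
  qed
  then show ?thesis using j by blast
qed

section \<open>Time windows in feasible schedules\<close>

lemma interval_work:
  fixes x T :: real
  assumes "sorted_wrt (\<lambda>(_, _, b) (_, a', _). b \<le> a') S" "S \<noteq> []"
    and "\<And>j a b. (j, a, b) \<in> set S \<Longrightarrow> x \<le> a \<and> a < b \<and> b \<le> T"
  shows "x + (\<Sum>(j, a, b)\<leftarrow>S. b - a) \<le> T"
  using assms
proof (induction S arbitrary: x)
  case (Cons s S)
  obtain j a b where s: "s = (j, a, b)" by (cases s)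
  have ab: "x \<le> a" "a < b" "b \<le> T" using Cons.prems(3)[of j a b] s by auto
  show ?case
  proof (cases "S = []")
    case True
    then show ?thesis using ab s by simp
  next
    case False
    \<comment> \<open>Later pieces start no earlier than \<open>b\<close>, so the induction
      hypothesis applies with \<open>b\<close> in the role of \<open>x\<close>.\<close>
    have "b + (\<Sum>(j, a, b)\<leftarrow>S. b - a) \<le> T"
    proof (rule Cons.IH)
      show "sorted_wrt (\<lambda>(_, _, b) (_, a', _). b \<le> a') S" using Cons.prems(1) by simp
      show "b \<le> a' \<and> a' < b' \<and> b' \<le> T" if "(j', a', b') \<in> set S" for j' a' b'
        using Cons.prems(1) Cons.prems(3)[of j' a' b'] that s by fastforce
    qed (use False in simp)
    then show ?thesis using ab s by simp
  qed
qed simp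

lemma sum_list_sum_filter:
  fixes f :: "nat \<Rightarrow> 'a \<Rightarrow> 'b \<Rightarrow> real"
  assumes "finite A"
  shows "(\<Sum>j\<in>A. \<Sum>(i, a, b)\<leftarrow>S. if i = j then f i a b else 0) =
    (\<Sum>(i, a, b)\<leftarrow>filter (\<lambda>(i, _). i \<in> A) S. f i a b)"
proof (induction S)
  case (Cons s S)
  obtain i a b where s: "s = (i, a, b)" by (cases s)
  show ?case using Cons assms by (simp add: s sum.distrib)
qed simp

lemma completion_ge: "(j, a, b) \<in> set S \<Longrightarrow> b \<le> completion S j"
proof -
  have "{b. \<exists>a. (j, a, b) \<in> set S} \<subseteq> (snd \<circ> snd) ` set S" by force
  then have "finite {b. \<exists>a. (j, a, b) \<in> set S}" by (rule finite_subset) simp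
  then show "(j, a, b) \<in> set S \<Longrightarrow> ?thesis" unfolding completion_def by (intro Max_ge) auto
qed

lemma completion_le:
  assumes "(j, a, b) \<in> set S" "\<And>a b. (j, a, b) \<in> set S \<Longrightarrow> b \<le> T"
  shows "completion S j \<le> T"
proof -
  have "{b. \<exists>a. (j, a, b) \<in> set S} \<subseteq> (snd \<circ> snd) ` set S" by force
  then have "finite {b. \<exists>a. (j, a, b) \<in> set S}" by (rule finite_subset) simp
  then show ?thesis unfolding completion_def using assms by (intro Max.boundedI) auto
qed

text \<open>A nonzero amount of work forces a piece. Without one, \<open>completion\<close> would be
  the maximum of an empty set.\<close>

lemma feasible_piece:
  assumes "feasible I S" "j < njobs I" "0 < proc I j"
  obtains a b where "(j, a, b) \<in> set S"
proof -
  have "(\<Sum>(i, a, b)\<leftarrow>S. if i = j then b - a else 0) \<noteq> (0::real)"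
    using assms by (simp add: feasible_def)
  moreover have "(\<Sum>(i, a, b)\<leftarrow>S. if i = j then b - a else 0) = (\<Sum>s\<leftarrow>S. 0::real)"
    if "\<forall>s\<in>set S. (case s of (i, a, b) \<Rightarrow> if i = j then b - a else 0) = (0::real)"
    using that by (intro arg_cong[where f = sum_list] map_cong) auto
  ultimately have "\<exists>s\<in>set S. (case s of (i, a, b) \<Rightarrow> if i = j then b - a else 0) \<noteq> (0::real)"
    by auto
  then show ?thesis using that by (auto split: if_splits)
qed

lemma feasible_completion_nonneg:
  assumes "feasible I S" "j < njobs I" "0 < proc I j"
  shows "0 \<le> completion S j"
proof -
  obtain a b where ab: "(j, a, b) \<in> set S" by (rule feasible_piece[OF assms])
  then have "real (release I j) \<le> a" "a < b" using assms(1) by (auto simp: feasible_def)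
  then show ?thesis using completion_ge[OF ab] by linarith
qed

text \<open>All jobs released at time \<open>x\<close> or later and completed by time \<open>T\<close> are processed in between.\<close>

lemma feasible_window:
  assumes "feasible I S" "A \<subseteq> {..<njobs I}"
    and "\<And>i. i \<in> A \<Longrightarrow> x \<le> release I i \<and> completion S i \<le> T"
    and "0 < (\<Sum>i\<in>A. proc I i)"
  shows "real x + real (\<Sum>i\<in>A. proc I i) \<le> T"
proof -
  let ?S = "filter (\<lambda>(i, _). i \<in> A) S"
  have fin: "finite A" using assms(2) by (rule finite_subset) simp
  have "real (\<Sum>i\<in>A. proc I i) = (\<Sum>j\<in>A. \<Sum>(i, a, b)\<leftarrow>S. if i = j then b - a else 0)"
    using assms(1,2) by (simp add: feasible_def subset_iff)
  also have "\<dots> = (\<Sum>(i, a, b)\<leftarrow>?S. b - a)"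
    by (rule sum_list_sum_filter[OF fin])
  finally have eq: "real (\<Sum>i\<in>A. proc I i) = (\<Sum>(i, a, b)\<leftarrow>?S. b - a)" .
  have ne: "?S \<noteq> []"
  proof
    assume "?S = []"
    then have "real (\<Sum>i\<in>A. proc I i) = 0" unfolding eq by (simp only: list.map sum_list.Nil)
    then show False using assms(4) by linarith
  qed
  have "sorted_wrt (\<lambda>(_, _, b) (_, a', _). b \<le> a') ?S"
    using assms(1) by (intro sorted_wrt_filter) (simp add: feasible_def)
  then show ?thesis unfolding eq
  proof (rule interval_work[OF _ ne])
    fix j a b assume "(j, a, b) \<in> set ?S"
    then have j: "(j, a, b) \<in> set S" "j \<in> A" by auto
    then have "real (release I j) \<le> a" "a < b" using assms(1) by (auto simp: feasible_def)
    then show "real x \<le> a \<and> a < b \<and> b \<le> T"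
      using assms(3)[OF j(2)] completion_ge[OF j(1)] by linarith
  qed
qed

abbreviation real_pieces :: "(nat \<times> nat \<times> nat) list \<Rightarrow> schedule" where
  "real_pieces \<equiv> map (\<lambda>(j, a, b). (j, real a, real b))"

lemma real_work:
  assumes "\<And>j a b. (j, a, b) \<in> set S \<Longrightarrow> a < b"
  shows "(\<Sum>(i, a, b)\<leftarrow>real_pieces S. if i = j then b - a else 0) = real (work j S)"
  using assms
proof (induction S)
  case (Cons s S)
  obtain i a b where s: "s = (i, a, b)" by (cases s)
  have "a < b" using Cons.prems[of i a b] s by simp
  moreover have "(\<Sum>(i, a, b)\<leftarrow>real_pieces S. if i = j then b - a else 0) = real (work j S)"
    by (rule Cons.IH) (use Cons.prems in auto)
  ultimately show ?case by (simp add: s work_def)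
qed (simp add: work_def)

context ordered_instance
begin

text \<open>Sandwich around the table value of the full state: \<open>v \<le> w\<close> and
  \<open>dp_lower_bound\<close> put it below the cost of every feasible schedule, while on-time
  completion puts the cost of the constructed schedule below \<open>1 + \<delta>\<close> times
  it.\<close>

theorem approx_schedule:
  assumes n: "njobs I = n"
    and I: "\<And>j. j < n \<Longrightarrow> proc I j = p j \<and> release I j = r j"
    and cost: "\<And>j t. j < n \<Longrightarrow> 0 \<le> t \<Longrightarrow> cost_fun I j t = real (w j) * g (u j) t"
    and g: "\<And>j. j < n \<Longrightarrow> cost_function (g (u j))"
    and g_val: "\<And>j t. j < n \<Longrightarrow> g (u j) (real t) = g_val (u j) t"
    and vw: "\<And>j. j < n \<Longrightarrow> v j \<le> w j \<and> real (w j) \<le> (1 + \<delta>) * real (v j)" and \<delta>: "0 \<le> \<delta>"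
    and sol: "\<And>s. s < Suc n ^ classes \<Longrightarrow> solved num den ch s"
    and ord_opt: "good_order (\<lambda>s. real (num s) / real (den s)) ord"
    and fin: "on_time hor hor rem S" "\<And>j. j < n \<Longrightarrow> rem j = 0"
  shows "approx_solution (1 + \<delta>) I (real_pieces S)"
proof -
  let ?S = "real_pieces S"
  define opt where "opt s = real (num s) / real (den s)" for s
  have S: "r j \<le> a \<and> a < b \<and> (\<exists>l<n. j = ord l \<and> b \<le> makespan (firsts l))" if "(j, a, b) \<in> set S" for j a b
    using fin(1) that unfolding on_time_def by fast
  have wk: "work j S = p j" if "j < n" for j
    using fin that unfolding on_time_def by (metis add_0)
  have feas: "feasible I ?S"
    unfolding feasible_def
  proof (intro conjI)
    have "j < n \<and> real (release I j) \<le> a \<and> a < b" if "(j, a, b) \<in> set ?S" for j a b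
    proof -
      from that obtain a' b' where ab: "(j, a', b') \<in> set S" "a = real a'" "b = real b'" by auto
      then have "j < n" using S[OF ab(1)] ord_less by auto
      then show ?thesis using S[OF ab(1)] ab I by simp
    qed
    then show "\<forall>(j, a, b)\<in>set ?S. j < njobs I \<and> real (release I j) \<le> a \<and> a < b"
      using n by blast
    have "sorted_wrt (\<lambda>(_, _, b) (_, a', _). b \<le> a') S" using fin(1) by (simp add: on_time_def)
    then show "sorted_wrt (\<lambda>(_, _, b) (_, a', _). b \<le> a') ?S"
      unfolding sorted_wrt_map by (rule sorted_wrt_mono_rel[rotated]) auto
    show "\<forall>j<njobs I. (\<Sum>(i, a, b)\<leftarrow>?S. if i = j then b - a else 0) = real (proc I j)"
      using real_work[of S] S wk I n by simp
  qed
  have pos: "0 < proc I j" if "j < n" for j using p_pos I that by simp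
  have g_mono: "g (u j) s \<le> g (u j) t" if "j < n" "0 \<le> s" "s \<le> t" for j s t
    using g[OF that(1)] that by (auto simp: cost_function_def mono_on_def)
  have g_nonneg: "0 \<le> g (u j) t" if "j < n" "0 \<le> t" for j t
    using g[OF that(1)] that by (auto simp: cost_function_def)
  have upper: "total_cost I ?S \<le> (1 + \<delta>) * opt (state {..<n})"
  proof -
    have "total_cost I ?S \<le> (\<Sum>j<n. (1 + \<delta>) * (real (v j) * g (u j) (completion ?S j)))"
      unfolding total_cost_def n
    proof (rule sum_mono)
      fix j assume j: "j \<in> {..<n}"
      have c: "0 \<le> completion ?S j" using feasible_completion_nonneg[OF feas] pos n j by simp
      have "real (w j) * g (u j) (completion ?S j) \<le> (1 + \<delta>) * real (v j) * g (u j) (completion ?S j)"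
        using vw j g_nonneg[OF _ c] by (intro mult_right_mono) auto
      then show "cost_fun I j (completion ?S j) \<le> (1 + \<delta>) * (real (v j) * g (u j) (completion ?S j))"
        using cost[OF _ c] j by (simp add: mult.assoc)
    qed
    also have "\<dots> = (1 + \<delta>) * (\<Sum>j<n. real (v j) * g (u j) (completion ?S j))"
      by (simp add: sum_distrib_left)
    also have "(\<Sum>j<n. real (v j) * g (u j) (completion ?S j)) =
        (\<Sum>l<n. real (v (ord l)) * g (u (ord l)) (completion ?S (ord l)))"
      by (rule sum.reindex_bij_betw[OF ord, symmetric])
    also have "\<dots> \<le> (\<Sum>l<n. step_cost ord (ord ` {..l}) l)"
    proof (rule sum_mono)
      fix l assume "l \<in> {..<n}"
      then have l: "l < n" by simp
      let ?j = "ord l"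
      have j: "?j < n" using ord_less[OF l] .
      have c0: "0 \<le> completion ?S ?j" using feasible_completion_nonneg[OF feas] pos n j by simp
      obtain a b where ab: "(?j, a, b) \<in> set ?S"
        using feasible_piece[OF feas] pos n j by metis
      have "completion ?S ?j \<le> real (makespan (firsts l))"
      proof (rule completion_le[OF ab])
        fix a b assume "(?j, a, b) \<in> set ?S"
        then obtain a' b' where ab': "(?j, a', b') \<in> set S" "b = real b'" by auto
        then obtain l' where "l' < n" "?j = ord l'" "b' \<le> makespan (firsts l')" using S by blast
        \<comment> \<open>The invariant only provides some position for the job of a piece;
          injectivity of \<open>ord\<close> identifies it.\<close>
        moreover from this have "l = l'" using ord l by (auto simp: bij_betw_def dest: inj_onD)
        ultimately show "b \<le> real (makespan (firsts l))" using ab'(2) by simp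
      qed
      from g_mono[OF j c0 this]
      show "real (v ?j) * g (u ?j) (completion ?S ?j) \<le> step_cost ord (ord ` {..l}) l"
        unfolding step_cost_def g_val[OF j, symmetric] firsts_def
        by (intro mult_left_mono) auto
    qed
    also have "\<dots> = opt (state {..<n})" using ord_opt by (simp add: good_order_def opt_def)
    finally show ?thesis using \<delta> by (simp add: mult_left_mono)
  qed
  have lower: "opt (state {..<n}) \<le> total_cost I S'" if S': "feasible I S'" for S'
  proof -
    let ?C = "completion S'"
    have C: "0 \<le> ?C j" if "j < n" for j
      using feasible_completion_nonneg[OF S'] pos n that by simp
    have "opt (state {..<n}) \<le> (\<Sum>j<n. real (v j) * g (u j) (?C j))"
    \<comment> \<open>\<open>c\<close> is the vector of completion times in the competing schedule,
      and \<open>F\<close> charges the rounded weights at these times.\<close>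
    proof (rule dp_lower_bound[where c = ?C and f = "\<lambda>j t. real (v j) * g_val (u j) t"])
      show "opt 0 \<le> 0"
        using sol[of 0] not_last_taken_0 by (simp add: opt_def solved_def)
      show "opt s \<le> opt (s - place j) + real (v j) * g_val (u j) (makespan (taken s))"
        if "s < Suc n ^ classes" "j < n" "last_taken s j" for s j
        using sol[OF that(1)] that(2,3) by (auto simp: solved_def best_def candidate_def opt_def split: if_splits)
      show "(\<lambda>t. real (v i) * g_val (u i) t) = (\<lambda>t. real (v j) * g_val (u j) t)"
        if "key i = key j" for i j
        using that by (simp add: key_def)
      show "real (v j) * g_val (u j) t \<le> real (v j) * g (u j) (?C j)" if "j < n" "real t \<le> ?C j" for j t
        unfolding g_val[OF that(1), symmetric] using g_mono[OF that(1) _ that(2)] by (intro mult_left_mono) auto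
      show "real x + real (demand {i. i < n \<and> ?C i \<le> ?C j} x) \<le> ?C j"
        if j: "j < n" and d: "0 < demand {i. i < n \<and> ?C i \<le> ?C j} x" for j x
      proof -
        let ?A = "{i \<in> {i. i < n \<and> ?C i \<le> ?C j}. x \<le> r i}"
        have eq: "demand {i. i < n \<and> ?C i \<le> ?C j} x = (\<Sum>i\<in>?A. proc I i)"
          unfolding demand_def using I by (intro sum.cong) auto
        show ?thesis unfolding eq
          by (rule feasible_window[OF S']) (use n I d eq in auto)
      qed
    qed (use p_pos C in auto)
    also have "\<dots> \<le> total_cost I S'"
      unfolding total_cost_def n
    proof (rule sum_mono)
      fix j assume "j \<in> {..<n}"
      then have j: "j < n" by simp
      show "real (v j) * g (u j) (?C j) \<le> cost_fun I j (?C j)"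
        unfolding cost[OF j C[OF j]] using vw[OF j] g_nonneg[OF j C[OF j]]
        by (intro mult_right_mono) auto
    qed
    finally show ?thesis .
  qed
  \<comment> \<open>\<open>feas\<close> is needed for the infimum to range over a nonempty
    set.\<close>
  have "opt (state {..<n}) \<le> opt_cost I"
    unfolding opt_cost_def using feas lower by (intro cInf_greatest) auto
  then have "total_cost I ?S \<le> (1 + \<delta>) * opt_cost I"
    using upper \<delta> by (meson add_nonneg_nonneg mult_left_mono order_trans zero_le_one)
  then show ?thesis using feas by (simp add: approx_solution_def)
qed

end


section \<open>The running time\<close>

text \<open>Each factor \<open>X\<close> is below \<open>2 ^ X\<close>, and
  \<open>X \<le> L * X\<close>. This justifies the word length \<open>4 * L * X\<close>, which is
  linear in \<open>L\<close>.\<close>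

lemma X_less_power: "X * X * 2 ^ (L * X) < 2 ^ (4 * L * X)" if "0 < L" "0 < X" for X L :: nat
proof -
  have "X * X < 2 ^ X * 2 ^ X" by (intro mult_strict_mono) auto
  then have "X * X * 2 ^ (L * X) < 2 ^ X * 2 ^ X * 2 ^ (L * X)" by simp
  also have "\<dots> = 2 ^ (X + X + L * X)" by (simp add: power_add)
  also have "\<dots> \<le> 2 ^ (4 * L * X)"
  proof (rule power_increasing)
    have "1 * X \<le> L * X" using that by (intro mult_le_mono1) simp
    then show "X + X + L * X \<le> 4 * L * X" unfolding mult.assoc by linarith
  qed simp
  finally show ?thesis .
qed

text \<open>A single number \<open>X\<close> bounds all quantities of quasi-polynomial size: loop
  lengths, weights and the number of states. Processing times and release dates are bounded through
  the number length only.\<close>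

locale gsp_input =
  fixes I :: gsp and k :: nat and g :: "nat \<Rightarrow> real \<Rightarrow> real" and w u :: "nat \<Rightarrow> nat"
    and q :: oracle_fun and N X :: nat
  assumes valid: "valid_gsp I" and factors: "factors_through I k g w u"
    and oracle_ok: "value_oracle k g q" and N_pos: "0 < N"
    and X_n: "njobs I + 2 \<le> X" and X_k: "k \<le> X" and X_N: "N \<le> X"
    and X_w: "\<And>j. j < njobs I \<Longrightarrow> w j \<le> X"
    and X_states: "Suc (njobs I) ^
      card ((\<lambda>j. (release I j, u j, rounded N (w j))) ` {..<njobs I}) \<le> X"
begin

abbreviation "n \<equiv> njobs I"
abbreviation "L \<equiv> number_length I k q"
abbreviation "b \<equiv> 4 * L * X"

lemma finite_numbers: "finite (bits ` (proc I ` {..<njobs I} \<union> release I ` {..<njobs I} \<union>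
    (\<Union>i<k. \<Union>t\<le>horizon I. {fst (q i t), snd (q i t)})))"
  by auto

lemma L_pos: "0 < L"
  unfolding number_length_def using finite_numbers by (simp add: Max_gr_iff)

lemma bits_less: "bits x \<le> L \<Longrightarrow> x < 2 ^ L"
  by (simp add: floorlog_le_iff)

lemma number_less:
  "x \<in> proc I ` {..<njobs I} \<union> release I ` {..<njobs I} \<union>
    (\<Union>i<k. \<Union>t\<le>horizon I. {fst (q i t), snd (q i t)}) \<Longrightarrow> x < 2 ^ L"
  unfolding number_length_def using finite_numbers
  by (intro bits_less[unfolded number_length_def] Max_ge) auto

lemma proc_less: "j < n \<Longrightarrow> proc I j < 2 ^ L"
  and release_less: "j < n \<Longrightarrow> release I j < 2 ^ L"
  and q_less: "i < k \<Longrightarrow> t \<le> horizon I \<Longrightarrow> fst (q i t) < 2 ^ L \<and> snd (q i t) < 2 ^ L"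
  by (auto intro!: number_less)

lemma L_le_b: "L \<le> b"
  using X_n by (cases X) auto

lemma X_less_b: "X < 2 ^ b"
proof -
  have "1 * X \<le> 4 * L * X" using L_pos by (intro mult_le_mono1) simp
  then show ?thesis by (intro less_power2_mono[OF less_exp]) simp
qed

lemma horizon_less: "horizon I < 2 ^ b"
proof -
  have "(\<Sum>j<n. proc I j) \<le> (\<Sum>j<n. 2 ^ L)"
    using proc_less by (intro sum_mono less_imp_le) auto
  moreover have "Max (insert 0 (release I ` {..<n})) \<le> 2 ^ L"
    using release_less by (auto intro: less_imp_le)
  ultimately have "horizon I \<le> 2 ^ L + (\<Sum>j<n. 2 ^ L)"
    unfolding horizon_def by (intro add_mono)
  then have "horizon I \<le> 2 ^ L + n * 2 ^ L" by simp
  also have "\<dots> \<le> X * 2 ^ L" using X_n by (cases X) auto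
  also have "\<dots> \<le> X * (X * 2 ^ (L * X))"
  proof (rule mult_le_mono2)
    have "1 * 2 ^ L \<le> X * 2 ^ (L * X)"
      using X_n by (intro mult_le_mono power_increasing) auto
    then show "2 ^ L \<le> X * 2 ^ (L * X)" by simp
  qed
  finally show ?thesis using X_less_power[OF L_pos, of X] X_n by (simp add: mult.assoc)
qed

lemma b_ge: "6 \<le> b"
proof -
  have "4 * 1 * 2 \<le> 4 * L * X" using L_pos X_n by (intro mult_le_mono) auto
  then show ?thesis by simp
qed

sublocale machine q n k "horizon I" b X
proof
  show "6 \<le> b" by (rule b_ge)
  show "X < 2 ^ b" by (rule X_less_b)
  then show "n < 2 ^ b" using X_n by linarith
  show "fst (q i t) < 2 ^ b \<and> snd (q i t) < 2 ^ b" if "i < k" "t \<le> horizon I" for i t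
    using q_less[OF that] L_le_b by (auto intro: less_power2_mono)
qed

definition input_arrays :: arrays where
  "input_arrays a x = (if a = 0 then input_memory I k w u x else 0)"

lemma input_job:
  assumes "j < n"
  shows "input_memory I k w u (4 * j + 2) = proc I j" "input_memory I k w u (4 * j + 3) = release I j"
    "input_memory I k w u (4 * j + 4) = w j" "input_memory I k w u (4 * j + 5) = u j"
proof -
  have *: "input_memory I k w u (4 * j + 2 + i) = [proc I j, release I j, w j, u j] ! i" if "i < 4" for i
  proof -
    have "4 * j + 2 + i - 2 = 4 * j + i" "(4 * j + i) div 4 = j" "(4 * j + i) mod 4 = i"
      using that by auto
    then show ?thesis using assms by (simp add: input_memory_def Let_def)
  qed
  show "input_memory I k w u (4 * j + 2) = proc I j" "input_memory I k w u (4 * j + 3) = release I j"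
    "input_memory I k w u (4 * j + 4) = w j" "input_memory I k w u (4 * j + 5) = u j"
    using *[of 0] *[of 1] *[of 2] *[of 3] by (simp_all add: eval_nat_numeral)
qed

lemma u_less: "j < n \<Longrightarrow> u j < k"
  using factors by (simp add: factors_through_def)

lemma input_less: "input_memory I k w u a < 2 ^ b"
proof -
  have "n < 2 ^ b" "k < 2 ^ b" using X_less_b X_n X_k by linarith+
  moreover have "[proc I j, release I j, w j, u j] ! i < 2 ^ b" if "j < n" "i < 4" for i j
  proof -
    have "x < 2 ^ b" if "x \<in> set [proc I j, release I j, w j, u j]" for x
    proof -
      have "w j < 2 ^ b" "u j < 2 ^ b"
        using X_w[OF \<open>j < n\<close>] u_less[OF \<open>j < n\<close>] X_less_b X_k by linarith+
      then show ?thesis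
        using that less_power2_mono[OF proc_less[OF \<open>j < n\<close>] L_le_b]
          less_power2_mono[OF release_less[OF \<open>j < n\<close>] L_le_b] by auto
    qed
    moreover have "[proc I j, release I j, w j, u j] ! i \<in> set [proc I j, release I j, w j, u j]"
      using that(2) by (intro nth_mem) simp
    ultimately show ?thesis by blast
  qed
  ultimately show ?thesis by (simp add: input_memory_def Let_def)
qed

lemma input_rep: "rep (input_memory I k w u) input_arrays"
  unfolding rep_def
proof (intro conjI allI impI)
  show "input_memory I k w u 0 = n" by (simp add: input_memory_def)
  show "input_memory I k w u a < 2 ^ b" for a by (rule input_less)
  show "input_memory I k w u (addr n a x) = input_arrays a x" if "cell a x" for a x
  proof (cases "a = 0")
    case False
    \<comment> \<open>The input ends before the interleaved arrays begin, so all of these start out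
      as zero.\<close>
    have "4 * n + 2 \<le> base n" by (simp add: base_def)
    then have "4 * n + 2 \<le> addr n a x" using False by (simp add: addr_def)
    then have "n \<le> (addr n a x - 2) div 4" "addr n a x \<noteq> 0" "addr n a x \<noteq> 1" by auto
    then show ?thesis using False by (simp add: input_memory_def input_arrays_def Let_def)
  qed (simp add: addr_def input_arrays_def)
qed

lemma spec_gsp_com:
  "spec (gsp_com N) input_arrays (\<lambda>\<tau>. \<tau> xCount 0 \<le> (n + 1) * n \<and>
    approx_solution (1 + 1 / real N) I (real_pieces (pieces \<tau> (\<tau> xCount 0))))"
  (is "spec _ _ ?Q")
proof -
  have "spec (load N) input_arrays (\<lambda>\<tau>. spec (classify ;; dp ;; backtrack ;; schedule_jobs) \<tau> ?Q)"
  proof (rule spec_mono[OF spec_load])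
    show "input_arrays 0 (4 * j + 4) \<le> X" if "j < n" for j
      using X_w[OF that] input_job(3)[OF that] by (simp add: input_arrays_def)
    show "N < 2 ^ b" using X_N X_less_b by linarith
    show "n \<le> X" using X_n by simp
    show "input_arrays 0 x < 2 ^ b" for x using input_less by (simp add: input_arrays_def)
    fix \<tau> :: arrays
    assume ld: "\<forall>j<n. \<tau> aP j = input_arrays 0 (4 * j + 2) \<and> \<tau> aR j = input_arrays 0 (4 * j + 3) \<and>
      \<tau> aV j = rounded N (input_arrays 0 (4 * j + 4)) \<and> \<tau> aU j = input_arrays 0 (4 * j + 5)"
    \<comment> \<open>The whole arrays are taken as job data, also beyond \<open>n\<close>, so that
      \<open>loaded\<close> is an equality of functions; agreement with the instance is needed for
      \<open>j < n\<close> only. This is why the locale is interpreted inside the proof.\<close>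
    define p r v u' where "p = \<tau> aP" and "r = \<tau> aR" and "v = \<tau> aV" and "u' = \<tau> aU"
    have job: "p j = proc I j" "r j = release I j" "v j = rounded N (w j)" "u' j = u j" if "j < n" for j
      using ld input_job that by (auto simp: input_arrays_def p_def r_def v_def u'_def)
    have sum_p: "(\<Sum>j<n. p j) = (\<Sum>j<n. proc I j)" using job by (intro sum.cong) auto
    have keys: "(\<lambda>j. (r j, u' j, v j)) ` {..<n} =
        (\<lambda>j. (release I j, u j, rounded N (w j))) ` {..<n}"
      using job by (intro image_cong) auto
    interpret inst: instance_data q n k "horizon I" b X p r u' v L
    proof
      show "n + 1 \<le> X" using X_n by simp
      show "Suc n ^ jobs.classes n r u' v \<le> X"
        using X_states by (simp add: jobs.classes_def jobs.key_def[abs_def] keys)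
      show "0 < p j" "u' j < k" "v j \<le> X" if "j < n" for j
        using job[OF that] valid u_less[OF that] X_w[OF that] rounded_le[of N "w j"] that
        by (auto simp: valid_gsp_def)
      show "r j + (\<Sum>i<n. p i) \<le> horizon I" if "j < n" for j
        unfolding sum_p horizon_def using job that by (intro add_mono Max_ge) auto
      show "horizon I < 2 ^ b" by (rule horizon_less)
      show "fst (q i t) < 2 ^ L \<and> snd (q i t) < 2 ^ L \<and> 0 < snd (q i t)"
        if "i < k" "t \<le> horizon I" for i t
        using q_less[OF that] oracle_ok that by (auto simp: value_oracle_def)
      show "X * X * 2 ^ (L * X) < 2 ^ b" using X_less_power[OF L_pos] X_n by simp
    qed
    have l1: "inst.loaded \<tau>" unfolding inst.loaded_def by (simp only: p_def r_def v_def u'_def)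
    have "spec classify \<tau> (\<lambda>\<tau>. spec (dp ;; backtrack ;; schedule_jobs) \<tau> ?Q)"
    proof (rule spec_mono[OF inst.spec_classify[OF l1]])
      fix \<tau>2 :: arrays
      assume fr: "\<And>a. a \<notin> writes classify \<Longrightarrow> \<tau>2 a = \<tau> a" and c2: "inst.classified \<tau>2"
      have l2: "inst.loaded \<tau>2" by (rule inst.loaded_frame[OF l1]; rule fr; simp)
      have "spec dp \<tau>2 (\<lambda>\<tau>. spec (backtrack ;; schedule_jobs) \<tau> ?Q)"
      proof (rule spec_mono[OF inst.spec_dp[OF l2 c2]])
        fix \<tau>3 :: arrays
        assume fr3: "\<And>a. a \<notin> writes dp \<Longrightarrow> \<tau>3 a = \<tau>2 a"
          and sol: "\<forall>s<Suc n ^ inst.classes. inst.solved (\<tau>3 aNum) (\<tau>3 aDen) (\<tau>3 aChoice) s"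
        have l3: "inst.loaded \<tau>3" by (rule inst.loaded_frame[OF l2]; rule fr3; simp)
        have c3: "inst.classified \<tau>3" by (rule inst.classified_frame[OF c2]; rule fr3; simp)
        have "spec backtrack \<tau>3 (\<lambda>\<tau>. spec schedule_jobs \<tau> ?Q)"
        proof (rule spec_mono[OF inst.spec_backtrack[OF c3]])
          show "inst.solved (\<tau>3 aNum) (\<tau>3 aDen) (\<tau>3 aChoice) s" if "s < Suc n ^ inst.classes" for s
            using sol that by blast
          fix \<tau>4 :: arrays
          assume fr4: "\<And>a. a \<notin> writes backtrack \<Longrightarrow> \<tau>4 a = \<tau>3 a"
            and go: "inst.good_order (\<lambda>s. real (\<tau>3 aNum s) / real (\<tau>3 aDen s)) (\<tau>4 aOrd)"
          have l4: "inst.loaded \<tau>4" by (rule inst.loaded_frame[OF l3]; rule fr4; simp)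
          interpret ord: ordered_instance q n k "horizon I" b X p r u' v L "\<tau>4 aOrd"
            by unfold_locales (use go in \<open>simp add: inst.good_order_def\<close>)
          show "spec schedule_jobs \<tau>4 ?Q"
          proof (rule spec_mono[OF ord.spec_schedule_jobs[OF l4 refl]])
            fix \<tau>5 assume "ord.finished \<tau>5"
            then obtain rem where fin: "\<tau>5 xCount 0 \<le> (n + 1) * n"
              "ord.on_time inst.hor inst.hor rem (pieces \<tau>5 (\<tau>5 xCount 0))" "\<forall>j<n. rem j = 0"
              by (auto simp: ord.finished_def)
            have "approx_solution (1 + 1 / real N) I (real_pieces (pieces \<tau>5 (\<tau>5 xCount 0)))"
            proof (rule ord.approx_schedule[where w = w and g = g])
              show "proc I j = p j \<and> release I j = r j" if "j < n" for j using job[OF that] by simp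
              show "cost_fun I j t = real (w j) * g (u' j) t" if "j < n" "0 \<le> t" for j t
                using job[OF that(1)] factors that by (simp add: factors_through_def)
              show "cost_function (g (u' j))" if "j < n" for j
                using job[OF that] factors that by (simp add: factors_through_def)
              show "g (u' j) (real t) = inst.g_val (u' j) t" if "j < n" for j t
                using job[OF that] oracle_ok u_less[OF that] by (simp add: value_oracle_def inst.g_val_def)
              show "v j \<le> w j \<and> real (w j) \<le> (1 + 1 / real N) * real (v j)" if "j < n" for j
                using job[OF that] rounded_le rounded_approx[OF N_pos] by simp
              show "inst.solved (\<tau>3 aNum) (\<tau>3 aDen) (\<tau>3 aChoice) s" if "s < Suc n ^ inst.classes" for s
                using sol that by blast
              show "rem j = 0" if "j < n" for j using fin(3) that by blast
            qed (use fin go in auto)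
            then show "?Q \<tau>5" using fin(1) by blast
          qed
        qed
        then show "spec (backtrack ;; schedule_jobs) \<tau>3 ?Q" by (rule spec_Comp)
      qed
      then show "spec (dp ;; backtrack ;; schedule_jobs) \<tau>2 ?Q" by (rule spec_Comp)
    qed
    then show "spec (classify ;; dp ;; backtrack ;; schedule_jobs) \<tau> ?Q" by (rule spec_Comp)
  qed
  then show ?thesis unfolding gsp_com_def by (rule spec_Comp)
qed

text \<open>The final store trades the size in cell 0 for the number of pieces. Its cost is covered
  by adding one more constant to the weight.\<close>

theorem exec_gsp_prog:
  "\<exists>t M. exec q (gsp_prog N) (input_memory I k w u) t M \<and>
    t \<le> (weight (gsp_com N) + put_weight 0 (Lit 0) (var xCount)) *
      (X + 1) ^ depth (gsp_com N) * (b + 1) \<and>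
    approx_solution (1 + 1 / real N) I (output_schedule M)"
proof -
  define \<tau> where "\<tau> = run (gsp_com N) input_arrays"
  have ok: "ok (gsp_com N) input_arrays" and cnt: "\<tau> xCount 0 \<le> (n + 1) * n"
    and app: "approx_solution (1 + 1 / real N) I (real_pieces (pieces \<tau> (\<tau> xCount 0)))"
    using spec_gsp_com by (auto simp: spec_def \<tau>_def)
  obtain t M where t: "exec q (compile (gsp_com N)) (input_memory I k w u) t M" "rep M \<tau>"
    "t \<le> weight (gsp_com N) * (X + 1) ^ depth (gsp_com N) * (b + 1)"
    using compile_correct[OF wf_gsp_com input_rep ok] unfolding \<tau>_def by blast
  let ?e = "compile_exp (var xCount)"
  have M: "M a < 2 ^ b" for a using t(2) by (simp add: rep_def)
  have e: "val q M ?e = \<tau> xCount 0" "small q b M ?e"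
    using compile_exp_correct[OF t(2), of "var xCount"] by auto
  define t' where "t' = 1 + eval_cost q M (Const 0) + eval_cost q M ?e"
  have "exec q (Store (Const 0) ?e) M t' (M(0 := \<tau> xCount 0))"
    using exec.Store[of q "Const 0" ?e M] e by (simp add: t'_def)
  with t(1) have ex: "exec q (gsp_prog N) (input_memory I k w u) (t + t') (M(0 := \<tau> xCount 0))"
    unfolding gsp_prog_def by (rule exec.Seq)
  \<comment> \<open>Pieces occupy cells from 1 up to below \<open>base n\<close>, so the final store
    leaves them intact and the representation still describes them.\<close>
  have "output_schedule (M(0 := \<tau> xCount 0)) = real_pieces (pieces \<tau> (\<tau> xCount 0))"
  proof -
    have "M (3 * i + c) = \<tau> 0 (3 * i + c)" if "i < \<tau> xCount 0" "0 < c" "c \<le> 3" for i c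
    proof -
      have "3 * i + c \<le> 3 * ((n + 1) * n)" using that cnt by simp
      also have "\<dots> < base n" by (simp add: base_def algebra_simps)
      finally have "cell 0 (3 * i + c)" using that by (simp add: cell_def)
      then show ?thesis using t(2) by (force simp: rep_def addr_def)
    qed
    from this[of _ 1] this[of _ 2] this[of _ 3] show ?thesis
      by (simp add: output_schedule_def pieces_def)
  qed
  moreover have "t + t' \<le> (weight (gsp_com N) + put_weight 0 (Lit 0) (var xCount)) *
      (X + 1) ^ depth (gsp_com N) * (b + 1)"
  proof -
    let ?w = "put_weight 0 (Lit 0) (var xCount)" and ?Y = "(X + 1) ^ depth (gsp_com N)"
    have s0: "small q b M (Const 0)" by simp
    have "t' \<le> ?w * (b + 1)"
      using eval_cost_bound[where M = M and e = "Const 0", OF M b_pos s0]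
        eval_cost_bound[where M = M and e = ?e, OF M b_pos e(2)]
      by (simp add: t'_def addr_expr_def algebra_simps)
    also have "\<dots> \<le> ?w * ?Y * (b + 1)"
    proof (rule mult_le_mono1)
      have "?w * 1 \<le> ?w * ?Y" by (intro mult_le_mono2) simp
      then show "?w \<le> ?w * ?Y" by (simp only: mult_1_right)
    qed
    finally show ?thesis using t(3) by (simp add: distrib_right)
  qed
  ultimately show ?thesis using ex app by metis
qed

end


section \<open>Growth rates\<close>

lemma eventually_log2_ge: "\<forall>\<^sub>F n in sequentially. c \<le> log 2 (real n)"
proof -
  have "\<forall>\<^sub>F n in sequentially. nat \<lceil>2 powr c\<rceil> + 1 \<le> n" by (rule eventually_ge_at_top)
  then show ?thesis
  proof eventually_elim
    case (elim n)
    then have "2 powr c \<le> real n" by linarith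
    moreover have "0 < real n" using elim by simp
    ultimately show ?case by (simp add: le_log_iff)
  qed
qed

lemma polylog_mono: "polylog f \<Longrightarrow> (\<And>n. g n \<le> f n) \<Longrightarrow> polylog g"
proof -
  assume "polylog f" and le: "\<And>n. g n \<le> f n"
  then obtain c where "\<forall>\<^sub>F n in sequentially. f n \<le> log 2 (real n) ^ c"
    by (auto simp: polylog_def)
  then have "\<forall>\<^sub>F n in sequentially. g n \<le> log 2 (real n) ^ c"
    by (rule eventually_mono) (rule order_trans[OF le])
  then show ?thesis unfolding polylog_def by blast
qed

lemma polylog_const: "polylog (\<lambda>_. c)"
  unfolding polylog_def using eventually_log2_ge[of c] by (intro exI[of _ 1]) simp

text \<open>The factor 2 from adding two equal powers is absorbed by one more power of the
  logarithm.\<close>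

lemma polylog_add:
  assumes "polylog f" "polylog g"
  shows "polylog (\<lambda>n. f n + g n)"
proof -
  obtain a b where a: "\<forall>\<^sub>F n in sequentially. f n \<le> log 2 (real n) ^ a"
    and b: "\<forall>\<^sub>F n in sequentially. g n \<le> log 2 (real n) ^ b"
    using assms by (auto simp: polylog_def)
  have "\<forall>\<^sub>F n in sequentially. f n + g n \<le> log 2 (real n) ^ Suc (a + b)"
    using a b eventually_log2_ge[of 2]
  proof eventually_elim
    case (elim n)
    let ?l = "log 2 (real n)"
    have "?l ^ a \<le> ?l ^ (a + b)" "?l ^ b \<le> ?l ^ (a + b)"
      using elim by (auto intro!: power_increasing)
    then have "f n + g n \<le> 2 * ?l ^ (a + b)" using elim by linarith
    also have "\<dots> \<le> ?l * ?l ^ (a + b)" using elim by (intro mult_right_mono) auto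
    finally show ?case by simp
  qed
  then show ?thesis unfolding polylog_def by blast
qed

text \<open>\<open>polylog\<close> bounds from above only, so nonnegativity is needed to multiply
  the two bounds.\<close>

lemma polylog_mult:
  assumes "polylog f" "polylog g" "\<And>n. 0 \<le> f n" "\<And>n. 0 \<le> g n"
  shows "polylog (\<lambda>n. f n * g n)"
proof -
  obtain a b where a: "\<forall>\<^sub>F n in sequentially. f n \<le> log 2 (real n) ^ a"
    and b: "\<forall>\<^sub>F n in sequentially. g n \<le> log 2 (real n) ^ b"
    using assms by (auto simp: polylog_def)
  have "\<forall>\<^sub>F n in sequentially. f n * g n \<le> log 2 (real n) ^ (a + b)"
    using a b
  proof eventually_elim
    case (elim n)
    then have "f n * g n \<le> log 2 (real n) ^ a * log 2 (real n) ^ b"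
      using assms(3,4)[of n] by (intro mult_mono) auto
    then show ?case by (simp add: power_add)
  qed
  then show ?thesis unfolding polylog_def by blast
qed

lemma polylog_nat_floor: "polylog f \<Longrightarrow> polylog (\<lambda>n. real (nat \<lfloor>f n\<rfloor>))"
proof -
  assume "polylog f"
  then obtain a where a: "\<forall>\<^sub>F n in sequentially. f n \<le> log 2 (real n) ^ a"
    by (auto simp: polylog_def)
  have "\<forall>\<^sub>F n in sequentially. real (nat \<lfloor>f n\<rfloor>) \<le> log 2 (real n) ^ a"
    using a eventually_log2_ge[of 0]
  proof eventually_elim
    case (elim n)
    then have "0 \<le> log 2 (real n) ^ a" by simp
    then show ?case using elim by linarith
  qed
  then show ?thesis unfolding polylog_def by blast
qed

lemma polylog_log_add: "polylog (\<lambda>n. log 2 (real n + 2))"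
proof -
  have "\<forall>\<^sub>F n in sequentially. log 2 (real n + 2) \<le> log 2 (real n) ^ 2"
    using eventually_log2_ge[of 2] eventually_ge_at_top[of 2]
  proof eventually_elim
    case (elim n)
    have "real n + 2 \<le> real n * 2" using elim by simp
    then have "log 2 (real n + 2) \<le> log 2 (real n * 2)" using elim by simp
    also have "\<dots> = log 2 (real n) + 1" using elim by (simp add: log_mult)
    also have "\<dots> \<le> 2 * log 2 (real n)" using elim by simp
    also have "\<dots> \<le> log 2 (real n) * log 2 (real n)" using elim by (intro mult_right_mono) auto
    finally show ?case by (simp add: power2_eq_square)
  qed
  then show ?thesis unfolding polylog_def by blast
qed

text \<open>The summand 1 keeps the argument of the logarithm positive; its effect is absorbed by
  one more power.\<close>

lemma polylog_log_quasi_poly: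
  assumes "quasi_poly W"
  shows "polylog (\<lambda>n. log 2 (real (nat \<lfloor>W n\<rfloor>) + 1))"
proof -
  obtain c where c: "\<forall>\<^sub>F n in sequentially. W n \<le> 2 powr (log 2 (real n) ^ c)"
    using assms by (auto simp: quasi_poly_def)
  have "\<forall>\<^sub>F n in sequentially. log 2 (real (nat \<lfloor>W n\<rfloor>) + 1) \<le> log 2 (real n) ^ Suc c"
    using c eventually_log2_ge[of 2]
  proof eventually_elim
    case (elim n)
    let ?l = "log 2 (real n)"
    have l1: "1 \<le> ?l ^ c" using elim by simp
    have p: "1 \<le> 2 powr (?l ^ c)" using l1 by (simp add: ge_one_powr_ge_zero)
    have "real (nat \<lfloor>W n\<rfloor>) \<le> 2 powr (?l ^ c)" using elim(1) p by linarith
    then have "real (nat \<lfloor>W n\<rfloor>) + 1 \<le> 2 powr (1 + ?l ^ c)" using p by (simp add: powr_add)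
    then have "log 2 (real (nat \<lfloor>W n\<rfloor>) + 1) \<le> 1 + ?l ^ c" by (simp add: log_le_iff)
    also have "\<dots> \<le> 2 * ?l ^ c" using l1 by simp
    also have "\<dots> \<le> ?l * ?l ^ c" using elim l1 by (intro mult_right_mono) auto
    finally show ?case by simp
  qed
  then show ?thesis unfolding polylog_def by blast
qed

lemma quasi_poly_powr: "polylog h \<Longrightarrow> quasi_poly (\<lambda>n. 2 powr h n)"
  unfolding polylog_def quasi_poly_def by simp

lemma bits_le_log: "real (bits x) \<le> log 2 (real x + 1) + 1"
proof (cases "x = 0")
  case False
  then have "real (bits x) = of_int \<lfloor>log 2 (real x)\<rfloor> + 1"
    by (simp add: floorlog_def)
  also have "\<dots> \<le> log 2 (real x) + 1" by simp
  also have "log 2 (real x) \<le> log 2 (real x + 1)" using False by simp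
  finally show ?thesis by simp
qed (simp add: floorlog_def)

text \<open>\<open>K\<close>, \<open>D\<close> and \<open>W\<close> influence only the time bound:
  the witness for the program is determined by \<epsilon>, and the time is linear in the number
  length.\<close>

theorem theorem4:
  fixes K D W :: "nat \<Rightarrow> real"
  assumes "polylog K" and "polylog D" and "quasi_poly W"
  shows "\<forall>\<epsilon>>0. \<exists>P T d. quasi_poly T \<and>
    (\<forall>I k g w u q.
       valid_gsp I \<and>
       factors_through I k g w u \<and>
       real k \<le> K (njobs I) \<and>
       real (card (release I ` {..<njobs I})) \<le> D (njobs I) \<and>
       (\<forall>j<njobs I. real (w j) \<le> W (njobs I)) \<and>
       value_oracle k g q \<longrightarrow>
       (\<exists>t M. exec q P (input_memory I k w u) t M \<and>
          real t \<le> T (njobs I) * real (number_length I k q) ^ d \<and>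
          approx_solution (1 + \<epsilon>) I (output_schedule M)))"
proof (intro allI impI)
  fix \<epsilon> :: real assume \<epsilon>: "0 < \<epsilon>"
  \<comment> \<open>Makes the rounding loss \<open>1 + 1/N\<close> at most
    \<open>1 + \<epsilon>\<close>.\<close>
  define N where "N = nat \<lceil>1 / \<epsilon>\<rceil>"
  have N_ge: "1 / \<epsilon> \<le> real N" and "0 < 1 / \<epsilon>" using \<epsilon> by (auto simp: N_def)
  then have "0 < real N" by linarith
  then have N: "0 < N" "1 / real N \<le> \<epsilon>"
    using N_ge \<epsilon> by (simp_all add: field_simps)
  define kk where "kk n = nat \<lfloor>K n\<rfloor>" for n
  define dd where "dd n = nat \<lfloor>D n\<rfloor>" for n
  define ww where "ww n = nat \<lfloor>W n\<rfloor>" for n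
  \<comment> \<open>Bound on the number of classes: release dates times functions times grid values
    below \<open>2 ^ bits (ww n)\<close>.\<close>
  define m where "m n = dd n * kk n * (1 + N * bits (ww n))" for n
  \<comment> \<open>A product instead of a maximum, so that its logarithm \<open>h\<close> is a sum
    of terms each of which is polylogarithmic.\<close>
  define X where "X n = (n + 2) * (N + 1) * (kk n + 1) * (ww n + 1) * (n + 2) ^ m n" for n
  define c where "c = weight (gsp_com N) + put_weight 0 (Lit 0) (var xCount)"
  define e where "e = depth (gsp_com N)"
  define h where "h n = log 2 (real (n + 2)) + log 2 (real (N + 1)) + log 2 (real (kk n + 1)) +
    log 2 (real (ww n + 1)) + real (m n) * log 2 (real (n + 2))" for n
  have X_powr: "real (X n) = 2 powr h n" for n
  proof -
    have log: "2 powr log 2 (real (Suc y)) = real (Suc y)" for y by simp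
    have "2 powr (real (m n) * log 2 (real (n + 2))) = (2 powr log 2 (real (n + 2))) powr real (m n)"
      by (simp only: powr_powr mult.commute)
    also have "\<dots> = real (n + 2) ^ m n" using log[of "n + 1"] by (simp add: powr_realpow)
    finally show ?thesis
      using log[of "n + 1"] log[of N] log[of "kk n"] log[of "ww n"]
      by (simp only: X_def h_def powr_add of_nat_mult of_nat_power Suc_eq_plus1 add.assoc one_add_one)
  qed
  \<comment> \<open>With \<open>X + 1 \<le> 2 * X\<close> and
    \<open>4 * L * X + 1 \<le> 5 * L * (2 * X)\<close> the time
    \<open>c * (X + 1) ^ e * (b + 1)\<close> takes this form, apart from the factor
    \<open>L\<close>.\<close>
  define T where "T n = real (5 * c) * (2 * real (X n)) ^ Suc e" for n
  have c_pos: "0 < c" by (simp add: c_def)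
  have T_powr: "T n = 2 powr (log 2 (real (5 * c)) + real (Suc e) * (1 + h n))" for n
  proof -
    have "2 * real (X n) = 2 powr (1 + h n)" by (simp add: X_powr powr_add)
    then have "(2 * real (X n)) ^ Suc e = 2 powr (real (Suc e) * (1 + h n))"
      by (simp add: powr_realpow[symmetric] powr_powr mult.commute del: power_Suc of_nat_Suc)
    then show ?thesis using c_pos by (simp add: T_def powr_add del: power_Suc of_nat_Suc)
  qed
  have log_n: "polylog (\<lambda>n. log 2 (real (n + 2)))" using polylog_log_add by (simp add: add.commute)
  have log_w: "polylog (\<lambda>n. log 2 (real (ww n + 1)))"
    using polylog_log_quasi_poly[OF assms(3)] by (simp add: ww_def add.commute)
  have pk: "polylog (\<lambda>n. real (kk n))" unfolding kk_def by (rule polylog_nat_floor[OF assms(1)])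
  have pd: "polylog (\<lambda>n. real (dd n))" unfolding dd_def by (rule polylog_nat_floor[OF assms(2)])
  have log_k: "polylog (\<lambda>n. log 2 (real (kk n + 1)))"
  proof (rule polylog_mono[OF pk])
    fix n
    have "real (kk n + 1) \<le> 2 ^ kk n"
      using of_nat_mono[of "kk n + 1" "2 ^ kk n", where 'a = real] less_exp[of "kk n"] by simp
    then show "log 2 (real (kk n + 1)) \<le> real (kk n)" by (simp add: log_le_iff powr_realpow)
  qed
  have pb: "polylog (\<lambda>n. real (bits (ww n)))"
    by (rule polylog_mono[OF polylog_add[OF log_w polylog_const[of 1]]])
      (use bits_le_log in \<open>simp add: add.commute\<close>)
  have pm: "polylog (\<lambda>n. real (m n))"
    unfolding m_def of_nat_mult of_nat_add
    by (intro polylog_mult polylog_add polylog_const pk pd pb) auto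
  have ph: "polylog h"
    unfolding h_def[abs_def]
    by (intro polylog_add polylog_mult polylog_const log_n log_w log_k pm) auto
  have h_nonneg: "0 \<le> h n" for n
    unfolding h_def by (intro add_nonneg_nonneg mult_nonneg_nonneg) auto
  have "polylog (\<lambda>n. log 2 (real (5 * c)) + real (Suc e) * (1 + h n))"
    by (intro polylog_add polylog_mult polylog_const ph) (use h_nonneg in \<open>auto intro: add_nonneg_nonneg\<close>)
  then have "quasi_poly T" unfolding T_powr[abs_def] by (rule quasi_poly_powr)
  moreover have "\<exists>t M. exec q (gsp_prog N) (input_memory I k w u) t M \<and>
      real t \<le> T (njobs I) * real (number_length I k q) ^ 1 \<and>
      approx_solution (1 + \<epsilon>) I (output_schedule M)"
    if I: "valid_gsp I" "factors_through I k g w u" "real k \<le> K (njobs I)"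
      "real (card (release I ` {..<njobs I})) \<le> D (njobs I)"
      "\<forall>j<njobs I. real (w j) \<le> W (njobs I)" "value_oracle k g q" for I k g w u q
  proof -
    define n where "n = njobs I"
    define x where "x = X n"
    have kk: "k \<le> kk n" using I(3) by (simp add: kk_def n_def le_nat_floor)
    have dd: "card (release I ` {..<n}) \<le> dd n" using I(4) by (simp add: dd_def n_def le_nat_floor)
    have ww: "w j \<le> ww n" if "j < n" for j using I(5) that by (simp add: ww_def n_def le_nat_floor)
    let ?keys = "(\<lambda>j. (release I j, u j, rounded N (w j))) ` {..<n}"
    have "?keys \<subseteq> (release I ` {..<n}) \<times> ({..<k} \<times> grid N ` {..<1 + N * bits (ww n)})"
    proof (rule image_subsetI)
      fix j assume j: "j \<in> {..<n}"
      have "ww n < 2 ^ bits (ww n)" using floorlog_le_iff[of 2 "ww n" "bits (ww n)"] by simp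
      then have "w j < 2 ^ bits (ww n)" using ww[of j] j by simp
      then have "rounded N (w j) \<in> grid N ` {..<1 + N * bits (ww n)}" by (rule rounded_mem[OF N(1)])
      moreover have "u j < k" using j I(2) by (simp add: factors_through_def n_def)
      ultimately show "(release I j, u j, rounded N (w j)) \<in>
          release I ` {..<n} \<times> ({..<k} \<times> grid N ` {..<1 + N * bits (ww n)})"
        using j by blast
    qed
    then have "card ?keys \<le> card ((release I ` {..<n}) \<times> ({..<k} \<times> grid N ` {..<1 + N * bits (ww n)}))"
      by (intro card_mono) auto
    also have "\<dots> = card (release I ` {..<n}) * (k * card (grid N ` {..<1 + N * bits (ww n)}))"
      by simp
    also have "\<dots> \<le> dd n * (kk n * (1 + N * bits (ww n)))"
      using dd kk card_image_le[of "{..<1 + N * bits (ww n)}" "grid N"] by (intro mult_le_mono) auto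
    finally have keys: "card ?keys \<le> m n" by (simp only: m_def mult.assoc)
    \<comment> \<open>All factors of \<open>X\<close> are positive, so the product dominates each of
      them.\<close>
    have fac: "a * b * c * d * f \<ge> y"
      if "0 < a" "0 < b" "0 < c" "0 < d" "0 < f" "y \<le> a \<or> y \<le> b \<or> y \<le> c \<or> y \<le> d \<or> y \<le> f"
      for a b c d f y :: nat
      using that by (auto intro: order_trans[of y])
    interpret inp: gsp_input I k g w u q N x
    proof
      show "njobs I + 2 \<le> x" unfolding x_def X_def n_def[symmetric] by (rule fac) auto
      show "k \<le> x" unfolding x_def X_def by (rule fac) (use kk in auto)
      show "N \<le> x" unfolding x_def X_def by (rule fac) auto
      show "w j \<le> x" if "j < njobs I" for j
        unfolding x_def X_def by (rule fac) (use ww[of j] that in \<open>auto simp: n_def\<close>)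
      have "Suc n ^ card ?keys \<le> (n + 2) ^ card ?keys" by (intro power_mono) auto
      also have "\<dots> \<le> (n + 2) ^ m n" using keys by (intro power_increasing) auto
      finally show "Suc (njobs I) ^ card ((\<lambda>j. (release I j, u j, rounded N (w j))) ` {..<njobs I}) \<le> x"
        unfolding x_def X_def n_def[symmetric] by (intro fac disjI2) simp_all
    qed (use I N in auto)
    obtain t M where t: "exec q (gsp_prog N) (input_memory I k w u) t M"
      "t \<le> c * (x + 1) ^ e * (4 * number_length I k q * x + 1)"
      "approx_solution (1 + 1 / real N) I (output_schedule M)"
      using inp.exec_gsp_prog unfolding c_def e_def by blast
    let ?L = "number_length I k q"
    have x1: "1 \<le> x" using inp.X_n by simp
    have "4 * ?L * x + 1 \<le> 5 * ?L * (2 * x)"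
    proof -
      have "1 * 1 \<le> ?L * x" using inp.L_pos x1 by (intro mult_le_mono) auto
      then show ?thesis by simp
    qed
    then have "t \<le> c * (2 * x) ^ e * (5 * ?L * (2 * x))"
      using t(2) x1 by (elim order_trans) (intro mult_le_mono power_mono, auto)
    also have "\<dots> = 5 * c * (2 * x) ^ Suc e * ?L" by simp
    finally have "real t \<le> real (5 * c * (2 * x) ^ Suc e * ?L)" by (rule of_nat_mono)
    then have "real t \<le> T n * real ?L ^ 1" by (simp add: T_def x_def)
    moreover have "approx_solution (1 + \<epsilon>) I (output_schedule M)"
    proof -
      \<comment> \<open>Passing from \<open>1/N\<close> to \<epsilon> requires a nonnegative
        optimum, which follows from the cost of the schedule just found.\<close>
      have "0 \<le> total_cost I (output_schedule M)"
        unfolding total_cost_def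
      proof (rule sum_nonneg)
        fix j assume "j \<in> {..<njobs I}"
        then have j: "j < njobs I" "0 < proc I j" "cost_function (cost_fun I j)"
          using I(1) by (auto simp: valid_gsp_def)
        then show "0 \<le> cost_fun I j (completion (output_schedule M) j)"
          using feasible_completion_nonneg[of I "output_schedule M" j] t(3)
          by (auto simp: approx_solution_def cost_function_def)
      qed
      also have "\<dots> \<le> (1 + 1 / real N) * opt_cost I" using t(3) by (simp add: approx_solution_def)
      finally have "0 \<le> opt_cost I"
        by (metis add_pos_nonneg divide_nonneg_nonneg of_nat_0_le_iff zero_le_mult_iff zero_le_one
            zero_less_one not_less)
      then have "(1 + 1 / real N) * opt_cost I \<le> (1 + \<epsilon>) * opt_cost I"
        using N(2) by (intro mult_right_mono) auto
      then show ?thesis using t(3) by (auto simp: approx_solution_def)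
    qed
    ultimately show ?thesis using t(1) n_def by blast
  qed
  ultimately show "\<exists>P T d. quasi_poly T \<and>
    (\<forall>I k g w u q.
       valid_gsp I \<and>
       factors_through I k g w u \<and>
       real k \<le> K (njobs I) \<and>
       real (card (release I ` {..<njobs I})) \<le> D (njobs I) \<and>
       (\<forall>j<njobs I. real (w j) \<le> W (njobs I)) \<and>
       value_oracle k g q \<longrightarrow>
       (\<exists>t M. exec q P (input_memory I k w u) t M \<and>
          real t \<le> T (njobs I) * real (number_length I k q) ^ d \<and>
          approx_solution (1 + \<epsilon>) I (output_schedule M)))"
    by (intro exI[of _ "gsp_prog N"] exI[of _ T] exI[of _ 1]) blast
qed

end
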